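(* Let $\Phi\in L^\infty(\mathbb{M}_{n,n})$ satisfy $\|H_\Phi\|_{\mathrm e}<1$. Then $\Phi$ has a unitary interpolant $U$ satisfying $\|H_{U^*}\|_{\mathrm e}<1$ if and only if $\|H_\Phi\|\le 1$.
   Context: $\mathbb{T}$ is the unit circle, $\mathbb{M}_{m,n}$ the space of complex $m\times n$ matrices. $H^2(\mathbb{C}^n)$ is the vector-valued Hardy space, $H^2_-(\mathbb{C}^m)=L^2(\mathbb{C}^m)\ominus H^2(\mathbb{C}^m)$, and $\mathbb{P}_-$ is the orthogonal projection onto $H^2_-$. For $\Phi\in L^\infty(\mathbb{M}_{m,n})$ the Hankel operator $H_\Phi:H^2(\mathbb{C}^n)\to H^2_-(\mathbb{C}^m)$ is $H_\Phi f=\mathbb{P}_-\Phi f$; $\|\cdot\|_{\mathrm e}$ denotes the essential norm (distance to the compact operators). A unitary interpolant of $\Phi\in L^\infty(\mathbb{M}_{n,n})$ is a function $U\in L^\infty(\mathbb{M}_{n,n})$ whose values are unitary matrices a.e. on $\mathbb{T}$ and such that $\hat U(j)=\hat\Phi(j)$ for all $j<0$ (equivalently $\Phi-U\in H^\infty(\mathbb{M}_{n,n})$). *)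

theory Defs
  imports "HOL-Analysis.Analysis"
begin

section \<open>The unit circle, parametrised by t \<mapsto> e^{it}, t \<in> [0, 2\<pi>]\<close>

definition Tm :: "real measure" where
  "Tm = lebesgue_on {0..2*pi}"

text \<open>Vector-valued functions on the circle: real \<Rightarrow> complex^'n (only values on [0,2pi] matter).\<close>

definition fcoef :: "(real \<Rightarrow> complex^'n) \<Rightarrow> int \<Rightarrow> complex^'n" where
  "fcoef f j = (\<chi> k. integral\<^sup>L Tm (\<lambda>t. f t $ k * cis (- of_int j * t)) / (2 * pi))"

definition mcoef :: "(real \<Rightarrow> complex^'n^'m) \<Rightarrow> int \<Rightarrow> complex^'n^'m" where
  "mcoef F j = (\<chi> a b. integral\<^sup>L Tm (\<lambda>t. F t $ a $ b * cis (- of_int j * t)) / (2 * pi))"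

definition L2 :: "(real \<Rightarrow> complex^'n) set" where
  "L2 = {f. f \<in> borel_measurable Tm \<and> integrable Tm (\<lambda>t. (norm (f t))\<^sup>2)}"

definition L2norm :: "(real \<Rightarrow> complex^'n) \<Rightarrow> real" where
  "L2norm f = sqrt (integral\<^sup>L Tm (\<lambda>t. (norm (f t))\<^sup>2) / (2 * pi))"

definition H2 :: "(real \<Rightarrow> complex^'n) set" where
  "H2 = {f \<in> L2. \<forall>j<0. fcoef f j = 0}"

definition H2minus :: "(real \<Rightarrow> complex^'n) set" where
  "H2minus = {f \<in> L2. \<forall>j\<ge>0. fcoef f j = 0}"

text \<open>Orthogonal projection P_- of L2 onto H2_- (determined up to a.e. equality).\<close>
definition Pminus :: "(real \<Rightarrow> complex^'n) \<Rightarrow> (real \<Rightarrow> complex^'n)" where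
  "Pminus g = (SOME h. h \<in> H2minus \<and> (\<forall>j<0. fcoef h j = fcoef g j))"

definition Linf :: "(real \<Rightarrow> complex^'n^'m) set" where
  "Linf = {F. F \<in> borel_measurable Tm \<and> (\<exists>C. AE t in Tm. norm (F t) \<le> C)}"

definition hankel :: "(real \<Rightarrow> complex^'n^'m) \<Rightarrow> (real \<Rightarrow> complex^'n) \<Rightarrow> (real \<Rightarrow> complex^'m)" where
  "hankel F f = Pminus (\<lambda>t. F t *v f t)"

definition opnorm :: "((real \<Rightarrow> complex^'n) \<Rightarrow> (real \<Rightarrow> complex^'m)) \<Rightarrow> real" where
  "opnorm T = Sup {L2norm (T f) | f. f \<in> H2 \<and> L2norm f \<le> 1}"

text \<open>Compact (linear) operators H2(C^n) \<rightarrow> H2_-(C^m): linear, and the image of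
  the unit ball is relatively compact (every bounded sequence has a subsequence
  whose image is Cauchy in L2; L2 is complete).\<close>
definition compact_op :: "((real \<Rightarrow> complex^'n) \<Rightarrow> (real \<Rightarrow> complex^'m)) \<Rightarrow> bool" where
  "compact_op K \<longleftrightarrow>
     (\<forall>f\<in>H2. K f \<in> H2minus) \<and>
     (\<forall>f\<in>H2. \<forall>g\<in>H2. \<forall>c::complex.
        AE t in Tm. K (\<lambda>s. c *s f s + g s) t = c *s K f t + K g t) \<and>
     (\<forall>u::nat \<Rightarrow> real \<Rightarrow> complex^'n. (\<forall>k. u k \<in> H2 \<and> L2norm (u k) \<le> 1) \<longrightarrow>
        (\<exists>r::nat \<Rightarrow> nat. strict_mono r \<and>
           (\<forall>e>0. \<exists>N. \<forall>p\<ge>N. \<forall>q\<ge>N.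
               L2norm (\<lambda>t. K (u (r p)) t - K (u (r q)) t) < e)))"

definition ess_norm :: "((real \<Rightarrow> complex^'n) \<Rightarrow> (real \<Rightarrow> complex^'m)) \<Rightarrow> real" where
  "ess_norm T = Inf {opnorm (\<lambda>f t. T f t - K f t) | K. compact_op K}"

definition cadj :: "complex^'n^'m \<Rightarrow> complex^'m^'n" where
  "cadj A = (\<chi> i j. cnj (A $ j $ i))"

definition unitary_mat :: "complex^'n^'n \<Rightarrow> bool" where
  "unitary_mat U \<longleftrightarrow> U ** cadj U = mat 1 \<and> cadj U ** U = mat 1"

definition unitary_interpolant :: "(real \<Rightarrow> complex^'n^'n) \<Rightarrow> (real \<Rightarrow> complex^'n^'n) \<Rightarrow> bool" where
  "unitary_interpolant F U \<longleftrightarrow>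
     U \<in> Linf \<and> (AE t in Tm. unitary_mat (U t)) \<and> (\<forall>j<0. mcoef U j = mcoef F j)"

end

theory Submission
  imports Defs
begin

text \<open>
  If \<open>U\<close> is a unitary interpolant, then \<open>H\<^sub>\<Phi> = H\<^sub>U\<close> is a contraction. For the converse let \<open>C\<close>
  range over the constant matrices for which \<open>\<Gamma>\<^sub>C\<close>, the Hankel operator with symbol \<open>z\<^sup>-\<^sup>1 (\<Phi> + C)\<close>,
  is a contraction; Parrott's theorem provides such matrices, and they form a compact convex set. Choose \<open>C\<close>
  of maximal Frobenius norm. Since \<open>\<parallel>\<Gamma>\<^sub>C\<parallel>\<^sub>e < 1\<close>, the operator \<open>\<Gamma>\<^sub>C\<close> has a spectral gap below \<open>1\<close>, and
  extremality of \<open>C\<close> forces either the values \<open>f(0)\<close> or the first coefficients of \<open>\<Gamma>\<^sub>C f\<close>, where \<open>f\<close> runs through the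
  maximising vectors, to fill \<open>\<complex>\<^sup>n\<close>. By Nehari's theorem (obtained by iterating Parrott's theorem)
  \<open>\<Gamma>\<^sub>C\<close> has a contractive symbol \<open>F\<close>. It is isometric along every maximising vector \<open>f\<close>,
  or coisometric along \<open>F f = \<Gamma>\<^sub>C f\<close>; as these vectors span \<open>\<complex>\<^sup>n\<close> almost everywhere, \<open>F\<close> is unitary-valued and
  \<open>U = z F\<close> is a unitary interpolant. Finally, if \<open>F\<^sup>* g = h\<close> with \<open>g\<close> in \<open>H\<^sup>2\<close> and \<open>h\<close> in \<open>H\<^sup>2\<^sub>-\<close>, then
  \<open>g\<^sup>* (F f) = h\<^sup>* f\<close> is both antianalytic and analytic, hence zero, so \<open>g = 0\<close>. Thus the Toeplitz operator \<open>T\<^sub>F\<close>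
  has closed dense range, which gives \<open>\<parallel>H\<^bsub>F\<^sup>*\<^esub>\<parallel> < 1\<close>, and \<open>H\<^bsub>U\<^sup>*\<^esub>\<close> is a finite rank
  perturbation of a shift of \<open>H\<^bsub>F\<^sup>*\<^esub>\<close>.
\<close>

section \<open>Hilbert space preliminaries\<close>

text \<open>A Hankel operator of norm below 1 preserves the norm of no nonzero vector, so nothing
  forces a contractive symbol to be unitary. The factor z^-1 adds one free coefficient, and pushing
  it to the boundary of the contractive completions creates maximising vectors. Perturbing
  \<open>C\<close> by a b^*, with b orthogonal to all f(0) and a orthogonal to all first
  coefficients of the images, leaves the maximising vectors untouched, and on their complement the
  change only has to fit into the spectral gap. An extreme point leaves no room for such a pair, so
  one of the two ranges is everything. Either alternative is enough because the matrices are square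
  and a one-sided inverse is two-sided. Multiplication by z moves \<open>C\<close> to index 0, which
  interpolation ignores, but it puts z^-1 into the adjoint symbol; the resulting finite rank term is
  why the estimate obtained for \<open>U\<close> is one of essential norm. Hilbert spaces are real
  throughout, and multiplication by i is carried along as an operator.\<close>

lemma parallelogram_inner:
  fixes x y :: "'a::real_inner"
  shows "(norm (x + y))\<^sup>2 + (norm (x - y))\<^sup>2 = 2 * (norm x)\<^sup>2 + 2 * (norm y)\<^sup>2"
  by (simp add: power2_norm_eq_inner algebra_simps inner_commute)

lemma norm_add_sq:
  fixes x y :: "'a::real_inner"
  shows "(norm (x + y))\<^sup>2 = (norm x)\<^sup>2 + 2 * inner x y + (norm y)\<^sup>2"
  by (simp add: power2_norm_eq_inner algebra_simps inner_commute)

text \<open>First variation: for b > 0 the value at t = -a/b is -a^2/b, and for b = 0 the expression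
  is linear in t. Best approximation and maximality of a vector are both exploited through
  this.\<close>

lemma linear_quadratic_nonneg_imp_zero:
  fixes a b :: real
  assumes "\<And>t. 2 * t * a + t\<^sup>2 * b \<ge> 0" "b \<ge> 0"
  shows "a = 0"
proof (rule ccontr)
  assume a: "a \<noteq> 0"
  show False
  proof (cases "b = 0")
    case True
    then show False using assms(1)[of "- a"] a
      by (simp add: power2_eq_square[symmetric])
  next
    case False
    with assms have b: "b > 0" by simp
    have "2 * (- a / b) * a + (- a / b)\<^sup>2 * b = - (a\<^sup>2 / b)"
      using b by (simp add: power2_eq_square field_simps)
    moreover have "a\<^sup>2 / b > 0" using a b by simp
    ultimately show False using assms(1)[of "- a / b"] by linarith
  qed
qed

text \<open>A minimising sequence for the distance is Cauchy by the parallelogram identity, since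
  midpoints stay in \<open>M\<close>; orthogonality is the first variation at the limit.\<close>

theorem hilbert_projection:
  fixes M :: "'a::{real_inner,complete_space} set"
  assumes M: "subspace M" "closed M"
  obtains p where "p \<in> M" "\<And>m. m \<in> M \<Longrightarrow> inner (x - p) m = 0"
proof -
  define d where "d = Inf ((\<lambda>m. (norm (x - m))\<^sup>2) ` M)"
  have ne: "M \<noteq> {}" using M subspace_0 by blast
  have lb: "d \<le> (norm (x - m))\<^sup>2" if "m \<in> M" for m
    unfolding d_def by (rule cInf_lower) (use that in \<open>auto intro!: bdd_belowI[of _ 0]\<close>)
  have "\<exists>m\<in>M. (norm (x - m))\<^sup>2 < d + 1 / Suc k" for k
    using cInf_lessD[of "(\<lambda>m. (norm (x - m))\<^sup>2) ` M" "d + 1 / Suc k"] ne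
    unfolding d_def by (auto simp add: divide_simps)
  then obtain u where u: "\<And>k. u k \<in> M" "\<And>k. (norm (x - u k))\<^sup>2 < d + 1 / Suc k"
    by metis
  have est: "(norm (u p - u q))\<^sup>2 \<le> 2 / Suc p + 2 / Suc q" for p q
  proof -
    have "(1/2) *\<^sub>R (u p + u q) \<in> M" using M u by (simp add: subspace_add subspace_scale)
    then have "4 * d \<le> 4 * (norm (x - (1/2) *\<^sub>R (u p + u q)))\<^sup>2" using lb by simp
    also have "\<dots> = (norm (2 *\<^sub>R (x - (1/2) *\<^sub>R (u p + u q))))\<^sup>2"
      by (simp only: norm_scaleR power_mult_distrib) simp
    also have "2 *\<^sub>R (x - (1/2) *\<^sub>R (u p + u q)) = (x - u p) + (x - u q)"
      by (simp add: algebra_simps scaleR_2)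
    finally have "4 * d \<le> (norm ((x - u p) + (x - u q)))\<^sup>2" .
    moreover have "norm (u p - u q) = norm ((x - u p) - (x - u q))"
      by (simp add: norm_minus_commute)
    moreover note parallelogram_inner[of "x - u p" "x - u q"] u(2)[of p] u(2)[of q]
    ultimately show ?thesis by auto
  qed
  have "Cauchy u"
  proof (rule metric_CauchyI)
    fix e :: real assume e: "e > 0"
    obtain N where N: "4 / e\<^sup>2 < real N" using reals_Archimedean2 by blast
    have "dist (u p) (u q) < e" if "p \<ge> N" "q \<ge> N" for p q
    proof -
      have "N > 0" using N e by (smt (verit) divide_nonneg_pos of_nat_0 not_gr_zero zero_less_power)
      have "2 / Suc p \<le> 2 / real (Suc N)" "2 / Suc q \<le> 2 / real (Suc N)"
        using that by (auto simp: divide_simps)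
      then have "(norm (u p - u q))\<^sup>2 \<le> 4 / real (Suc N)" using est[of p q] by simp
      also have "\<dots> < e\<^sup>2" using N e
        by (simp add: field_simps) (smt (verit) zero_less_power)
      finally show ?thesis using e by (simp add: dist_norm power_less_imp_less_base)
    qed
    then show "\<exists>N. \<forall>p\<ge>N. \<forall>q\<ge>N. dist (u p) (u q) < e" by blast
  qed
  then obtain p where p: "u \<longlonglongrightarrow> p" using convergent_eq_Cauchy by blast
  have pM: "p \<in> M" using M(2) u(1) p closed_sequentially by blast
  have "(\<lambda>k. (norm (x - u k))\<^sup>2) \<longlonglongrightarrow> (norm (x - p))\<^sup>2" by (intro tendsto_intros p)
  moreover have "(\<lambda>k. d + 1 / Suc k) \<longlonglongrightarrow> d + 0"
    by (intro tendsto_intros LIMSEQ_Suc[OF lim_const_over_n])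
  ultimately have pd: "(norm (x - p))\<^sup>2 \<le> d"
    using LIMSEQ_le[of "\<lambda>k. (norm (x - u k))\<^sup>2" _ "\<lambda>k. d + 1 / Suc k" "d + 0"] u(2)
    by (auto simp: less_imp_le)
  have "inner (x - p) m = 0" if m: "m \<in> M" for m
  proof (rule linear_quadratic_nonneg_imp_zero[of _ "(norm m)\<^sup>2"])
    fix t :: real
    have "p - t *\<^sub>R m \<in> M" using M pM m by (simp add: subspace_diff subspace_scale)
    moreover have "x - (p - t *\<^sub>R m) = (x - p) + t *\<^sub>R m" by (simp add: algebra_simps)
    ultimately have "(norm (x - p))\<^sup>2 \<le> (norm ((x - p) + t *\<^sub>R m))\<^sup>2"
      using lb[of "p - t *\<^sub>R m"] pd by (metis order_trans)
    also have "\<dots> = (norm (x - p))\<^sup>2 + 2 * t * inner (x - p) m + t\<^sup>2 * (norm m)\<^sup>2"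
      by (subst norm_add_sq) (simp add: power_mult_distrib)
    finally show "0 \<le> 2 * t * inner (x - p) m + t\<^sup>2 * (norm m)\<^sup>2" by simp
  qed simp
  with pM that show thesis by blast
qed

lemmas bl_add = linear_add[OF bounded_linear.linear]
lemmas bl_diff = linear_diff[OF bounded_linear.linear]
lemmas bl_scaleR = linear_scale[OF bounded_linear.linear]
lemmas bl_zero = linear_0[OF bounded_linear.linear]
lemmas bl_sum = linear_sum[OF bounded_linear.linear]

section \<open>Maximising vectors\<close>

text \<open>The only consequence of \<open>\<parallel>G\<parallel>\<^sub>e < \<theta>\<close> that is ever used: up to a compact
  error, \<open>G\<close> contracts differences by the factor \<open>\<theta>\<close>.\<close>

definition ess_contracts :: "real \<Rightarrow> ('a::real_inner \<Rightarrow> 'b::real_inner) \<Rightarrow> bool" where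
  "ess_contracts \<theta> G \<longleftrightarrow> (\<forall>u. (\<forall>k::nat. norm (u k) \<le> 1) \<longrightarrow>
     (\<exists>r::nat\<Rightarrow>nat. strict_mono r \<and> (\<forall>e>0. \<exists>N. \<forall>p\<ge>N. \<forall>q\<ge>N.
        norm (G (u (r p)) - G (u (r q))) \<le> \<theta> * norm (u (r p) - u (r q)) + e)))"

lemma ess_contractsD:
  assumes "ess_contracts \<theta> G" "\<And>k. norm (u k) \<le> 1"
  obtains r where "strict_mono (r::nat\<Rightarrow>nat)" "\<And>e. e > 0 \<Longrightarrow> \<exists>N. \<forall>p\<ge>N. \<forall>q\<ge>N.
        norm (G (u (r p)) - G (u (r q))) \<le> \<theta> * norm (u (r p) - u (r q)) + e"
proof -
  have "\<exists>r::nat\<Rightarrow>nat. strict_mono r \<and> (\<forall>e>0. \<exists>N. \<forall>p\<ge>N. \<forall>q\<ge>N.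
        norm (G (u (r p)) - G (u (r q))) \<le> \<theta> * norm (u (r p) - u (r q)) + e)"
    using assms unfolding ess_contracts_def by simp
  then show thesis by (elim exE conjE) (rule that, assumption, blast)
qed

text \<open>A genuine contraction has no compact error, so the identity subsequence works. With
  \<open>\<theta>\<close> = 1 this makes Parrott's theorem accessible to the compactness argument
  for maximising sequences.\<close>

lemma ess_contracts_contraction:
  assumes "bounded_linear G" "\<And>x. norm (G x) \<le> \<theta> * norm x"
  shows "ess_contracts \<theta> G"
  unfolding ess_contracts_def
proof (intro allI impI)
  fix u :: "nat \<Rightarrow> 'a"
  interpret bounded_linear G by fact
  show "\<exists>r::nat\<Rightarrow>nat. strict_mono r \<and> (\<forall>e>0. \<exists>N. \<forall>p\<ge>N. \<forall>q\<ge>N.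
        norm (G (u (r p)) - G (u (r q))) \<le> \<theta> * norm (u (r p) - u (r q)) + e)"
  proof (intro exI[of _ id] conjI strict_mono_id allI impI, intro exI[of _ 0] allI impI)
    fix e :: real and p q :: nat assume "e > 0"
    then show "norm (G (u (id p)) - G (u (id q))) \<le> \<theta> * norm (u (id p) - u (id q)) + e"
      using assms(2)[of "u p - u q"] by (simp add: diff)
  qed
qed

text \<open>The values of \<open>L\<close> on the unit ball are bounded in finite dimension, so
  along a further subsequence their differences tend to zero. Adding a row to an operator therefore
  keeps the constant \<open>\<theta>\<close>.\<close>

lemma ess_contracts_Pair:
  fixes L :: "'a::real_inner \<Rightarrow> 'e::euclidean_space"
  assumes G: "ess_contracts \<theta> G" and L: "bounded_linear L"
  shows "ess_contracts \<theta> (\<lambda>x. (G x, L x))"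
  unfolding ess_contracts_def
proof (intro allI impI)
  fix u :: "nat \<Rightarrow> 'a" assume u: "\<forall>k. norm (u k) \<le> 1"
  obtain r where r: "strict_mono (r::nat\<Rightarrow>nat)" and rG: "\<And>e. e > 0 \<Longrightarrow> \<exists>N. \<forall>p\<ge>N. \<forall>q\<ge>N.
        norm (G (u (r p)) - G (u (r q))) \<le> \<theta> * norm (u (r p) - u (r q)) + e"
    by (rule ess_contractsD[OF G, of u]) (use u in auto)
  obtain K where K: "\<And>x. norm (L x) \<le> norm x * K" "K > 0"
    using bounded_linear.pos_bounded[OF L] by blast
  have "bounded (range (\<lambda>k. L (u (r k))))"
    using K u by (intro boundedI[of _ K])
      (smt (verit) mult_left_le_one_le mult.commute norm_ge_zero imageE)
  then obtain l s where s: "strict_mono (s::nat\<Rightarrow>nat)" "(\<lambda>k. L (u (r (s k)))) \<longlonglongrightarrow> l"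
    using bounded_imp_convergent_subsequence[of "\<lambda>k. L (u (r k))"] by (auto simp: o_def)
  then have C: "Cauchy (\<lambda>k. L (u (r (s k))))" by (intro LIMSEQ_imp_Cauchy)
  have "\<exists>N. \<forall>p\<ge>N. \<forall>q\<ge>N.
        norm ((G (u (r (s p))), L (u (r (s p)))) - (G (u (r (s q))), L (u (r (s q)))))
          \<le> \<theta> * norm (u (r (s p)) - u (r (s q))) + e" if e: "e > 0" for e
  proof -
    obtain N1 where N1: "\<forall>p\<ge>N1. \<forall>q\<ge>N1.
        norm (G (u (r p)) - G (u (r q))) \<le> \<theta> * norm (u (r p) - u (r q)) + e/2"
      using rG[of "e/2"] e by auto
    obtain N2 where N2: "\<forall>p\<ge>N2. \<forall>q\<ge>N2. norm (L (u (r (s p))) - L (u (r (s q)))) < e/2"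
      using CauchyD[OF C, of "e/2"] e by auto
    show ?thesis
    proof (intro exI[of _ "max N1 N2"] allI impI)
      fix p q assume pq: "p \<ge> max N1 N2" "q \<ge> max N1 N2"
      have "s p \<ge> N1" "s q \<ge> N1" using pq seq_suble[OF s(1)]
        by (meson le_trans max.bounded_iff)+
      then have "norm (G (u (r (s p))) - G (u (r (s q)))) \<le> \<theta> * norm (u (r (s p)) - u (r (s q))) + e/2"
        using N1 by blast
      moreover have "norm (L (u (r (s p))) - L (u (r (s q)))) < e/2" using N2 pq by auto
      moreover have "norm (a, b) \<le> norm a + norm b" for a :: 'b and b :: 'e
        unfolding norm_Pair by (rule sqrt_sum_squares_le_sum) auto
      ultimately show "norm ((G (u (r (s p))), L (u (r (s p)))) - (G (u (r (s q))), L (u (r (s q)))))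
          \<le> \<theta> * norm (u (r (s p)) - u (r (s q))) + e"
        by (smt (verit) diff_Pair field_sum_of_halves)
    qed
  qed
  then show "\<exists>r::nat\<Rightarrow>nat. strict_mono r \<and> (\<forall>e>0. \<exists>N. \<forall>p\<ge>N. \<forall>q\<ge>N.
        norm ((G (u (r p)), L (u (r p))) - (G (u (r q)), L (u (r q))))
          \<le> \<theta> * norm (u (r p) - u (r q)) + e)"
    using r s(1) by (intro exI[of _ "r \<circ> s"]) (auto simp: strict_mono_o)
qed

text \<open>The parallelogram identity for \<open>u\<^sub>p, u\<^sub>q\<close> and for their images forces
  \<open>(\<rho>\<^sup>2 - \<theta>\<^sup>2) \<parallel>u\<^sub>p - u\<^sub>q\<parallel>\<^sup>2 \<rightarrow> 0\<close>.\<close>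

lemma maximising_sequence_converges:
  fixes G :: "'a::{real_inner,complete_space} \<Rightarrow> 'b::real_inner"
  assumes G: "bounded_linear G" "\<And>x. norm (G x) \<le> \<rho> * norm x"
    and ess: "ess_contracts \<theta> G" and \<theta>: "0 \<le> \<theta>" "\<theta> < \<rho>"
    and u: "\<And>k. norm (u k) \<le> 1" and lim: "(\<lambda>k. norm (G (u k))) \<longlonglongrightarrow> \<rho>"
  obtains r x where "strict_mono (r::nat\<Rightarrow>nat)" "(u \<circ> r) \<longlonglongrightarrow> x" "norm x = 1" "norm (G x) = \<rho>"
proof -
  interpret G: bounded_linear G by fact
  obtain r where r: "strict_mono (r::nat\<Rightarrow>nat)" and rG: "\<And>e. e > 0 \<Longrightarrow> \<exists>N. \<forall>p\<ge>N. \<forall>q\<ge>N.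
        norm (G (u (r p)) - G (u (r q))) \<le> \<theta> * norm (u (r p) - u (r q)) + e"
    by (rule ess_contractsD[OF ess, of u]) (use u in auto)
  define w where "w = u \<circ> r"
  have w1: "norm (w k) \<le> 1" for k using u by (simp add: w_def)
  have wlim: "(\<lambda>k. norm (G (w k))) \<longlonglongrightarrow> \<rho>"
    using LIMSEQ_subseq_LIMSEQ[OF lim r] by (simp add: w_def o_def)
  have \<rho>: "\<rho> > 0" using \<theta> by simp
  have "Cauchy w"
  proof (rule metric_CauchyI)
    fix e :: real assume e: "e > 0"
    \<comment> \<open>All errors below add up to \<delta>, one half from the differences of the
      images and one half from the norms of the images falling short of \<rho>. The total stays
      below (\<rho>^2 - \<theta>^2) e^2.\<close>
    define \<delta> where "\<delta> = (\<rho>\<^sup>2 - \<theta>\<^sup>2) * e\<^sup>2 / 2"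
    have gap: "\<rho>\<^sup>2 - \<theta>\<^sup>2 > 0" using \<theta> by (simp add: power_strict_mono)
    have \<delta>: "\<delta> > 0" using gap e by (simp add: \<delta>_def)
    \<comment> \<open>Since d \<le> 2 and \<eta> \<le> 1, the square of \<theta> d + \<eta> exceeds
      \<theta>^2 d^2 by at most \<eta> (4 \<theta> + 1), which this choice keeps below
      \<delta>/2.\<close>
    define \<eta> where "\<eta> = min 1 (\<delta> / (2 * (4 * \<theta> + 1)))"
    have \<eta>: "\<eta> > 0" "\<eta> \<le> 1" "\<eta> * (4 * \<theta> + 1) \<le> \<delta> / 2"
    proof -
      show "\<eta> > 0" "\<eta> \<le> 1" using \<delta> \<theta> by (auto simp: \<eta>_def)
      have "\<eta> * (4 * \<theta> + 1) \<le> \<delta> / (2 * (4 * \<theta> + 1)) * (4 * \<theta> + 1)"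
        using \<theta> by (intro mult_right_mono) (auto simp: \<eta>_def)
      also have "\<dots> = \<delta> / 2" using \<theta> by (simp add: field_simps)
      finally show "\<eta> * (4 * \<theta> + 1) \<le> \<delta> / 2" .
    qed
    obtain N1 where N1: "\<forall>p\<ge>N1. \<forall>q\<ge>N1.
        norm (G (w p) - G (w q)) \<le> \<theta> * norm (w p - w q) + \<eta>"
      using rG[OF \<eta>(1)] by (auto simp: w_def)
    have "(\<lambda>k. (norm (G (w k)))\<^sup>2) \<longlonglongrightarrow> \<rho>\<^sup>2" by (intro tendsto_intros wlim)
    then have "eventually (\<lambda>k. (norm (G (w k)))\<^sup>2 > \<rho>\<^sup>2 - \<delta>/8) sequentially"
      using \<delta> by (intro order_tendstoD) auto
    then obtain N2 where N2: "\<forall>k\<ge>N2. (norm (G (w k)))\<^sup>2 > \<rho>\<^sup>2 - \<delta>/8"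
      unfolding eventually_sequentially by blast
    have "dist (w p) (w q) < e" if pq: "p \<ge> max N1 N2" "q \<ge> max N1 N2" for p q
    proof -
      define d where "d = norm (w p - w q)"
      have d2: "d \<le> 2" unfolding d_def using norm_triangle_ineq4[of "w p" "w q"] w1[of p] w1[of q] by simp
      have d0: "d \<ge> 0" by (simp add: d_def)
      have 1: "norm (G (w p) - G (w q)) \<le> \<theta> * d + \<eta>" using N1 pq by (auto simp: d_def)
      have "(norm (G (w p) - G (w q)))\<^sup>2 \<le> (\<theta> * d + \<eta>)\<^sup>2"
        using 1 by (intro power_mono) auto
      also have "\<dots> = \<theta>\<^sup>2 * d\<^sup>2 + \<eta> * (2 * \<theta> * d + \<eta>)"
        by (simp add: power2_eq_square algebra_simps)
      also have "\<dots> \<le> \<theta>\<^sup>2 * d\<^sup>2 + \<eta> * (4 * \<theta> + 1)"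
      proof -
        have "2 * \<theta> * d \<le> 2 * \<theta> * 2" using d2 \<theta> by (intro mult_left_mono) auto
        then have "\<eta> * (2 * \<theta> * d + \<eta>) \<le> \<eta> * (4 * \<theta> + 1)" using \<eta> by (intro mult_left_mono) auto
        then show ?thesis by simp
      qed
      finally have 2: "(norm (G (w p) - G (w q)))\<^sup>2 \<le> \<theta>\<^sup>2 * d\<^sup>2 + \<delta>/2" using \<eta> by simp
      have "(norm (G (w p + w q)))\<^sup>2 \<le> (\<rho> * norm (w p + w q))\<^sup>2"
        using G(2) by (intro power_mono) auto
      also have "\<dots> = \<rho>\<^sup>2 * (norm (w p + w q))\<^sup>2" by (simp add: power_mult_distrib)
      also have "\<dots> \<le> \<rho>\<^sup>2 * (4 - d\<^sup>2)"
      proof (rule mult_left_mono)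
        have "(norm (w p))\<^sup>2 \<le> 1" "(norm (w q))\<^sup>2 \<le> 1" using w1 by (auto simp: power_le_one)
        then show "(norm (w p + w q))\<^sup>2 \<le> 4 - d\<^sup>2"
          using parallelogram_inner[of "w p" "w q"] by (simp add: d_def)
      qed simp
      finally have 3: "(norm (G (w p) + G (w q)))\<^sup>2 \<le> \<rho>\<^sup>2 * (4 - d\<^sup>2)" by (simp add: G.add)
      have "4 * \<rho>\<^sup>2 - \<delta>/2 < \<rho>\<^sup>2 * (4 - d\<^sup>2) + \<theta>\<^sup>2 * d\<^sup>2 + \<delta>/2"
      proof -
        have "(norm (G (w p)))\<^sup>2 > \<rho>\<^sup>2 - \<delta>/8" "(norm (G (w q)))\<^sup>2 > \<rho>\<^sup>2 - \<delta>/8" using N2 pq by auto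
        then show ?thesis using parallelogram_inner[of "G (w p)" "G (w q)"] 2 3 by linarith
      qed
      then have "(\<rho>\<^sup>2 - \<theta>\<^sup>2) * d\<^sup>2 < (\<rho>\<^sup>2 - \<theta>\<^sup>2) * e\<^sup>2" using \<delta>
        by (simp add: algebra_simps \<delta>_def)
      then have "d\<^sup>2 < e\<^sup>2" using gap by simp
      then show ?thesis using e d0 by (simp add: d_def dist_norm power_less_imp_less_base)
    qed
    then show "\<exists>N. \<forall>p\<ge>N. \<forall>q\<ge>N. dist (w p) (w q) < e" by blast
  qed
  then obtain x where x: "w \<longlonglongrightarrow> x" using convergent_eq_Cauchy by blast
  have "(\<lambda>k. norm (G (w k))) \<longlonglongrightarrow> norm (G x)" by (intro tendsto_intros G.tendsto x)
  then have Gx: "norm (G x) = \<rho>" using wlim LIMSEQ_unique by blast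
  have "norm x \<le> 1" using x w1 by (intro LIMSEQ_le_const2[OF tendsto_norm[OF x]]) auto
  moreover have "norm x \<ge> 1" using G(2)[of x] Gx \<rho> by simp
  ultimately show thesis using that[OF r] x Gx by (simp add: w_def)
qed

text \<open>The nonnegative quadratic form \<rho>^2 |x|^2 - |G x|^2 vanishes at a maximising vector,
  hence so does its polarisation against every \<open>y\<close>. This is the eigenvector equation
  G^* G x = \<rho>^2 x in weak form, with no adjoint involved.\<close>

lemma maximising_vector_inner:
  fixes G :: "'a::real_inner \<Rightarrow> 'b::real_inner"
  assumes G: "bounded_linear G" "\<And>x. norm (G x) \<le> \<rho> * norm x" "\<rho> \<ge> 0"
    and x: "norm (G x) = \<rho> * norm x"
  shows "inner (G x) (G y) = \<rho>\<^sup>2 * inner x y"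
proof -
  interpret G: bounded_linear G by fact
  have "\<rho>\<^sup>2 * inner x y - inner (G x) (G y) = 0"
  proof (rule linear_quadratic_nonneg_imp_zero[of _ "\<rho>\<^sup>2 * (norm y)\<^sup>2 - (norm (G y))\<^sup>2"])
    fix t :: real
    have "(norm (G (x + t *\<^sub>R y)))\<^sup>2 \<le> (\<rho> * norm (x + t *\<^sub>R y))\<^sup>2"
      using G by (intro power_mono) auto
    then have "(norm (G x))\<^sup>2 + 2 * t * inner (G x) (G y) + t\<^sup>2 * (norm (G y))\<^sup>2
       \<le> \<rho>\<^sup>2 * ((norm x)\<^sup>2 + 2 * t * inner x y + t\<^sup>2 * (norm y)\<^sup>2)"
      by (simp add: G.add G.scaleR norm_add_sq power_mult_distrib mult.assoc)
    moreover have "(norm (G x))\<^sup>2 = \<rho>\<^sup>2 * (norm x)\<^sup>2" using x by (simp add: power_mult_distrib)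
    ultimately show "0 \<le> 2 * t * (\<rho>\<^sup>2 * inner x y - inner (G x) (G y))
        + t\<^sup>2 * (\<rho>\<^sup>2 * (norm y)\<^sup>2 - (norm (G y))\<^sup>2)"
      by (simp add: algebra_simps)
  next
    have "(norm (G y))\<^sup>2 \<le> (\<rho> * norm y)\<^sup>2" using G by (intro power_mono) auto
    then show "0 \<le> \<rho>\<^sup>2 * (norm y)\<^sup>2 - (norm (G y))\<^sup>2" by (simp add: power_mult_distrib)
  qed
  then show ?thesis by simp
qed

text \<open>The set is the kernel of \<rho>^2 - G^* G; closure under addition comes from the weak
  eigenvector equation.\<close>

lemma subspace_maximising_vectors:
  fixes G :: "'a::real_inner \<Rightarrow> 'b::real_inner"
  assumes G: "bounded_linear G" "\<And>x. norm (G x) \<le> \<rho> * norm x" "\<rho> \<ge> 0"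
  shows "subspace {x. norm (G x) = \<rho> * norm x}"
proof -
  interpret G: bounded_linear G by fact
  note inn = maximising_vector_inner[OF G]
  show ?thesis
  proof (rule subspaceI, goal_cases)
    case (2 x y)
    then have "(norm (G (x + y)))\<^sup>2 = (\<rho> * norm (x + y))\<^sup>2"
      by (simp add: G.add norm_add_sq inn power_mult_distrib algebra_simps)
    then have "norm (G (x + y)) = \<rho> * norm (x + y)"
      using G(3) by (smt (verit) power2_eq_imp_eq norm_ge_zero zero_le_mult_iff)
    then show ?case by simp
  qed (auto simp: G.zero G.scaleR algebra_simps)
qed

lemma closed_maximising_vectors:
  fixes G :: "'a::real_inner \<Rightarrow> 'b::real_inner"
  assumes G: "bounded_linear G"
  shows "closed {x. norm (G x) = \<rho> * norm x}"
  by (intro closed_Collect_eq continuous_intros bounded_linear.continuous_on[OF G])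

text \<open>Otherwise there are unit vectors orthogonal to all maximising vectors whose images have
  norms tending to 1. A subsequence converges to a maximising vector, which would then be orthogonal
  to itself.\<close>

lemma gap_orthogonal_to_maximising_vectors:
  fixes G :: "'a::{real_inner,complete_space} \<Rightarrow> 'b::real_inner"
  assumes G: "bounded_linear G" "\<And>x. norm (G x) \<le> norm x"
    and ess: "ess_contracts \<theta> G" and \<theta>: "0 \<le> \<theta>" "\<theta> < 1"
  obtains \<gamma> where "0 \<le> \<gamma>" "\<gamma> < 1"
    "\<And>d. (\<And>e. norm (G e) = norm e \<Longrightarrow> inner d e = 0) \<Longrightarrow> norm (G d) \<le> \<gamma> * norm d"
proof (rule ccontr)
  interpret G: bounded_linear G by fact
  assume neg: "\<not> thesis"
  have "\<exists>d. (\<forall>e. norm (G e) = norm e \<longrightarrow> inner d e = 0) \<and> norm d = 1 \<and> norm (G d) > 1 - 1 / Suc k" for k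
  proof -
    have "\<exists>d. (\<forall>e. norm (G e) = norm e \<longrightarrow> inner d e = 0) \<and> norm (G d) > (1 - 1 / Suc k) * norm d"
      using neg that[of "1 - 1 / Suc k"] by (force simp: divide_simps not_le)
    then obtain d where d: "\<And>e. norm (G e) = norm e \<Longrightarrow> inner d e = 0"
        "norm (G d) > (1 - 1 / Suc k) * norm d" by blast
    then have dn: "norm d > 0" by (auto simp: G.zero)
    then have "norm (G (d /\<^sub>R norm d)) > 1 - 1 / Suc k" "norm (d /\<^sub>R norm d) = 1"
      using d(2) by (auto simp: G.scaleR field_simps)
    with d(1) show ?thesis by (intro exI[of _ "d /\<^sub>R norm d"]) auto
  qed
  then obtain u where u: "\<And>k e. norm (G e) = norm e \<Longrightarrow> inner (u k) e = 0"
      "\<And>k. norm (u k) = 1" "\<And>k. norm (G (u k)) > 1 - 1 / Suc k"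
    by metis
  have "(\<lambda>k. norm (G (u k))) \<longlonglongrightarrow> 1"
  proof (rule tendsto_sandwich)
    show "(\<lambda>k. 1 - 1 / real (Suc k)) \<longlonglongrightarrow> 1"
      using tendsto_diff[OF tendsto_const[of 1] LIMSEQ_Suc[OF lim_const_over_n[of 1]]] by simp
    show "(\<lambda>k. 1::real) \<longlonglongrightarrow> 1" by simp
  qed (use u G in \<open>auto simp: less_imp_le intro!: always_eventually\<close>, metis)
  then obtain r x where rx: "strict_mono (r::nat\<Rightarrow>nat)" "(u \<circ> r) \<longlonglongrightarrow> x" "norm x = 1" "norm (G x) = 1"
    using maximising_sequence_converges[of G 1 \<theta> u] G ess \<theta> u(2) by auto
  have "(\<lambda>k. inner ((u \<circ> r) k) x) \<longlonglongrightarrow> inner x x" by (intro tendsto_intros rx)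
  moreover have "(\<lambda>k. inner ((u \<circ> r) k) x) = (\<lambda>_. 0)" using u(1)[of x] rx by auto
  ultimately have "inner x x = 0" using LIMSEQ_unique tendsto_const by metis
  then show False using rx by simp
qed

section \<open>Parrott's theorem and extremal completions\<close>

text \<open>\<open>norm\<close> on matrices is the Frobenius norm, so this is the Cauchy-Schwarz
  inequality in each row.\<close>

lemma norm_matrix_vector_le:
  fixes A :: "complex^'n^'m"
  shows "norm (A *v x) \<le> norm A * norm x"
proof -
  have "norm ((A *v x) $ i) \<le> norm (A $ i) * norm x" for i
  proof -
    have "norm ((A *v x) $ i) \<le> (\<Sum>j\<in>UNIV. norm (A $ i $ j) * norm (x $ j))"
      unfolding matrix_vector_mult_def by (auto intro!: order_trans[OF norm_sum] simp: norm_mult)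
    also have "\<dots> \<le> norm (A $ i) * norm x"
      unfolding norm_vec_def using L2_set_mult_ineq[of "\<lambda>j. norm (A $ i $ j)" "\<lambda>j. norm (x $ j)" UNIV]
      by simp
    finally show ?thesis .
  qed
  then have "norm (A *v x) \<le> L2_set (\<lambda>i. norm (A $ i) * norm x) UNIV"
    unfolding norm_vec_def[of "A *v x"] by (intro L2_set_mono) auto
  also have "\<dots> = norm A * norm x"
    unfolding norm_vec_def[of A] by (rule L2_set_left_distrib[symmetric]) simp
  finally show ?thesis .
qed

text \<open>Each entry is read off from the image of a basis vector. The dimension-dependent
  constant is harmless, since only boundedness of matrix sets and of symbols is derived from
  it.\<close>

lemma norm_matrix_le_of_contractive:
  fixes A :: "complex^'n^'m" and B :: real
  assumes "\<And>x. norm (A *v x) \<le> B * norm x"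
  shows "norm A \<le> CARD('m) * (CARD('n) * B)"
proof -
  have e: "norm (A $ i $ j) \<le> B" for i j
  proof -
    have "A $ i $ j = (A *v axis j 1) $ i" by (simp add: matrix_vector_mult_def axis_def if_distrib cong: if_cong)
    then have "norm (A $ i $ j) \<le> norm (A *v axis j 1)" by (metis Finite_Cartesian_Product.norm_nth_le)
    also have "\<dots> \<le> B" using assms[of "axis j 1"] by simp
    finally show ?thesis .
  qed
  have "norm A \<le> (\<Sum>i\<in>UNIV. norm (A $ i))"
    unfolding norm_vec_def[of A] by (rule L2_set_le_sum) auto
  also have "\<dots> \<le> (\<Sum>i\<in>(UNIV::'m set). (\<Sum>j\<in>(UNIV::'n set). B))"
  proof (rule sum_mono)
    fix i
    have "norm (A $ i) \<le> (\<Sum>j\<in>UNIV. norm (A $ i $ j))"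
      unfolding norm_vec_def[of "A $ i"] by (rule L2_set_le_sum) auto
    also have "\<dots> \<le> (\<Sum>j\<in>(UNIV::'n set). B)" by (intro sum_mono e)
    finally show "norm (A $ i) \<le> (\<Sum>j\<in>(UNIV::'n set). B)" .
  qed
  finally show ?thesis by simp
qed

lemma scaleR_matrix_vector: "(t *\<^sub>R (A::complex^'n^'m)) *v x = t *\<^sub>R (A *v x)"
  by (simp add: vec_eq_iff matrix_vector_mult_def scaleR_sum_right)

lemma ii_vector_scale: "c *s (x::complex^'n) = Re c *\<^sub>R x + Im c *\<^sub>R (\<i> *s x)"
  by (simp add: vec_eq_iff complex_eq_iff)

lemma inner_ii_left: "inner (\<i> *s (x::complex^'n)) y = - inner x (\<i> *s y)"
  unfolding inner_vec_def sum_negf[symmetric] by (intro sum.cong) (auto simp: inner_complex_def)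

text \<open>\<open>inner\<close> is the real part of the Hermitian product; the imaginary part is
  recovered by rotating one argument by i.\<close>

lemma inner_cnj_sum:
  fixes b w :: "complex^'n"
  shows "(\<Sum>j\<in>UNIV. cnj (b $ j) * w $ j) = Complex (inner b w) (- inner b (\<i> *s w))"
  unfolding complex_eq_iff
  by (simp add: inner_vec_def inner_complex_def sum_negf[symmetric] algebra_simps)

text \<open>The corner \<open>C\<close> of the block operator \<open>x \<mapsto> (H x, T x + C (v x))\<close> is free;
  \<open>J\<close> is multiplication by the imaginary unit on the (real) Hilbert space \<open>'a\<close>.\<close>

locale corner =
  fixes H :: "'a::{real_inner,complete_space} \<Rightarrow> 'b::real_inner"
    and T v :: "'a \<Rightarrow> complex^'n" and J :: "'a \<Rightarrow> 'a"
  assumes bl_H: "bounded_linear H" and bl_T: "bounded_linear T" and bl_v: "bounded_linear v"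
    and bl_J: "bounded_linear J"
    and H_J: "norm (H (J x)) = norm (H x)" and norm_J: "norm (J x) = norm x"
    and T_J: "T (J x) = \<i> *s T x" and v_J: "v (J x) = \<i> *s v x"
    and v_lift: "\<exists>x. v x = w \<and> norm x \<le> norm w"
    and H_le: "norm (H x) \<le> norm x"
begin

sublocale H: bounded_linear H by (rule bl_H)
sublocale T: bounded_linear T by (rule bl_T)
sublocale v: bounded_linear v by (rule bl_v)
sublocale J: bounded_linear J by (rule bl_J)

definition toprow :: "complex^'n^'n \<Rightarrow> 'a \<Rightarrow> complex^'n" where
  "toprow C x = T x + C *v v x"

definition G :: "complex^'n^'n \<Rightarrow> 'a \<Rightarrow> 'b \<times> (complex^'n)" where
  "G C x = (H x, toprow C x)"

lemma bl_toprow: "bounded_linear (toprow C)"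
  unfolding toprow_def
  by (intro bounded_linear_add bl_T bounded_linear_compose[OF matrix_vector_mul_bounded_linear bl_v])

lemma bl_G: "bounded_linear (G C)"
  unfolding G_def by (intro bounded_linear_Pair bl_H bl_toprow)

sublocale G: bounded_linear "G C" for C by (rule bl_G)
sublocale toprow: bounded_linear "toprow C" for C by (rule bl_toprow)

lemma toprow_J: "toprow C (J x) = \<i> *s toprow C x"
  by (simp add: toprow_def T_J v_J vec.scale vector_add_ldistrib)

lemma norm_G_sq: "(norm (G C x))\<^sup>2 = (norm (H x))\<^sup>2 + (norm (toprow C x))\<^sup>2"
  by (simp add: G_def norm_Pair)

lemma norm_G_J: "norm (G C (J x)) = norm (G C x)"
proof -
  have "norm (\<i> *s y) = norm y" for y :: "complex^'n"
    by (simp add: norm_vec_def norm_mult)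
  then show ?thesis by (simp add: G_def norm_Pair H_J toprow_J)
qed

text \<open>Complex scalar multiplication as seen through \<open>v\<close> and
  \<open>toprow\<close>, both of which turn \<open>J\<close> into multiplication by i.\<close>

definition cs :: "complex \<Rightarrow> 'a \<Rightarrow> 'a" where "cs c x = Re c *\<^sub>R x + Im c *\<^sub>R J x"

lemma v_cs: "v (cs c x) = c *s v x"
  by (subst ii_vector_scale) (simp add: cs_def v.add v.scaleR v_J)

lemma toprow_cs: "toprow C (cs c x) = c *s toprow C x"
  by (subst ii_vector_scale) (simp add: cs_def toprow.add toprow.scaleR toprow_J)

definition maxv :: "real \<Rightarrow> complex^'n^'n \<Rightarrow> 'a set" where
  "maxv \<rho> C = {x. norm (G C x) = \<rho> * norm x}"

lemma subspace_maxv: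
  "(\<And>x. norm (G C x) \<le> \<rho> * norm x) \<Longrightarrow> \<rho> \<ge> 0 \<Longrightarrow> subspace (maxv \<rho> C)"
  unfolding maxv_def by (rule subspace_maximising_vectors[OF bl_G])

lemma J_maxv: "x \<in> maxv \<rho> C \<Longrightarrow> J x \<in> maxv \<rho> C"
  by (simp add: maxv_def norm_G_J norm_J)

lemma cs_maxv:
  "(\<And>x. norm (G C x) \<le> \<rho> * norm x) \<Longrightarrow> \<rho> \<ge> 0 \<Longrightarrow> x \<in> maxv \<rho> C \<Longrightarrow> cs c x \<in> maxv \<rho> C"
  unfolding cs_def
  by (intro subspace_add[OF subspace_maxv] subspace_scale[OF subspace_maxv] J_maxv)

text \<open>\<open>C\<close> enters only through C (v x), so the operator depends on it in a
  Lipschitz way. This gives continuity in \<open>C\<close> and controls perturbations of a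
  completion.\<close>

lemma norm_G_diff_le:
  obtains K where "K > 0" "\<And>C D x. norm (G C x - G D x) \<le> norm (C - D) * K * norm x"
proof -
  obtain K where K: "K > 0" "\<And>x. norm (v x) \<le> norm x * K" using v.pos_bounded by blast
  have "norm (G C x - G D x) \<le> norm (C - D) * K * norm x" for C D x
  proof -
    have "G C x - G D x = (0, (C - D) *v v x)"
      by (simp add: G_def toprow_def matrix_vector_mult_diff_rdistrib)
    then have "norm (G C x - G D x) = norm ((C - D) *v v x)" by (simp add: norm_Pair)
    also have "\<dots> \<le> norm (C - D) * norm (v x)" by (rule norm_matrix_vector_le)
    also have "\<dots> \<le> norm (C - D) * (norm x * K)" by (intro mult_left_mono K) auto
    finally show ?thesis by (simp add: mult_ac)
  qed
  with K that show thesis by blast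
qed

text \<open>By \<open>v_lift\<close> every w is some v x with x no longer than w, and C w = toprow C
  x - T x is then bounded. With closedness this makes sets of completions compact.\<close>

lemma bounded_corners:
  obtains B where "\<And>C. (\<And>x. norm (G C x) \<le> R * norm x) \<Longrightarrow> norm C \<le> B"
proof -
  obtain K where K: "K > 0" "\<And>x. norm (T x) \<le> norm x * K" using T.pos_bounded by blast
  show thesis
  proof (rule that)
    fix C assume C: "\<And>x. norm (G C x) \<le> R * norm x"
    show "norm C \<le> CARD('n) * (CARD('n) * (\<bar>R\<bar> + K))"
    proof (rule norm_matrix_le_of_contractive)
      fix w :: "complex^'n"
      obtain x where x: "v x = w" "norm x \<le> norm w" using v_lift by blast
      have "norm (C *v w) = norm (toprow C x - T x)" by (simp add: toprow_def x)
      also have "\<dots> \<le> norm (toprow C x) + norm (T x)" by (rule norm_triangle_ineq4)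
      also have "norm (toprow C x) \<le> norm (G C x)" unfolding G_def norm_Pair by (simp add: real_le_rsqrt)
      also have "norm (G C x) \<le> \<bar>R\<bar> * norm x" using C[of x] mult_right_mono[OF abs_ge_self[of R] norm_ge_zero[of x]] by linarith
      also have "norm (T x) \<le> norm x * K" by (rule K)
      also have "\<bar>R\<bar> * norm x + norm x * K = (\<bar>R\<bar> + K) * norm x" by (simp add: algebra_simps)
      also have "\<dots> \<le> (\<bar>R\<bar> + K) * norm w" using K x by (intro mult_left_mono) auto
      finally show "norm (C *v w) \<le> (\<bar>R\<bar> + K) * norm w" by simp
    qed
  qed
qed

text \<open>Injectivity of \<open>v\<close> makes the assignment of \<open>toprow C x\<close> to v x
  well defined on the maximising vectors. Their image under \<open>v\<close> is a complex subspace
  because \<open>J\<close> preserves them, so a basis of it and a linear extension produce the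
  matrix.\<close>

lemma matrix_on_maxv:
  assumes C: "\<And>x. norm (G C x) \<le> \<rho> * norm x" "\<rho> \<ge> 0"
    and inj: "\<And>x. x \<in> maxv \<rho> C \<Longrightarrow> v x = 0 \<Longrightarrow> x = 0"
  obtains D where "\<And>x. x \<in> maxv \<rho> C \<Longrightarrow> D *v v x = toprow C x"
proof -
  let ?E = "maxv \<rho> C"
  note sub = subspace_maxv[OF C]
  obtain s where s: "\<And>w. w \<in> v ` ?E \<Longrightarrow> s w \<in> ?E \<and> v (s w) = w"
    using bchoice[of "v ` ?E" "\<lambda>w x. x \<in> ?E \<and> v x = w"] by blast
  obtain B where B: "B \<subseteq> v ` ?E" "vec.independent B" "v ` ?E \<subseteq> vec.span B"
    by (rule vec.basis_exists[of "v ` ?E"])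
  obtain g where g: "Vector_Spaces.linear (*s) (*s) g" "\<And>w. w \<in> B \<Longrightarrow> g w = toprow C (s w)"
    using vec.linear_independent_extend[OF B(2), of "\<lambda>w. toprow C (s w)"] by blast
  interpret g: Vector_Spaces.linear "(*s)" "(*s)" g by (rule g(1))
  \<comment> \<open>The extension \<open>g\<close> is prescribed on the basis only. Induction over
    the complex span, with \<open>cs\<close> acting on preimages, shows that it agrees with
    \<open>toprow C\<close> on a suitable preimage of every vector.\<close>
  have "\<exists>x\<in>?E. v x = w \<and> g w = toprow C x" if "w \<in> vec.span B" for w
    using that
  proof (induction rule: vec.span_induct_alt)
    case base
    show ?case using subspace_0[OF sub] g.zero
      by (intro bexI[of _ 0]) (auto simp: v.zero toprow.zero)
  next
    case (step c w y)
    then obtain x where x: "x \<in> ?E" "v x = y" "g y = toprow C x" by blast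
    have sw: "s w \<in> ?E" "v (s w) = w" using s B(1) step by auto
    show ?case
    proof (intro bexI[of _ "cs c (s w) + x"] conjI)
      show "cs c (s w) + x \<in> ?E" by (intro subspace_add[OF sub] cs_maxv C sw x)
      show "v (cs c (s w) + x) = c *s w + y" by (simp add: v.add v_cs sw x)
      show "g (c *s w + y) = toprow C (cs c (s w) + x)"
        by (simp add: toprow.add toprow_cs g.add g.scale g(2)[OF step(1)] x)
    qed
  qed
  note ex = this
  show thesis
  proof (rule that[of "matrix g"])
    fix x assume x: "x \<in> ?E"
    then have "v x \<in> vec.span B" using B by auto
    from ex[OF this] obtain y where y: "y \<in> ?E" "v y = v x" "g (v x) = toprow C y" by blast
    have "y - x = 0" by (intro inj subspace_diff[OF sub]) (auto simp: x y v.diff)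
    then show "matrix g *v v x = toprow C x" using y by (simp add: matrix_works[OF g(1)])
  qed
qed

text \<open>If the least norm \<open>\<rho>\<close> of a completion exceeded \<open>1\<close>, then \<open>v\<close> would be injective on the
  maximising vectors of an optimal \<open>C\<close>, so that a matrix \<open>D\<close> with \<open>D (v x) = toprow C x\<close> for all of them
  exists, and \<open>C - \<epsilon> D\<close> would have smaller norm.\<close>

theorem parrott:
  assumes row: "\<And>x. v x = 0 \<Longrightarrow> (norm (H x))\<^sup>2 + (norm (T x))\<^sup>2 \<le> (norm x)\<^sup>2"
  shows "\<exists>C. \<forall>x. norm (G C x) \<le> norm x"
proof -
  define N where "N C = onorm (G C)" for C
  have N: "norm (G C x) \<le> N C * norm x" for C x unfolding N_def by (rule onorm[OF bl_G])
  have N0: "N C \<ge> 0" for C unfolding N_def by (rule onorm_pos_le[OF bl_G])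
  obtain K where K: "K > 0" "\<And>C D x. norm (G C x - G D x) \<le> norm (C - D) * K * norm x"
    using norm_G_diff_le by blast
  have lip1: "N C \<le> N D + K * norm (C - D)" for C D
  proof -
    have "onorm (G C) \<le> N D + K * norm (C - D)"
    proof (rule onorm_bound)
      fix x
      have "norm (G C x) \<le> norm (G D x) + norm (G C x - G D x)" by (rule norm_triangle_sub)
      also have "\<dots> \<le> N D * norm x + norm (C - D) * K * norm x" by (intro add_mono N K)
      finally show "norm (G C x) \<le> (N D + K * norm (C - D)) * norm x" by (simp add: algebra_simps)
    next
      show "0 \<le> N D + K * norm (C - D)" using N0 K by simp
    qed
    then show ?thesis by (simp add: N_def)
  qed
  have contN: "continuous_on UNIV N"
  proof (rule lipschitz_on_continuous_on, rule lipschitz_onI)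
    show "dist (N C) (N D) \<le> K * dist C D" for C D
      using lip1[of C D] lip1[of D C] by (simp add: dist_norm norm_minus_commute abs_le_iff)
    show "0 \<le> K" using K by simp
  qed
  obtain B where B: "\<And>C. (\<And>x. norm (G C x) \<le> N 0 * norm x) \<Longrightarrow> norm C \<le> B"
    using bounded_corners by blast
  \<comment> \<open>The completions no worse than the zero corner form a compact set, so the least
    norm is attained.\<close>
  define S where "S = {C. N C \<le> N 0}"
  have "norm C \<le> B" if "C \<in> S" for C
  proof (rule B)
    fix x :: 'a
    have "N C * norm x \<le> N 0 * norm x" using that by (intro mult_right_mono) (auto simp: S_def)
    then show "norm (G C x) \<le> N 0 * norm x" using N[of C x] by linarith
  qed
  then have "bounded S" unfolding bounded_iff by blast
  moreover have "closed S" unfolding S_def by (intro closed_Collect_le contN continuous_intros)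
  ultimately have "compact S" by (simp add: compact_eq_bounded_closed)
  moreover have "S \<noteq> {}" by (auto simp: S_def)
  ultimately obtain C where C: "C \<in> S" "\<forall>D\<in>S. N C \<le> N D"
    using continuous_attains_inf[of S N] continuous_on_subset[OF contN] by blast
  have Cmin: "N C \<le> N D" for D
    using C by (cases "D \<in> S") (auto simp: S_def)
  define \<rho> where "\<rho> = N C"
  note GC = N[of C, folded \<rho>_def]
  show ?thesis
  proof (cases "\<rho> \<le> 1")
    case True
    have "norm (G C x) \<le> norm x" for x
      using GC[of x] mult_right_mono[OF True norm_ge_zero[of x]] by simp
    then show ?thesis by blast
  next
    case False
    then have \<rho>: "\<rho> > 1" "\<rho> \<ge> 0" by auto
    \<comment> \<open>On the kernel of \<open>v\<close> the corner is invisible and the hypothesis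
      \<open>row\<close> bounds the operator by 1, so a vector stretched by \<rho> > 1 cannot lie
      there.\<close>
    have inj: "x = 0" if x: "x \<in> maxv \<rho> C" "v x = 0" for x
    proof -
      have "toprow C x = T x" using x by (simp add: toprow_def)
      then have "(\<rho> * norm x)\<^sup>2 \<le> (norm x)\<^sup>2" using row[OF x(2)] norm_G_sq[of C x] x(1) by (simp add: maxv_def)
      then have "\<rho> * norm x \<le> norm x" by (rule power2_le_imp_le) simp
      then have "(\<rho> - 1) * norm x \<le> 0" by (simp add: algebra_simps)
      then show "x = 0" using \<rho> by (simp add: mult_le_0_iff)
    qed
    obtain D where D: "\<And>x. x \<in> maxv \<rho> C \<Longrightarrow> D *v v x = toprow C x"
      using matrix_on_maxv[OF GC \<rho>(2) inj] by blast
    define \<epsilon> where "\<epsilon> k = 1 / real (Suc k)" for k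
    have \<epsilon>: "\<epsilon> k > 0" "\<epsilon> k \<le> 1" for k by (auto simp: \<epsilon>_def)
    have \<epsilon>lim: "\<epsilon> \<longlonglongrightarrow> 0" unfolding \<epsilon>_def using LIMSEQ_Suc[OF lim_const_over_n[of 1]] by simp
    define M where "M k = C - \<epsilon> k *\<^sub>R D" for k
    \<comment> \<open>Minimality of \<rho> prevents the norm of the operator with corner
      \<open>M k\<close> from dropping below \<rho>. The tolerance is quadratic in \<epsilon> so
      that it cannot hide the first-order effect of subtracting \<epsilon> D.\<close>
    have "\<exists>u. norm u = 1 \<and> norm (G (M k) u) > \<rho> - (\<epsilon> k)\<^sup>2" for k
    proof -
      have "\<exists>x. norm (G (M k) x) > (\<rho> - (\<epsilon> k)\<^sup>2) * norm x"
      proof (rule ccontr)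
        assume "\<not> ?thesis"
        then have "N (M k) \<le> \<rho> - (\<epsilon> k)\<^sup>2" unfolding N_def using \<rho> power_le_one[of "\<epsilon> k" 2] \<epsilon>[of k]
          by (intro onorm_bound) (auto simp: not_less)
        then show False using Cmin[of "M k"] zero_less_power[OF \<epsilon>(1)[of k], of 2] by (simp add: \<rho>_def)
      qed
      then obtain x where x: "norm (G (M k) x) > (\<rho> - (\<epsilon> k)\<^sup>2) * norm x" by blast
      then have "norm x > 0" by (auto simp: G.zero)
      with x show ?thesis
        by (intro exI[of _ "x /\<^sub>R norm x"]) (auto simp: G.scaleR field_simps)
    qed
    then obtain u where u: "\<And>k. norm (u k) = 1" "\<And>k. norm (G (M k) (u k)) > \<rho> - (\<epsilon> k)\<^sup>2" by metis
    have lo: "norm (G C (u k)) \<ge> \<rho> - (\<epsilon> k)\<^sup>2 - \<epsilon> k * (norm D * K)" for k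
    proof -
      have "norm (G (M k) (u k)) \<le> norm (G C (u k)) + norm (G (M k) (u k) - G C (u k))"
        by (rule norm_triangle_sub)
      also have "norm (G (M k) (u k) - G C (u k)) \<le> \<epsilon> k * (norm D * K)"
        using K(2)[of "M k" "u k" C] u(1)[of k] \<epsilon>(1)[of k] by (simp add: M_def mult.assoc)
      finally show ?thesis using u(2)[of k] by simp
    qed
    have "(\<lambda>k. norm (G C (u k))) \<longlonglongrightarrow> \<rho>"
    proof (rule tendsto_sandwich)
      show "(\<lambda>k. \<rho> - (\<epsilon> k)\<^sup>2 - \<epsilon> k * (norm D * K)) \<longlonglongrightarrow> \<rho>"
        using \<epsilon>lim by (auto intro!: tendsto_eq_intros)
      show "(\<lambda>k. \<rho>) \<longlonglongrightarrow> \<rho>" by simp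
      show "\<forall>\<^sub>F k in sequentially. norm (G C (u k)) \<le> \<rho>"
        using GC u(1) by (intro always_eventually allI) (metis mult.right_neutral)
    qed (use lo in auto)
    moreover have "ess_contracts 1 (G C)"
      unfolding G_def by (intro ess_contracts_Pair ess_contracts_contraction bl_H bl_toprow) (simp add: H_le)
    ultimately obtain r x where rx: "strict_mono (r::nat\<Rightarrow>nat)" "(u \<circ> r) \<longlonglongrightarrow> x" "norm x = 1" "norm (G C x) = \<rho>"
      using maximising_sequence_converges[OF bl_G GC, of 1 u] \<rho> u(1) by (metis order_refl zero_le_one)
    have xE: "x \<in> maxv \<rho> C" using rx by (simp add: maxv_def)
    obtain Kv where Kv: "Kv > 0" "\<And>x. norm (v x) \<le> norm x * Kv" using v.pos_bounded by blast
    define c where "c = norm D * Kv"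
    \<comment> \<open>Expanding the square for the corner C - \<epsilon> D to first order and
      dividing by \<epsilon> bounds the first variation of the norm along the
      near-maximisers.\<close>
    have est: "2 * inner (toprow C (u k)) (D *v v (u k)) \<le> \<epsilon> k * (c\<^sup>2 + 2 * \<rho>)" for k
    proof -
      let ?a = "toprow C (u k)" and ?d = "D *v v (u k)"
      have "norm ?d \<le> c"
        using norm_matrix_vector_le[of D "v (u k)"] mult_left_mono[OF Kv(2)[of "u k"] norm_ge_zero[of D]] u(1)[of k]
        by (simp add: c_def)
      then have d: "(norm ?d)\<^sup>2 \<le> c\<^sup>2" by (intro power_mono) auto
      have la: "toprow (M k) (u k) = ?a + (- \<epsilon> k) *\<^sub>R ?d"
        by (simp add: toprow_def M_def matrix_vector_mult_diff_rdistrib scaleR_matrix_vector)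
      have "(\<rho> - (\<epsilon> k)\<^sup>2)\<^sup>2 \<le> (norm (G (M k) (u k)))\<^sup>2"
        using u(2)[of k] \<rho> power_le_one[of "\<epsilon> k" 2] \<epsilon>[of k] by (intro power_mono) auto
      also have "\<dots> = (norm (H (u k)))\<^sup>2 + (norm ?a)\<^sup>2 - 2 * \<epsilon> k * inner ?a ?d + (\<epsilon> k)\<^sup>2 * (norm ?d)\<^sup>2"
        unfolding norm_G_sq la by (subst norm_add_sq) (simp add: power_mult_distrib)
      also have "(norm (H (u k)))\<^sup>2 + (norm ?a)\<^sup>2 = (norm (G C (u k)))\<^sup>2" by (simp add: norm_G_sq)
      also have "(norm (G C (u k)))\<^sup>2 \<le> \<rho>\<^sup>2"
        using GC[of "u k"] u(1)[of k] by (intro power_mono) auto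
      finally have "(\<rho> - (\<epsilon> k)\<^sup>2)\<^sup>2 \<le> \<rho>\<^sup>2 - 2 * \<epsilon> k * inner ?a ?d + (\<epsilon> k)\<^sup>2 * (norm ?d)\<^sup>2" by simp
      moreover have "(\<epsilon> k)\<^sup>2 * (norm ?d)\<^sup>2 \<le> (\<epsilon> k)\<^sup>2 * c\<^sup>2" using d by (intro mult_left_mono) auto
      moreover have "(\<rho> - (\<epsilon> k)\<^sup>2)\<^sup>2 \<ge> \<rho>\<^sup>2 - 2 * \<rho> * (\<epsilon> k)\<^sup>2" by (simp add: power2_diff algebra_simps)
      ultimately have "\<epsilon> k * (2 * inner ?a ?d) \<le> \<epsilon> k * (\<epsilon> k * (c\<^sup>2 + 2 * \<rho>))"
        by (simp add: algebra_simps power2_eq_square)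
      then show ?thesis using \<epsilon>(1)[of k] by (simp only: mult_le_cancel_left_pos)
    qed
    have "2 * inner (toprow C x) (D *v v x) \<le> 0 * (c\<^sup>2 + 2 * \<rho>)"
    proof (rule LIMSEQ_le)
      show "(\<lambda>k. 2 * inner (toprow C ((u \<circ> r) k)) (D *v v ((u \<circ> r) k))) \<longlonglongrightarrow> 2 * inner (toprow C x) (D *v v x)"
        by (intro tendsto_intros toprow.tendsto bounded_linear.tendsto[OF matrix_vector_mul_bounded_linear] v.tendsto rx)
      show "(\<lambda>k. (\<epsilon> \<circ> r) k * (c\<^sup>2 + 2 * \<rho>)) \<longlonglongrightarrow> 0 * (c\<^sup>2 + 2 * \<rho>)"
        by (intro tendsto_intros LIMSEQ_subseq_LIMSEQ \<epsilon>lim rx)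
    qed (use est in auto)
    \<comment> \<open>As D (v x) = toprow C x at the limit, the left-hand side is twice the squared
      norm of \<open>toprow C x\<close>. The maximum is then attained by \<open>H\<close> alone,
      whose norm is at most 1.\<close>
    then have "toprow C x = 0" using D[OF xE] by (simp add: power2_norm_eq_inner[symmetric])
    then have "\<rho> = norm (H x)" using rx(4) by (simp add: G_def norm_Pair)
    then show ?thesis using H_le[of x] rx \<rho> by simp
  qed
qed

text \<open>A completion of maximal Frobenius norm is an extreme point of the set of contractive
  completions, so no rank one matrix \<open>a b\<^sup>*\<close> with \<open>a\<close>, \<open>b\<close> orthogonal to the two ranges below exists.\<close>

theorem extremal_completion:
  assumes ex: "\<exists>C. \<forall>x. norm (G C x) \<le> norm x"
    and ess: "ess_contracts \<theta> H" "0 \<le> \<theta>" "\<theta> < 1"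
  obtains C where "\<And>x. norm (G C x) \<le> norm x"
    "v ` maxv 1 C = UNIV \<or> toprow C ` maxv 1 C = UNIV"
proof -
  define S where "S = {C. \<forall>x. norm (G C x) \<le> norm x}"
  obtain K where K: "K > 0" "\<And>C D x. norm (G C x - G D x) \<le> norm (C - D) * K * norm x"
    using norm_G_diff_le by blast
  obtain B where "\<And>C. (\<And>x. norm (G C x) \<le> 1 * norm x) \<Longrightarrow> norm C \<le> B"
    using bounded_corners by blast
  then have "bounded S" unfolding bounded_iff S_def by auto
  moreover have "closed S"
  proof -
    have "continuous_on UNIV (\<lambda>C. G C x)" for x
    proof (rule lipschitz_on_continuous_on, rule lipschitz_onI)
      show "dist (G C x) (G D x) \<le> K * norm x * dist C D" for C D
        using K(2)[of C x D] by (simp add: dist_norm mult_ac)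
      show "0 \<le> K * norm x" using K by simp
    qed
    then show ?thesis unfolding S_def by (intro closed_Collect_all closed_Collect_le continuous_intros)
  qed
  ultimately have "compact S" by (simp add: compact_eq_bounded_closed)
  moreover have "S \<noteq> {}" using ex by (auto simp: S_def)
  ultimately obtain C where C: "C \<in> S" "\<forall>D\<in>S. norm D \<le> norm C"
    using continuous_attains_sup[of S norm] continuous_on_norm_id by blast
  have GC: "norm (G C x) \<le> norm x" for x using C by (simp add: S_def)
  have GC1: "norm (G C x) \<le> 1 * norm x" for x using GC by simp
  let ?E = "maxv 1 C"
  have sub: "subspace ?E" using subspace_maxv[OF GC1] by simp
  have clos: "closed ?E" unfolding maxv_def by (rule closed_maximising_vectors[OF bl_G])
  have "v ` ?E = UNIV \<or> toprow C ` ?E = UNIV"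
  proof (rule ccontr)
    assume neg: "\<not> ?thesis"
    have orth: "\<exists>a. a \<noteq> 0 \<and> (\<forall>x\<in>?E. inner a (f x) = 0)" if f: "bounded_linear f" "f ` ?E \<noteq> UNIV"
      for f :: "'a \<Rightarrow> complex^'n"
    proof -
      have "subspace (f ` ?E)" using linear_subspace_image[OF bounded_linear.linear[OF f(1)] sub] .
      then have sp: "span (f ` ?E) = f ` ?E" by (rule span_eq_iff[THEN iffD2])
      have "span (f ` ?E) \<noteq> UNIV" unfolding sp by (rule f(2))
      from span_not_univ_subset_hyperplane[OF this] show ?thesis unfolding sp by blast
    qed
    obtain b where b: "b \<noteq> 0" "\<And>x. x \<in> ?E \<Longrightarrow> inner b (v x) = 0" using orth[OF bl_v] neg by blast
    obtain a where a: "a \<noteq> 0" "\<And>x. x \<in> ?E \<Longrightarrow> inner a (toprow C x) = 0" using orth[OF bl_toprow] neg by blast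
    define D :: "complex^'n^'n" where "D = (\<chi> i j. a $ i * cnj (b $ j))"
    have Dv: "D *v w = (\<Sum>j\<in>UNIV. cnj (b $ j) * w $ j) *s a" for w
      by (simp add: D_def vec_eq_iff matrix_vector_mult_def sum_distrib_left sum_distrib_right mult_ac)
    \<comment> \<open>Orthogonality of b to v x and, through \<open>J\<close>, to i v x makes the
      complex Hermitian product vanish, not only its real part.\<close>
    have D0: "D *v v x = 0" if "x \<in> ?E" for x
      using b(2)[OF that] b(2)[OF J_maxv[OF that]] by (simp add: Dv inner_cnj_sum v_J zero_complex.code[symmetric])
    have D1: "inner (toprow C x) (D *v w) = 0" if "x \<in> ?E" for x w
    proof -
      have "inner (toprow C x) (\<i> *s a) = - inner (toprow C (J x)) a" by (simp add: toprow_J inner_ii_left)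
      then have "inner (toprow C x) (\<i> *s a) = 0" "inner (toprow C x) a = 0"
        using a(2)[OF that] a(2)[OF J_maxv[OF that]] by (auto simp: inner_commute)
      then show ?thesis unfolding Dv by (subst ii_vector_scale) (simp add: inner_add_right)
    qed
    have essG: "ess_contracts \<theta> (G C)"
      unfolding G_def by (intro ess_contracts_Pair ess bl_toprow)
    obtain \<gamma> where \<gamma>: "0 \<le> \<gamma>" "\<gamma> < 1"
      "\<And>d. (\<And>e. norm (G C e) = norm e \<Longrightarrow> inner d e = 0) \<Longrightarrow> norm (G C d) \<le> \<gamma> * norm d"
      using gap_orthogonal_to_maximising_vectors[OF bl_G GC essG ess(2,3)] by blast
    have Dne: "D \<noteq> 0"
    proof -
      obtain i j where "a $ i \<noteq> 0" "b $ j \<noteq> 0" using a b by (metis vec_eq_iff zero_index)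
      then have "D $ i $ j \<noteq> 0" by (simp add: D_def)
      then show ?thesis by auto
    qed
    \<comment> \<open>With this size the perturbation has norm at most 1 - \<gamma> and exactly
      fills the gap left on the complement of the maximising vectors.\<close>
    define s where "s = (1 - \<gamma>) / (norm D * K)"
    have s: "s > 0" "s * norm D * K = 1 - \<gamma>" using \<gamma> K Dne by (auto simp: s_def)
    have mem: "C + t *\<^sub>R D \<in> S" if t: "\<bar>t\<bar> = s" for t
      unfolding S_def mem_Collect_eq
    proof
      fix x
      obtain e where e: "e \<in> ?E" "\<And>m. m \<in> ?E \<Longrightarrow> inner (x - e) m = 0"
        using hilbert_projection[OF sub clos] by blast
      define d where "d = x - e"
      let ?G = "G (C + t *\<^sub>R D)"
      have GG: "?G y = G C y + (0, t *\<^sub>R (D *v v y))" for y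
        by (simp add: G_def toprow_def matrix_vector_mult_add_rdistrib scaleR_matrix_vector)
      have "norm (G C d) \<le> \<gamma> * norm d"
        using e(2) by (intro \<gamma>(3)) (auto simp: d_def maxv_def)
      moreover have "norm (?G d - G C d) \<le> (1 - \<gamma>) * norm d"
        using K(2)[of "C + t *\<^sub>R D" d C] t by (simp add: s(2))
      ultimately have "norm (?G d) \<le> norm d"
        using norm_triangle_sub[of "?G d" "G C d"] by (simp add: algebra_simps)
      then have Gd: "(norm (?G d))\<^sup>2 \<le> (norm d)\<^sup>2" by (intro power_mono) auto
      have Ge: "?G e = G C e" using D0[OF e(1)] by (simp add: GG zero_prod_def[symmetric])
      \<comment> \<open>The two parts of x stay orthogonal after the perturbation: the added term is
        a multiple of a, orthogonal to \<open>toprow C e\<close>, and the weak eigenvector equation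
        treats the rest. Their squared norms can therefore be estimated separately.\<close>
      have "inner (G C e) (?G d) = inner (G C e) (G C d)"
        unfolding GG inner_add_right by (simp add: G_def D1[OF e(1)])
      also have "\<dots> = inner e d"
        using maximising_vector_inner[OF bl_G GC1, of e d] e(1) by (simp add: maxv_def)
      also have ed: "inner e d = 0" using e by (simp add: d_def inner_commute)
      finally have cross: "inner (?G e) (?G d) = 0" using Ge by simp
      have "x = e + d" by (simp add: d_def)
      then have "(norm (?G x))\<^sup>2 = (norm (?G e))\<^sup>2 + (norm (?G d))\<^sup>2"
        using cross by (simp add: G.add norm_add_sq)
      also have "\<dots> \<le> (norm e)\<^sup>2 + (norm d)\<^sup>2"
        using e(1) Ge Gd by (simp add: maxv_def)
      also have "\<dots> = (norm x)\<^sup>2" using ed \<open>x = e + d\<close> by (simp add: norm_add_sq)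
      finally show "norm (?G x) \<le> norm x" by (rule power2_le_imp_le) simp
    qed
    \<comment> \<open>If both neighbours of \<open>C\<close> were contractive completions, the
      parallelogram identity would make one of them longer than \<open>C\<close>.\<close>
    have "(norm (C + s *\<^sub>R D))\<^sup>2 \<le> (norm C)\<^sup>2" "(norm (C - s *\<^sub>R D))\<^sup>2 \<le> (norm C)\<^sup>2"
      using mem[of s] mem[of "- s"] C(2) s(1) by (auto intro!: power_mono)
    moreover have "(norm (s *\<^sub>R D))\<^sup>2 > 0" using s Dne by simp
    ultimately show False using parallelogram_inner[of C "s *\<^sub>R D"] by linarith
  qed
  with GC that show thesis by blast
qed

end

section \<open>Uniqueness of Fourier coefficients\<close>

lemma space_Tm [simp]: "space Tm = {0..2*pi}"
  by (simp add: Tm_def)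

lemma emeasure_Tm: "emeasure Tm (space Tm) = ennreal (2*pi)"
  by (simp add: Tm_def emeasure_restrict_space)

interpretation Tm: finite_measure Tm
  by (rule finite_measureI) (simp only: emeasure_Tm, simp)

lemma measure_Tm [simp]: "measure Tm {0..2*pi} = 2*pi"
  using emeasure_Tm by (simp add: measure_def)

lemma AE_Tm_not_negligible:
  assumes "negligible N"
  shows "AE t in Tm. t \<notin> N"
proof -
  have "AE t in lebesgue. t \<notin> N"
    using assms by (intro AE_not_in) (simp add: negligible_iff_null_sets)
  then show ?thesis unfolding Tm_def by (subst AE_restrict_space_iff) auto
qed

lemma continuous_measurable_Tm:
  fixes f :: "real \<Rightarrow> 'b::euclidean_space"
  assumes "continuous_on {0..2*pi} f"
  shows "f \<in> borel_measurable Tm"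
  unfolding Tm_def using assms by (intro continuous_imp_measurable_on_sets_lebesgue) auto

lemma cis_measurable [measurable]: "(\<lambda>t. cis (a * t)) \<in> borel_measurable Tm"
  by (intro continuous_measurable_Tm continuous_intros)

definition fourier_null :: "(real \<Rightarrow> complex) \<Rightarrow> bool" where
  "fourier_null f \<longleftrightarrow> integrable Tm f \<and> (\<forall>j::int. (LINT t|Tm. f t * cis (- of_int j * t)) = 0)"

lemma integrable_mult_bounded:
  fixes f g :: "real \<Rightarrow> complex"
  assumes "integrable Tm f" "g \<in> borel_measurable Tm" "\<And>t. norm (g t) \<le> B"
  shows "integrable Tm (\<lambda>t. f t * g t)"
proof (rule Bochner_Integration.integrable_bound[of _ "\<lambda>t. B * norm (f t)"])
  show "integrable Tm (\<lambda>t. B * norm (f t))" using assms(1) by auto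
  show "(\<lambda>t. f t * g t) \<in> borel_measurable Tm" using assms by measurable
  show "AE t in Tm. norm (f t * g t) \<le> norm (B * norm (f t))"
  proof (rule AE_I2)
    fix t
    have "B \<ge> 0" using assms(3) norm_ge_zero order_trans by blast
    then show "norm (f t * g t) \<le> norm (B * norm (f t))"
      using mult_left_mono[OF assms(3)[of t] norm_ge_zero[of "f t"]] by (simp add: norm_mult mult.commute abs_mult)
  qed
qed

lemma integrable_mult_cis: "integrable Tm f \<Longrightarrow> integrable Tm (\<lambda>t. f t * cis (a * t))"
  by (rule integrable_mult_bounded[OF _ cis_measurable, where B=1]) auto

lemma fourier_null_add:
  assumes "fourier_null f" "fourier_null g" shows "fourier_null (\<lambda>t. f t + g t)"
proof -
  have i: "integrable Tm (\<lambda>t. f t * cis (- of_int j * t))" "integrable Tm (\<lambda>t. g t * cis (- of_int j * t))" for j :: int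
    using assms unfolding fourier_null_def by (blast intro: integrable_mult_cis)+
  show ?thesis using assms i by (auto simp: fourier_null_def distrib_right)
qed

lemma fourier_null_cmult:
  assumes "fourier_null f" shows "fourier_null (\<lambda>t. f t * c)"
proof -
  have "(LINT t|Tm. f t * c * cis (- of_int j * t)) = c * (LINT t|Tm. f t * cis (- of_int j * t))" for j :: int
    unfolding integral_mult_right_zero[symmetric] by (intro Bochner_Integration.integral_cong) auto
  then show ?thesis using assms by (auto simp: fourier_null_def)
qed

lemma fourier_null_cis:
  assumes "fourier_null f" shows "fourier_null (\<lambda>t. f t * cis (of_int k * t))"
proof -
  have "(LINT t|Tm. f t * cis (of_int k * t) * cis (- of_int j * t)) = (LINT t|Tm. f t * cis (- of_int (j - k) * t))" for j :: int
    by (intro Bochner_Integration.integral_cong) (auto simp: cis_mult mult.assoc algebra_simps)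
  then show ?thesis using assms unfolding fourier_null_def by (simp only: integrable_mult_cis) simp
qed

text \<open>On the circle a real-linear function of z has the form c z plus its conjugate, so
  multiplication by it only shifts and combines Fourier coefficients. Induction extends this to
  polynomials in cos t and sin t.\<close>

lemma fourier_null_polynomial:
  fixes g :: "complex \<Rightarrow> real"
  assumes "real_polynomial_function g" "fourier_null f"
  shows "fourier_null (\<lambda>t. f t * of_real (g (cis t)))"
  using assms
proof (induction arbitrary: f rule: real_polynomial_function.induct)
  case (linear g)
  then interpret bounded_linear g by simp
  define c where "c = (complex_of_real (g 1) - \<i> * of_real (g \<i>)) / 2"
  have "complex_of_real (g (cis t)) = cis (of_int 1 * t) * c + cis (of_int (-1) * t) * cnj c" for t
  proof -
    have "cis t = cos t *\<^sub>R 1 + sin t *\<^sub>R \<i>" by (simp add: complex_eq_iff)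
    then have "g (cis t) = cos t * g 1 + sin t * g \<i>" by (simp only: add scaleR) simp
    then show ?thesis by (simp add: c_def complex_eq_iff field_simps)
  qed
  then have *: "f t * of_real (g (cis t)) = f t * cis (of_int 1 * t) * c + f t * cis (of_int (-1) * t) * cnj c" for t
    by (simp only: distrib_left mult.assoc)
  show ?case unfolding * by (intro fourier_null_add fourier_null_cmult fourier_null_cis linear.prems)
next
  case (const c)
  then show ?case using fourier_null_cmult[of f "of_real c"] by simp
next
  case (add g h)
  then show ?case using fourier_null_add[of "\<lambda>t. f t * of_real (g (cis t))" "\<lambda>t. f t * of_real (h (cis t))"]
    by (simp add: distrib_left)
next
  case (mult g h)
  then show ?case using mult.IH(2)[OF mult.IH(1)[OF mult.prems]] by (simp add: mult.assoc)
qed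

lemma fourier_null_integral:
  assumes "fourier_null f" shows "(LINT t|Tm. f t) = 0"
  using assms unfolding fourier_null_def by (auto dest!: spec[of _ 0])

text \<open>Stone-Weierstrass on the circle replaces \<psi> by a polynomial, at the cost of e times
  the integral of the modulus of \<open>f\<close>.\<close>

lemma fourier_null_continuous_circle:
  fixes \<psi> :: "complex \<Rightarrow> real"
  assumes f: "fourier_null f" and \<psi>: "continuous_on (sphere 0 1) \<psi>"
    and m: "(\<lambda>t. \<psi> (cis t)) \<in> borel_measurable Tm"
  shows "(LINT t|Tm. f t * of_real (\<psi> (cis t))) = 0"
proof -
  define I where "I = (LINT t|Tm. norm (f t))"
  have intf: "integrable Tm f" using f by (simp add: fourier_null_def)
  have I: "I \<ge> 0" by (simp add: I_def)
  have "norm (LINT t|Tm. f t * of_real (\<psi> (cis t))) \<le> e * I" if e: "e > 0" for e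
  proof -
    obtain g where g: "real_polynomial_function g" "\<And>z. z \<in> sphere 0 1 \<Longrightarrow> \<bar>\<psi> z - g z\<bar> < e"
      using Stone_Weierstrass_real_polynomial_function[OF compact_sphere \<psi> e] by blast
    have gm: "(\<lambda>t. g (cis t)) \<in> borel_measurable Tm"
      by (intro continuous_measurable_Tm continuous_on_compose2[OF continuous_on_polymonial_function[of g UNIV]] continuous_intros)
         (use g(1) in \<open>auto simp: real_polynomial_function_eq\<close>)
    have fg: "fourier_null (\<lambda>t. f t * of_real (g (cis t)))" by (rule fourier_null_polynomial[OF g(1) f])
    have b: "norm (complex_of_real (\<psi> (cis t)) - of_real (g (cis t))) \<le> e" for t
      unfolding of_real_diff[symmetric] norm_of_real using g(2)[of "cis t"] by (simp add: less_imp_le)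
    have int1: "integrable Tm (\<lambda>t. f t * (of_real (\<psi> (cis t)) - of_real (g (cis t))))"
      using b m gm by (intro integrable_mult_bounded[OF intf]) auto
    have "(LINT t|Tm. f t * of_real (\<psi> (cis t)))
        = (LINT t|Tm. f t * (of_real (\<psi> (cis t)) - of_real (g (cis t))) + f t * of_real (g (cis t)))"
      by (intro Bochner_Integration.integral_cong) (auto simp: algebra_simps)
    also have "\<dots> = (LINT t|Tm. f t * (of_real (\<psi> (cis t)) - of_real (g (cis t))))"
      using fourier_null_integral[OF fg] int1 fg by (simp add: fourier_null_def)
    also have "norm \<dots> \<le> (LINT t|Tm. norm (f t * (of_real (\<psi> (cis t)) - of_real (g (cis t)))))"
      by (rule integral_norm_bound)
    also have "\<dots> \<le> (LINT t|Tm. e * norm (f t))"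
    proof (rule integral_mono)
      show "norm (f t * (of_real (\<psi> (cis t)) - of_real (g (cis t)))) \<le> e * norm (f t)" for t
        using mult_left_mono[OF b[of t] norm_ge_zero[of "f t"]] by (simp add: norm_mult mult.commute)
    qed (use int1 intf in auto)
    also have "\<dots> = e * I" by (simp add: I_def)
    finally show ?thesis .
  qed
  then have "norm (LINT t|Tm. f t * of_real (\<psi> (cis t))) \<le> 0 + e" if "e > 0" for e
  proof -
    have "e / (I + 1) > 0" using that I by simp
    from \<open>\<And>e. e > 0 \<Longrightarrow> _ \<le> e * I\<close>[OF this]
    have "norm (LINT t|Tm. f t * of_real (\<psi> (cis t))) \<le> e / (I + 1) * I" .
    also have "\<dots> \<le> e" using that I by (simp add: field_simps)
    finally show ?thesis by simp
  qed
  then have "norm (LINT t|Tm. f t * of_real (\<psi> (cis t))) \<le> 0" by (rule field_le_epsilon)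
  then show ?thesis by simp
qed

text \<open>Equal values at both ends let \<phi> descend to a continuous function on the
  circle.\<close>

lemma fourier_null_continuous_real:
  fixes \<phi> :: "real \<Rightarrow> real"
  assumes f: "fourier_null f" and \<phi>: "continuous_on {0..2*pi} \<phi>" "\<phi> 0 = 0" "\<phi> (2*pi) = 0"
  shows "(LINT t|Tm. f t * of_real (\<phi> t)) = 0"
proof -
  define \<psi> where "\<psi> z = \<phi> (Arg2pi z)" for z
  have eq: "\<psi> (cis t) = \<phi> t" if "t \<in> {0..2*pi}" for t
  proof (cases "t = 2*pi")
    case True
    then show ?thesis using \<phi> by (simp add: \<psi>_def Arg2pi_of_real[of 1, simplified])
  next
    case False
    then have "Arg2pi (cis t) = t" using that
      by (intro Arg2pi_unique[of 1]) (auto simp: cis_conv_exp)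
    then show ?thesis by (simp add: \<psi>_def)
  qed
  \<comment> \<open>\<open>Arg2pi\<close> jumps at 1, so continuity is proved with closed sets: each
    preimage is the image under \<open>cis\<close> of a compact part of the interval.\<close>
  have "continuous_on (sphere 0 1) \<psi>"
    unfolding continuous_on_closed_vimage[OF closed_sphere]
  proof (intro allI impI)
    fix B :: "real set" assume B: "closed B"
    have "\<psi> -` B \<inter> sphere 0 1 = cis ` ({0..2*pi} \<inter> \<phi> -` B)"
    proof (intro equalityI subsetI)
      fix z assume z: "z \<in> \<psi> -` B \<inter> sphere 0 1"
      then have "cis (Arg2pi z) = z" using Arg2pi_eq[of z] by (simp add: cis_conv_exp)
      moreover have "Arg2pi z \<in> {0..2*pi}" using Arg2pi[of z] by auto
      ultimately show "z \<in> cis ` ({0..2*pi} \<inter> \<phi> -` B)" using z by (auto simp: \<psi>_def intro!: image_eqI[of _ _ "Arg2pi z"])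
    next
      fix z assume "z \<in> cis ` ({0..2*pi} \<inter> \<phi> -` B)"
      then show "z \<in> \<psi> -` B \<inter> sphere 0 1" using eq by auto
    qed
    moreover have "closed ({0..2*pi} \<inter> \<phi> -` B)"
      using continuous_on_closed_vimage[of "{0..2*pi}" \<phi>] \<phi>(1) B by (auto simp: Int_commute)
    then have "compact ({0..2*pi} \<inter> \<phi> -` B)"
      by (auto simp: compact_eq_bounded_closed intro: bounded_subset[OF bounded_closed_interval])
    then have "compact (cis ` ({0..2*pi} \<inter> \<phi> -` B))"
      by (intro compact_continuous_image continuous_intros)
    ultimately show "closed (\<psi> -` B \<inter> sphere 0 1)" by (simp add: compact_imp_closed)
  qed
  moreover have m: "(\<lambda>t. \<psi> (cis t)) \<in> borel_measurable Tm"
    by (subst measurable_cong[where g=\<phi>]) (use eq \<phi>(1) in \<open>auto intro: continuous_measurable_Tm\<close>)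
  ultimately have "(LINT t|Tm. f t * of_real (\<psi> (cis t))) = 0"
    using fourier_null_continuous_circle[OF f] by blast
  moreover have "(LINT t|Tm. f t * of_real (\<psi> (cis t))) = (LINT t|Tm. f t * of_real (\<phi> t))"
    by (intro Bochner_Integration.integral_cong) (auto simp: eq)
  ultimately show ?thesis by simp
qed

lemma fourier_null_continuous:
  fixes \<phi> :: "real \<Rightarrow> complex"
  assumes f: "fourier_null f" and \<phi>: "continuous_on {0..2*pi} \<phi>" "\<phi> 0 = 0" "\<phi> (2*pi) = 0"
  shows "(LINT t|Tm. f t * \<phi> t) = 0"
proof -
  have c: "continuous_on {0..2*pi} (\<lambda>t. Re (\<phi> t))" "continuous_on {0..2*pi} (\<lambda>t. Im (\<phi> t))"
    using \<phi>(1) by (auto intro!: continuous_intros)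
  have int: "integrable Tm (\<lambda>t. f t * of_real (h t))" if h: "continuous_on {0..2*pi} h" for h :: "real \<Rightarrow> real"
  proof -
    have "compact (h ` {0..2*pi})" using h by (intro compact_continuous_image) auto
    from compact_imp_bounded[OF this]
    obtain B where "\<forall>x\<in>h ` {0..2*pi}. norm x \<le> B" unfolding bounded_iff ..
    then have B: "norm (h t) \<le> B" if "t \<in> {0..2*pi}" for t using that by blast
    \<comment> \<open>\<open>h\<close> is arbitrary off the interval, so a uniform bound is
      available only after cutting off there; \<open>Tm\<close> does not see the difference.\<close>
    have i: "integrable Tm (\<lambda>t. f t * (if t \<in> {0..2*pi} then of_real (h t) else 0))"
    proof (rule integrable_mult_bounded[where B="max B 0"])
      show "integrable Tm f" using f by (simp add: fourier_null_def)
      show "(\<lambda>t. if t \<in> {0..2*pi} then complex_of_real (h t) else 0) \<in> borel_measurable Tm"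
        using continuous_measurable_Tm[OF h] by (subst measurable_cong[where g="\<lambda>t. complex_of_real (h t)"]) auto
      show "norm (if t \<in> {0..2*pi} then complex_of_real (h t) else 0) \<le> max B 0" for t
        using B[of t] by (cases "t \<in> {0..2*pi}") (simp_all add: le_max_iff_disj)
    qed
    have "(\<lambda>t. f t * of_real (h t)) \<in> borel_measurable Tm"
      using f continuous_measurable_Tm[OF h] by (auto simp: fourier_null_def)
    then show ?thesis by (rule integrable_cong_AE_imp[OF i]) (auto intro!: AE_I2)
  qed
  have "(LINT t|Tm. f t * \<phi> t) = (LINT t|Tm. f t * of_real (Re (\<phi> t)) + (f t * of_real (Im (\<phi> t))) * \<i>)"
    by (intro Bochner_Integration.integral_cong) (auto simp: complex_eq_iff algebra_simps)
  also have "\<dots> = (LINT t|Tm. f t * of_real (Re (\<phi> t))) + (LINT t|Tm. f t * of_real (Im (\<phi> t))) * \<i>"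
    using int[OF c(1)] int[OF c(2)] by simp
  also have "\<dots> = 0" using fourier_null_continuous_real[OF f c(1)] fourier_null_continuous_real[OF f c(2)] \<phi> by simp
  finally show ?thesis .
qed

text \<open>Admissible continuous test functions of modulus at most 1 converge almost everywhere to
  the conjugate phase of \<open>f\<close>. Dominated convergence then shows that the integral of the
  modulus of \<open>f\<close> vanishes.\<close>

theorem fourier_uniqueness:
  assumes f: "fourier_null f" shows "AE t in Tm. f t = 0"
proof -
  have intf: "integrable Tm f" using f by (simp add: fourier_null_def)
  then have fm: "f \<in> borel_measurable Tm" by auto
  define h where "h t = cnj (sgn (f t))" for t
  have "(\<lambda>t. sgn (f t)) \<in> borel_measurable Tm"
    unfolding sgn_div_norm by (intro borel_measurable_scaleR borel_measurable_inverse measurable_compose[OF fm borel_measurable_norm] fm)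
  then have hm: "h \<in> borel_measurable Tm"
    unfolding h_def by (rule borel_measurable_continuous_on[OF continuous_on_cnj[OF continuous_on_id]])
  then have "h measurable_on {0..2*pi}"
    by (subst measurable_on_iff_borel_measurable) (auto simp: Tm_def)
  then obtain N g where Ng: "negligible N \<and> (\<forall>n. continuous_on UNIV (g n)) \<and>
      (\<forall>x. x \<notin> N \<longrightarrow> (\<lambda>n::nat. g n x) \<longlonglongrightarrow> (if x \<in> {0..2*pi} then h x else 0))"
    unfolding measurable_on_def by (elim exE) (rule that)
  then have N: "negligible N" and g: "continuous_on UNIV (g n)"
    and lim: "x \<notin> N \<Longrightarrow> (\<lambda>n. g n x) \<longlonglongrightarrow> (if x \<in> {0..2*pi} then h x else 0)" for n x
    by auto
  \<comment> \<open>The cutoff \<open>k\<close> vanishes at 0 and 2 pi, as the test functions must,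
    and tends to 1 in between. Dividing by max 1 |g| bounds the approximants without changing their
    limit, because |h| \<le> 1.\<close>
  define k where "k n t = min 1 (real n * min \<bar>t\<bar> \<bar>2*pi - t\<bar>)" for n t
  define p where "p n t = of_real (k n t) * (g n t / of_real (max 1 (norm (g n t))))" for n t
  have pc: "continuous_on UNIV (p n)" for n
    unfolding p_def k_def by (intro continuous_intros g) (auto simp: max_def)
  have pb: "norm (p n t) \<le> 1" for n t
  proof -
    have "norm (k n t) \<le> 1" by (auto simp: k_def)
    moreover have "norm (g n t / complex_of_real (max 1 (norm (g n t)))) \<le> 1"
      by (auto simp: norm_divide divide_simps max_def)
    ultimately show ?thesis unfolding p_def norm_mult norm_of_real
      by (metis mult_le_one norm_ge_zero real_norm_def)
  qed
  have plim: "(\<lambda>n. p n t) \<longlonglongrightarrow> h t" if t: "t \<in> {0..2*pi}" "t \<notin> N \<union> {0, 2*pi}" for t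
  proof -
    have "(\<lambda>n. g n t) \<longlonglongrightarrow> h t" using lim[of t] t by auto
    moreover have "norm (h t) \<le> 1" by (simp add: h_def norm_sgn)
    ultimately have "(\<lambda>n. g n t / complex_of_real (max 1 (norm (g n t)))) \<longlonglongrightarrow> h t / of_real (max 1 (norm (h t)))"
      by (intro tendsto_intros) (auto simp: max_def)
    then have "(\<lambda>n. g n t / complex_of_real (max 1 (norm (g n t)))) \<longlonglongrightarrow> h t"
      using \<open>norm (h t) \<le> 1\<close> by (simp add: max_def split: if_splits)
    have "(\<lambda>n. k n t) \<longlonglongrightarrow> 1"
    proof (rule tendsto_eventually)
      define d where "d = min \<bar>t\<bar> \<bar>2*pi - t\<bar>"
      have d: "d > 0" using t by (auto simp: d_def)
      obtain M where M: "1 / d < real M" using reals_Archimedean2 by blast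
      have "k n t = 1" if "n \<ge> M" for n
      proof -
        have "1 \<le> real M * d" using M d by (simp add: field_simps)
        also have "\<dots> \<le> real n * d" using that d by (intro mult_right_mono) auto
        finally show ?thesis by (simp add: k_def d_def)
      qed
      then show "\<forall>\<^sub>F n in sequentially. k n t = 1" unfolding eventually_sequentially by blast
    qed
    then have "(\<lambda>n. complex_of_real (k n t)) \<longlonglongrightarrow> of_real 1" by (rule tendsto_of_real)
    then have "(\<lambda>n. p n t) \<longlonglongrightarrow> of_real 1 * h t"
      unfolding p_def by (rule tendsto_mult) fact
    then show ?thesis by simp
  qed
  have "(\<lambda>n. LINT t|Tm. f t * p n t) \<longlonglongrightarrow> (LINT t|Tm. f t * h t)"
  proof (rule integral_dominated_convergence[where w="\<lambda>t. norm (f t)"])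
    show "(\<lambda>t. f t * h t) \<in> borel_measurable Tm" using fm hm by measurable
    show "(\<lambda>t. f t * p n t) \<in> borel_measurable Tm" for n
      using fm continuous_measurable_Tm[OF continuous_on_subset[OF pc[of n]]] by auto
    show "integrable Tm (\<lambda>t. norm (f t))" using intf by auto
    have "negligible (N \<union> {0, 2*pi})" using N by auto
    from AE_Tm_not_negligible[OF this] AE_space[of Tm]
    show "AE t in Tm. (\<lambda>n. f t * p n t) \<longlonglongrightarrow> f t * h t"
      by eventually_elim (intro tendsto_intros plim, auto)
    show "AE t in Tm. norm (f t * p n t) \<le> norm (f t)" for n
      using pb by (intro AE_I2) (simp add: norm_mult mult_left_le)
  qed
  moreover have "(LINT t|Tm. f t * p n t) = 0" for n
    by (rule fourier_null_continuous[OF f]) (use continuous_on_subset[OF pc[of n]] in \<open>auto simp: p_def k_def\<close>)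
  ultimately have "(LINT t|Tm. f t * h t) = 0" by (simp add: LIMSEQ_const_iff)
  moreover have "f t * h t = of_real (norm (f t))" for t
    by (cases "f t = 0") (simp_all add: h_def sgn_eq complex_norm_square[symmetric] power2_eq_square)
  ultimately have "(LINT t|Tm. norm (f t)) = 0" by (simp add: integral_complex_of_real)
  then have "AE t in Tm. norm (f t) = 0" using intf by (subst (asm) integral_nonneg_eq_0_iff_AE) auto
  then show ?thesis by simp
qed

section \<open>The Hilbert space of square integrable functions on the circle\<close>

lemma L2_measurable: "f \<in> L2 \<Longrightarrow> f \<in> borel_measurable Tm"
  by (simp add: L2_def)

lemma L2_bound:
  fixes f :: "real \<Rightarrow> complex^'m" and g :: "real \<Rightarrow> complex^'n"
  assumes f: "f \<in> borel_measurable Tm" and g: "g \<in> L2" "AE t in Tm. norm (f t) \<le> C * norm (g t)"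
  shows "f \<in> L2"
proof -
  have "integrable Tm (\<lambda>t. (norm (f t))\<^sup>2)"
  proof (rule Bochner_Integration.integrable_bound[of _ "\<lambda>t. C\<^sup>2 * (norm (g t))\<^sup>2"])
    show "integrable Tm (\<lambda>t. C\<^sup>2 * (norm (g t))\<^sup>2)" using g by (auto simp: L2_def)
    show "(\<lambda>t. (norm (f t))\<^sup>2) \<in> borel_measurable Tm" using f by measurable
    show "AE t in Tm. norm ((norm (f t))\<^sup>2) \<le> norm (C\<^sup>2 * (norm (g t))\<^sup>2)"
      using g(2)
    proof eventually_elim
      case (elim t)
      then have "(norm (f t))\<^sup>2 \<le> (C * norm (g t))\<^sup>2" by (intro power_mono) auto
      then show ?case by (simp add: power_mult_distrib)
    qed
  qed
  then show ?thesis using f by (simp add: L2_def)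
qed

lemma L2_add:
  fixes f g :: "real \<Rightarrow> complex^'n"
  assumes "f \<in> L2" "g \<in> L2" shows "(\<lambda>t. f t + g t) \<in> L2"
proof -
  have "integrable Tm (\<lambda>t. (norm (f t + g t))\<^sup>2)"
  proof (rule Bochner_Integration.integrable_bound[of _ "\<lambda>t. 2 * (norm (f t))\<^sup>2 + 2 * (norm (g t))\<^sup>2"])
    show "integrable Tm (\<lambda>t. 2 * (norm (f t))\<^sup>2 + 2 * (norm (g t))\<^sup>2)" using assms by (auto simp: L2_def)
    show "(\<lambda>t. (norm (f t + g t))\<^sup>2) \<in> borel_measurable Tm" using assms by (auto simp: L2_def)
    show "AE t in Tm. norm ((norm (f t + g t))\<^sup>2) \<le> norm (2 * (norm (f t))\<^sup>2 + 2 * (norm (g t))\<^sup>2)"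
    proof (rule AE_I2)
      fix t
      have "0 \<le> (norm (f t - g t))\<^sup>2" by simp
      then have "(norm (f t + g t))\<^sup>2 \<le> 2 * (norm (f t))\<^sup>2 + 2 * (norm (g t))\<^sup>2"
        using parallelogram_inner[of "f t" "g t"] by linarith
      then show "norm ((norm (f t + g t))\<^sup>2) \<le> norm (2 * (norm (f t))\<^sup>2 + 2 * (norm (g t))\<^sup>2)"
        by simp
    qed
  qed
  then show ?thesis using assms by (auto simp: L2_def)
qed

lemma L2_scaleR: "f \<in> L2 \<Longrightarrow> (\<lambda>t. c *\<^sub>R f t) \<in> L2"
  by (rule L2_bound[of _ f "\<bar>c\<bar>"]) (auto simp: L2_def)

lemma L2_zero: "(\<lambda>t. 0) \<in> L2"
  by (simp add: L2_def)

lemma L2_uminus: "f \<in> L2 \<Longrightarrow> (\<lambda>t. - f t) \<in> L2"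
  using L2_scaleR[of f "-1"] by simp

lemma L2_diff: "f \<in> L2 \<Longrightarrow> g \<in> L2 \<Longrightarrow> (\<lambda>t. f t - g t) \<in> L2"
  using L2_add[of f "\<lambda>t. - g t"] L2_uminus[of g] by simp

lemma L2_cong:
  assumes "f \<in> L2" "g \<in> borel_measurable Tm" "AE t in Tm. f t = g t"
  shows "g \<in> L2"
  by (rule L2_bound[OF assms(2,1), of 1]) (use assms(3) in auto)

lemma L2_inner_integrable:
  assumes "f \<in> L2" "g \<in> L2" shows "integrable Tm (\<lambda>t. inner (f t) (g t))"
proof (rule Bochner_Integration.integrable_bound[of _ "\<lambda>t. (norm (f t))\<^sup>2 + (norm (g t))\<^sup>2"])
  show "integrable Tm (\<lambda>t. (norm (f t))\<^sup>2 + (norm (g t))\<^sup>2)" using assms by (auto simp: L2_def)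
  show "(\<lambda>t. inner (f t) (g t)) \<in> borel_measurable Tm" using assms by (auto simp: L2_def)
  show "AE t in Tm. norm (inner (f t) (g t)) \<le> norm ((norm (f t))\<^sup>2 + (norm (g t))\<^sup>2)"
  proof (rule AE_I2)
    fix t
    have "norm (inner (f t) (g t)) \<le> norm (f t) * norm (g t)" by (simp add: Cauchy_Schwarz_ineq2)
    also have "2 * (norm (f t) * norm (g t)) \<le> (norm (f t))\<^sup>2 + (norm (g t))\<^sup>2"
      using sum_squares_bound[of "norm (f t)" "norm (g t)"] by (simp add: mult.assoc)
    then have "norm (f t) * norm (g t) \<le> (norm (f t))\<^sup>2 + (norm (g t))\<^sup>2"
      using mult_nonneg_nonneg[OF norm_ge_zero norm_ge_zero, of "f t" "g t"] by linarith
    finally show "norm (inner (f t) (g t)) \<le> norm ((norm (f t))\<^sup>2 + (norm (g t))\<^sup>2)" by simp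
  qed
qed

\<comment> \<open>Square integrable functions modulo null functions as a real inner product
  space\<close>
quotient_type 'n lsq = "real \<Rightarrow> complex^'n" /
  partial: "\<lambda>f g. f \<in> L2 \<and> g \<in> L2 \<and> (AE t in Tm. f t = g t)"
proof (rule part_equivpI)
  show "\<exists>f::real \<Rightarrow> complex^'n. f \<in> L2 \<and> f \<in> L2 \<and> (AE t in Tm. f t = f t)"
    using L2_zero by auto
  show "symp (\<lambda>f g. f \<in> L2 \<and> g \<in> L2 \<and> (AE t in Tm. f t = (g t :: complex^'n)))"
    by (rule sympI) (auto simp: eq_commute)
  show "transp (\<lambda>f g. f \<in> L2 \<and> g \<in> L2 \<and> (AE t in Tm. f t = (g t :: complex^'n)))"
    by (rule transpI) auto
qed

instantiation lsq :: (finite) real_vector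
begin

lift_definition zero_lsq :: "'a lsq" is "\<lambda>t. 0" by (simp add: L2_zero)
lift_definition plus_lsq :: "'a lsq \<Rightarrow> 'a lsq \<Rightarrow> 'a lsq" is "\<lambda>f g t. f t + g t"
  by (auto simp: L2_add)
lift_definition minus_lsq :: "'a lsq \<Rightarrow> 'a lsq \<Rightarrow> 'a lsq" is "\<lambda>f g t. f t - g t"
  by (auto simp: L2_diff)
lift_definition uminus_lsq :: "'a lsq \<Rightarrow> 'a lsq" is "\<lambda>f t. - f t"
  by (auto simp: L2_uminus)
lift_definition scaleR_lsq :: "real \<Rightarrow> 'a lsq \<Rightarrow> 'a lsq" is "\<lambda>c f t. c *\<^sub>R f t"
  by (auto simp: L2_scaleR)

instance
  by standard
    (transfer; auto simp: L2_add L2_zero L2_uminus L2_diff L2_scaleR algebra_simps)+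

end

instantiation lsq :: (finite) real_inner
begin

text \<open>The real part of the Hermitian product for normalised Lebesgue measure. The complex
  structure returns later as the operator \<open>im\<close>.\<close>

lift_definition inner_lsq :: "'a lsq \<Rightarrow> 'a lsq \<Rightarrow> real"
  is "\<lambda>f g. (LINT t|Tm. inner (f t) (g t)) / (2*pi)"
proof -
  fix f f' g g' :: "real \<Rightarrow> complex^'a"
  assume f: "f \<in> L2 \<and> f' \<in> L2 \<and> (AE t in Tm. f t = f' t)" and g: "g \<in> L2 \<and> g' \<in> L2 \<and> (AE t in Tm. g t = g' t)"
  have "(LINT t|Tm. inner (f t) (g t)) = (LINT t|Tm. inner (f' t) (g' t))"
    using f g by (intro integral_cong_AE) (auto simp: L2_def)
  then show "(LINT t|Tm. inner (f t) (g t)) / (2*pi) = (LINT t|Tm. inner (f' t) (g' t)) / (2*pi)" by simp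
qed

definition norm_lsq :: "'a lsq \<Rightarrow> real" where "norm_lsq x = sqrt (inner x x)"
definition dist_lsq :: "'a lsq \<Rightarrow> 'a lsq \<Rightarrow> real" where "dist_lsq x y = norm (x - y)"
definition sgn_lsq :: "'a lsq \<Rightarrow> 'a lsq" where "sgn_lsq x = x /\<^sub>R norm x"
definition uniformity_lsq :: "('a lsq \<times> 'a lsq) filter" where
  "uniformity_lsq = (INF e\<in>{0<..}. principal {(x, y). dist x y < e})"
definition open_lsq :: "'a lsq set \<Rightarrow> bool" where
  "open_lsq U = (\<forall>x\<in>U. eventually (\<lambda>(x', y). x' = x \<longrightarrow> y \<in> U) uniformity)"

instance
proof
  fix x y z :: "'a lsq" and r :: real
  show "inner x y = inner y x" by transfer (simp add: inner_commute)
  show "inner (x + y) z = inner x z + inner y z"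
    by transfer (auto simp: inner_add_left L2_inner_integrable add_divide_distrib)
  show "inner (r *\<^sub>R x) y = r * inner x y" by transfer simp
  show "0 \<le> inner x x" by transfer simp
  show "(inner x x = 0) = (x = 0)"
  proof transfer
    fix f :: "real \<Rightarrow> complex^'a"
    assume f: "f \<in> L2 \<and> f \<in> L2 \<and> (AE t in Tm. f t = f t)"
    have "((LINT t|Tm. inner (f t) (f t)) / (2*pi) = 0) = ((LINT t|Tm. inner (f t) (f t)) = 0)" by simp
    also have "\<dots> = (AE t in Tm. inner (f t) (f t) = 0)"
      using f by (intro integral_nonneg_eq_0_iff_AE L2_inner_integrable) auto
    finally show "((LINT t|Tm. inner (f t) (f t)) / (2*pi) = 0) = (f \<in> L2 \<and> (\<lambda>t. 0) \<in> L2 \<and> (AE t in Tm. f t = 0))"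
      using f by (simp add: L2_zero)
  qed
qed (auto simp: norm_lsq_def dist_lsq_def sgn_lsq_def uniformity_lsq_def open_lsq_def)

end

abbreviation cls :: "(real \<Rightarrow> complex^'n) \<Rightarrow> 'n lsq" where "cls \<equiv> abs_lsq"
abbreviation rep :: "'n lsq \<Rightarrow> real \<Rightarrow> complex^'n" where "rep \<equiv> rep_lsq"

lemma rep_L2 [simp, intro]: "rep x \<in> L2"
  using Quotient_rep_reflp[OF Quotient_lsq, of x] by simp

lemma rep_measurable [measurable]: "rep x \<in> borel_measurable Tm"
  by (rule L2_measurable) simp

lemma cls_rep [simp]: "cls (rep x) = x"
  by (rule Quotient_abs_rep[OF Quotient_lsq])

lemma cls_eq_iff: "f \<in> L2 \<Longrightarrow> g \<in> L2 \<Longrightarrow> cls f = cls g \<longleftrightarrow> (AE t in Tm. f t = g t)"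
  using Quotient_rel[OF Quotient_lsq, of f g] by auto

lemma rep_cls: "f \<in> L2 \<Longrightarrow> AE t in Tm. rep (cls f) t = f t"
  using cls_eq_iff[of "rep (cls f)" f] by simp

lemma lsq_eq_iff: "x = y \<longleftrightarrow> (AE t in Tm. rep x t = rep y t)"
  using cls_eq_iff[of "rep x" "rep y"] by simp

lemma cls_add: "f \<in> L2 \<Longrightarrow> g \<in> L2 \<Longrightarrow> cls (\<lambda>t. f t + g t) = cls f + cls g"
  by (simp add: plus_lsq.abs_eq eq_onp_def)
lemma cls_diff: "f \<in> L2 \<Longrightarrow> g \<in> L2 \<Longrightarrow> cls (\<lambda>t. f t - g t) = cls f - cls g"
  by (simp add: minus_lsq.abs_eq eq_onp_def)
lemma cls_scaleR: "f \<in> L2 \<Longrightarrow> cls (\<lambda>t. c *\<^sub>R f t) = c *\<^sub>R cls f"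
  by (simp add: scaleR_lsq.abs_eq eq_onp_def)
lemma cls_zero: "cls (\<lambda>t. 0) = 0"
  by (simp add: zero_lsq_def)
lemma inner_cls: "f \<in> L2 \<Longrightarrow> g \<in> L2 \<Longrightarrow> inner (cls f) (cls g) = (LINT t|Tm. inner (f t) (g t)) / (2*pi)"
  by (simp add: inner_lsq.abs_eq eq_onp_def)

lemma inner_rep: "inner x y = (LINT t|Tm. inner (rep x t) (rep y t)) / (2*pi)"
  using inner_cls[of "rep x" "rep y"] by simp

lemma norm_cls: "f \<in> L2 \<Longrightarrow> norm (cls f) = L2norm f"
  unfolding norm_lsq_def L2norm_def by (simp add: inner_cls power2_norm_eq_inner)

lemma norm_sq_rep: "(norm x)\<^sup>2 = (LINT t|Tm. (norm (rep x t))\<^sup>2) / (2*pi)"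
  by (simp add: power2_norm_eq_inner inner_rep)

lemma rep_add: "AE t in Tm. rep (x + y) t = rep x t + rep y t"
  using rep_cls[OF L2_add[of "rep x" "rep y"]] by (simp add: cls_add)
lemma rep_scaleR: "AE t in Tm. rep (c *\<^sub>R x) t = c *\<^sub>R rep x t"
  using rep_cls[OF L2_scaleR[of "rep x" c]] by (simp add: cls_scaleR)
lemma rep_zero: "AE t in Tm. rep 0 t = 0"
  using rep_cls[OF L2_zero] by (simp add: cls_zero)

text \<open>Fatou's lemma for the squared norms. Obtaining membership of the limit together with the
  bound serves both completeness and the contractivity of a symbol not yet known to be
  bounded.\<close>

lemma L2_Fatou:
  fixes f :: "nat \<Rightarrow> real \<Rightarrow> complex^'n"
  assumes f: "\<And>k. f k \<in> L2" "\<And>k. norm (cls (f k)) \<le> c" and g: "g \<in> borel_measurable Tm"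
    and lim: "AE t in Tm. (\<lambda>k. f k t) \<longlonglongrightarrow> g t"
  shows "g \<in> L2" "norm (cls g) \<le> c"
proof -
  have c: "c \<ge> 0" using f(2)[of 0] norm_ge_zero order_trans by blast
  have nn: "(\<integral>\<^sup>+t. ennreal ((norm (f k t))\<^sup>2) \<partial>Tm) \<le> ennreal (2 * pi * c\<^sup>2)" for k
  proof -
    have "(\<integral>\<^sup>+t. ennreal ((norm (f k t))\<^sup>2) \<partial>Tm) = ennreal (LINT t|Tm. (norm (f k t))\<^sup>2)"
      using f(1)[of k] by (intro nn_integral_eq_integral) (auto simp: L2_def)
    moreover have "(norm (cls (f k)))\<^sup>2 = (LINT t|Tm. (norm (f k t))\<^sup>2) / (2*pi)"
      by (simp add: norm_cls[OF f(1)] L2norm_def)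
    moreover have "(norm (cls (f k)))\<^sup>2 \<le> c\<^sup>2" using f(2) by (intro power_mono) auto
    ultimately show ?thesis using ennreal_leI[of "LINT t|Tm. (norm (f k t))\<^sup>2" "2 * pi * c\<^sup>2"]
      by (simp add: pos_divide_le_eq mult.commute)
  qed
  have "(\<integral>\<^sup>+t. ennreal ((norm (g t))\<^sup>2) \<partial>Tm) = (\<integral>\<^sup>+t. liminf (\<lambda>k. ennreal ((norm (f k t))\<^sup>2)) \<partial>Tm)"
  proof (rule nn_integral_cong_AE)
    show "AE t in Tm. ennreal ((norm (g t))\<^sup>2) = liminf (\<lambda>k. ennreal ((norm (f k t))\<^sup>2))"
      using lim
    proof eventually_elim
      case (elim t)
      then have "(\<lambda>k. ennreal ((norm (f k t))\<^sup>2)) \<longlonglongrightarrow> ennreal ((norm (g t))\<^sup>2)" by (intro tendsto_intros)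
      then show ?case using lim_imp_Liminf by (metis sequentially_bot)
    qed
  qed
  also have "\<dots> \<le> liminf (\<lambda>k. \<integral>\<^sup>+t. ennreal ((norm (f k t))\<^sup>2) \<partial>Tm)"
    using L2_measurable[OF f(1)] by (intro nn_integral_liminf) measurable
  also have "\<dots> \<le> liminf (\<lambda>k::nat. ennreal (2 * pi * c\<^sup>2))"
    by (intro Liminf_mono always_eventually allI nn)
  finally have le: "(\<integral>\<^sup>+t. ennreal ((norm (g t))\<^sup>2) \<partial>Tm) \<le> ennreal (2 * pi * c\<^sup>2)"
    by (simp add: Liminf_const)
  have int: "integrable Tm (\<lambda>t. (norm (g t))\<^sup>2)"
    using g le by (intro integrableI_bounded) (auto simp: le_less_trans[OF _ ennreal_less_top])
  then show gL: "g \<in> L2" using g by (simp add: L2_def)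
  have "ennreal (LINT t|Tm. (norm (g t))\<^sup>2) \<le> ennreal (2 * pi * c\<^sup>2)"
    using le int by (subst (asm) nn_integral_eq_integral) auto
  then have "(LINT t|Tm. (norm (g t))\<^sup>2) / (2*pi) \<le> c\<^sup>2" by (simp add: field_simps)
  then show "norm (cls g) \<le> c" using c
    by (simp add: norm_cls[OF gL] L2norm_def real_le_lsqrt sqrt_le_D)
qed

text \<open>The increments have summable integrals, so the telescoping series converges absolutely
  almost everywhere; Fatou's lemma applied to the tails turns this into convergence in norm.\<close>

lemma L2_fast_Cauchy:
  fixes Y :: "nat \<Rightarrow> ('n::finite) lsq"
  assumes Y: "\<And>k. norm (Y (Suc k) - Y k) \<le> (1/2)^k"
  obtains f where "f \<in> L2" "AE t in Tm. (\<lambda>k. rep (Y k) t) \<longlonglongrightarrow> f t" "Y \<longlonglongrightarrow> cls f"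
proof -
  define g where "g k t = norm (rep (Y (Suc k)) t - rep (Y k) t)" for k t
  have gm: "g k \<in> borel_measurable Tm" for k unfolding g_def by measurable
  have nn: "(\<integral>\<^sup>+t. ennreal (g k t) \<partial>Tm) \<le> ennreal (2 * pi * (1/2)^k)" for k
  proof -
    let ?e = "(1/2)^k :: real"
    have L: "(\<lambda>t. rep (Y (Suc k)) t - rep (Y k) t) \<in> L2" by (intro L2_diff rep_L2)
    then have int: "integrable Tm (\<lambda>t. (g k t)\<^sup>2)" by (simp add: L2_def g_def)
    have "(LINT t|Tm. (g k t)\<^sup>2) / (2*pi) = (norm (Y (Suc k) - Y k))\<^sup>2"
      using norm_cls[OF L] cls_diff[OF rep_L2 rep_L2, of "Y (Suc k)" "Y k"] by (simp add: L2norm_def g_def)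
    also have "\<dots> \<le> ?e\<^sup>2" using Y by (intro power_mono) auto
    finally have e2: "(LINT t|Tm. (g k t)\<^sup>2) \<le> 2 * pi * ?e\<^sup>2" by (simp add: field_simps)
    \<comment> \<open>The arithmetic-geometric mean inequality, weighted so that both terms
      integrate to at most pi 2^-k, converts the square mean bound into a bound on the integral of
      \<open>g k\<close>.\<close>
    have ptw: "g k t \<le> ?e / 2 + (g k t)\<^sup>2 / (2 * ?e)" for t
    proof -
      have "0 \<le> (g k t - ?e)\<^sup>2" by simp
      then have "2 * ?e * g k t \<le> ?e\<^sup>2 + (g k t)\<^sup>2" by (simp add: power2_diff mult_ac)
      then show ?thesis by (simp add: field_simps power2_eq_square)
    qed
    have "(\<integral>\<^sup>+t. ennreal (g k t) \<partial>Tm) \<le> (\<integral>\<^sup>+t. ennreal (?e / 2 + (g k t)\<^sup>2 / (2 * ?e)) \<partial>Tm)"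
      by (intro nn_integral_mono ennreal_leI ptw)
    also have "\<dots> = ennreal (LINT t|Tm. (?e / 2 + (g k t)\<^sup>2 / (2 * ?e)))"
      using int by (intro nn_integral_eq_integral) auto
    also have "(LINT t|Tm. (?e / 2 + (g k t)\<^sup>2 / (2 * ?e))) = 2 * pi * ?e / 2 + (LINT t|Tm. (g k t)\<^sup>2) / (2 * ?e)"
      using int by simp
    also have "\<dots> \<le> 2 * pi * ?e / 2 + 2 * pi * ?e\<^sup>2 / (2 * ?e)"
      using e2 by (intro add_left_mono divide_right_mono) auto
    also have "\<dots> = 2 * pi * ?e" by (simp add: power2_eq_square)
    finally show ?thesis by (simp add: ennreal_leI)
  qed
  have "(\<integral>\<^sup>+t. (\<Sum>k. ennreal (g k t)) \<partial>Tm) = (\<Sum>k. \<integral>\<^sup>+t. ennreal (g k t) \<partial>Tm)"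
    using gm by (intro nn_integral_suminf) auto
  also have "\<dots> \<le> (\<Sum>k. ennreal (2 * pi * (1/2)^k))" by (intro suminf_le nn) auto
  also have "\<dots> < \<infinity>"
    using summable_mult[OF summable_geometric[of "1/2::real"], of "2*pi"]
    by (subst suminf_ennreal2) (auto simp: less_top)
  finally have "AE t in Tm. (\<Sum>k. ennreal (g k t)) \<noteq> \<infinity>"
    using gm by (intro nn_integral_noteq_infinite) auto
  then have conv: "AE t in Tm. convergent (\<lambda>k. rep (Y k) t)"
  proof eventually_elim
    case (elim t)
    then have "summable (\<lambda>k. g k t)" by (intro summable_suminf_not_top) (auto simp: g_def)
    then have "summable (\<lambda>k. rep (Y (Suc k)) t - rep (Y k) t)"
      unfolding g_def by (rule summable_norm_cancel)
    then have "convergent (\<lambda>n. \<Sum>k<n. rep (Y (Suc k)) t - rep (Y k) t)" by (simp add: summable_iff_convergent)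
    then have "convergent (\<lambda>n. rep (Y n) t - rep (Y 0) t)" unfolding sum_lessThan_telescope[of "\<lambda>k. rep (Y k) t"] .
    from convergent_add[OF this convergent_const[of "rep (Y 0) t"]] show ?case by simp
  qed
  define f where "f t = lim (\<lambda>k. rep (Y k) t)" for t
  have fm: "f \<in> borel_measurable Tm" unfolding f_def by (rule borel_measurable_lim_metric) measurable
  have lim: "AE t in Tm. (\<lambda>k. rep (Y k) t) \<longlonglongrightarrow> f t"
    using conv by eventually_elim (simp add: f_def convergent_LIMSEQ_iff)
  have tail: "norm (Y (k + m) - Y k) \<le> 2 * (1/2)^k" for k m
  proof -
    have "Y (k + m) - Y k = (\<Sum>i<m. Y (Suc (k + i)) - Y (k + i))"
      using sum_lessThan_telescope[of "\<lambda>i. Y (k + i)" m] by simp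
    then have "norm (Y (k + m) - Y k) \<le> (\<Sum>i<m. norm (Y (Suc (k + i)) - Y (k + i)))"
      by (simp add: norm_sum)
    also have "\<dots> \<le> (\<Sum>i<m. (1/2)^(k + i))" by (intro sum_mono Y)
    also have "\<dots> = (1/2)^k * (\<Sum>i<m. (1/2)^i)" by (simp add: power_add sum_distrib_left)
    also have "(\<Sum>i<m. (1/2::real)^i) \<le> (\<Sum>i. (1/2)^i)" by (intro sum_le_suminf) auto
    also have "(\<Sum>i. (1/2::real)^i) = 2" by (simp add: suminf_geometric)
    finally show ?thesis by (simp add: mult.commute)
  qed
  have FL: "(\<lambda>t. f t - rep (Y k) t) \<in> L2 \<and> norm (cls (\<lambda>t. f t - rep (Y k) t)) \<le> 2 * (1/2)^k" for k
  proof -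
    have "AE t in Tm. (\<lambda>m. rep (Y (k + m)) t - rep (Y k) t) \<longlonglongrightarrow> f t - rep (Y k) t"
      using lim
    proof eventually_elim
      case (elim t)
      from LIMSEQ_ignore_initial_segment[OF elim, of k]
      show ?case by (intro tendsto_intros) (simp add: add.commute)
    qed
    moreover have "(\<lambda>t. rep (Y (k + m)) t - rep (Y k) t) \<in> L2" for m by (intro L2_diff rep_L2)
    moreover have "norm (cls (\<lambda>t. rep (Y (k + m)) t - rep (Y k) t)) \<le> 2 * (1/2)^k" for m
      using tail[of k m] by (simp add: cls_diff)
    moreover have "(\<lambda>t. f t - rep (Y k) t) \<in> borel_measurable Tm" using fm by measurable
    ultimately show ?thesis
      using L2_Fatou[of "\<lambda>m t. rep (Y (k + m)) t - rep (Y k) t" "2 * (1/2)^k" "\<lambda>t. f t - rep (Y k) t"] by blast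
  qed
  have fL: "f \<in> L2" using L2_add[OF conjunct1[OF FL[of 0]] rep_L2[of "Y 0"]] by simp
  have le: "norm (Y k - cls f) \<le> 2 * (1/2)^k" for k
    using FL[of k] cls_diff[OF fL rep_L2, of "Y k"] by (simp add: norm_minus_commute)
  have pow: "(\<lambda>k. 2 * (1/2)^k :: real) \<longlonglongrightarrow> 0"
    using tendsto_mult_right_zero[OF LIMSEQ_realpow_zero[of "1/2::real"], of 2] by simp
  have "(\<lambda>k. norm (Y k - cls f)) \<longlonglongrightarrow> 0"
    by (rule tendsto_sandwich[OF _ _ tendsto_const pow]) (intro always_eventually allI norm_ge_zero le)+
  then have "Y \<longlonglongrightarrow> cls f" by (rule LIM_zero_cancel[OF tendsto_norm_zero_cancel])
  with fL lim that show thesis by blast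
qed

instance lsq :: (finite) complete_space
proof
  fix X :: "nat \<Rightarrow> 'a lsq" assume X: "Cauchy X"
  have "\<exists>N. \<forall>m\<ge>N. \<forall>n\<ge>N. norm (X m - X n) < (1/2)^k" for k
    using X by (intro CauchyD) auto
  then obtain N where N: "\<And>k m n. m \<ge> N k \<Longrightarrow> n \<ge> N k \<Longrightarrow> norm (X m - X n) < (1/2)^k" by metis
  \<comment> \<open>The summand k makes \<open>r\<close> strictly increasing, and the partial sums
    dominate every threshold up to k.\<close>
  define r where "r k = k + (\<Sum>i\<le>k. N i)" for k
  have rN: "r k \<ge> N k" "r (Suc k) \<ge> N k" for k
  proof -
    have "(\<Sum>i\<le>k. N i) \<ge> N k" by (rule member_le_sum) auto
    then show "r k \<ge> N k" "r (Suc k) \<ge> N k" by (auto simp: r_def)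
  qed
  have mono: "strict_mono r" by (rule strict_mono_Suc_iff[THEN iffD2]) (auto simp: r_def)
  have "norm ((X \<circ> r) (Suc k) - (X \<circ> r) k) \<le> (1/2)^k" for k
    using N[OF rN(2)[of k] rN(1)[of k]] by simp
  then obtain f where "(X \<circ> r) \<longlonglongrightarrow> cls f" using L2_fast_Cauchy[of "X \<circ> r"] by blast
  then have "X \<longlonglongrightarrow> cls f" using Cauchy_converges_subseq[OF X mono] by (simp add: o_def)
  then show "convergent X" by (auto simp: convergent_def)
qed

lemma lsq_limit_AE_subseq:
  fixes X :: "nat \<Rightarrow> ('n::finite) lsq"
  assumes X: "X \<longlonglongrightarrow> x"
  obtains r where "strict_mono (r::nat\<Rightarrow>nat)" "AE t in Tm. (\<lambda>k. rep (X (r k)) t) \<longlonglongrightarrow> rep x t"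
proof -
  \<comment> \<open>The factor 1/2 pays for comparing two consecutive terms through the limit
    x.\<close>
  have "\<exists>N. \<forall>m\<ge>N. norm (X m - x) < (1/2)^k / 2" for k
    using X by (intro LIMSEQ_D) auto
  then obtain N where N: "\<And>k m. m \<ge> N k \<Longrightarrow> norm (X m - x) < (1/2)^k / 2" by metis
  define r where "r k = k + (\<Sum>i\<le>k. N i)" for k
  have rN: "r k \<ge> N k" "r (Suc k) \<ge> N k" for k
  proof -
    have "(\<Sum>i\<le>k. N i) \<ge> N k" by (rule member_le_sum) auto
    then show "r k \<ge> N k" "r (Suc k) \<ge> N k" by (auto simp: r_def)
  qed
  have mono: "strict_mono r" by (rule strict_mono_Suc_iff[THEN iffD2]) (auto simp: r_def)
  have "norm ((X \<circ> r) (Suc k) - (X \<circ> r) k) \<le> (1/2)^k" for k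
    using N[OF rN(2)[of k]] N[OF rN(1)[of k]] norm_triangle_ineq4[of "X (r (Suc k)) - x" "X (r k) - x"] by simp
  then obtain f where f: "f \<in> L2" "AE t in Tm. (\<lambda>k. rep ((X \<circ> r) k) t) \<longlonglongrightarrow> f t" "(X \<circ> r) \<longlonglongrightarrow> cls f"
    using L2_fast_Cauchy[of "X \<circ> r"] by blast
  have "cls f = x" using f(3) LIMSEQ_subseq_LIMSEQ[OF X mono] LIMSEQ_unique by blast
  then have "AE t in Tm. rep x t = f t" using rep_cls[OF f(1)] by simp
  with f(2) have "AE t in Tm. (\<lambda>k. rep (X (r k)) t) \<longlonglongrightarrow> rep x t"
    by eventually_elim simp
  with mono that show thesis by blast
qed

section \<open>Multiplication operators, Fourier coefficients and the Riesz projections\<close>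

lemma norm_matrix_vector_le_mult:
  fixes A :: "complex^'n^'m"
  shows "norm A \<le> C \<Longrightarrow> norm (A *v x) \<le> C * norm x"
  by (rule order_trans[OF norm_matrix_vector_le mult_right_mono]) auto

lemma cis_measurable_minus [measurable]: "(\<lambda>t. cis (- (a * t))) \<in> borel_measurable Tm"
  using cis_measurable[of "- a"] by simp

lemma bounded_bilinear_matrix_vector:
  "bounded_bilinear (\<lambda>(A::complex^'n^'m) x. A *v x)"
proof
  show "(r *\<^sub>R A) *v x = r *\<^sub>R (A *v x)" for r and A :: "complex^'n^'m" and x
    by (rule scaleR_matrix_vector)
  show "A *v (r *\<^sub>R x) = r *\<^sub>R (A *v x)" for r and A :: "complex^'n^'m" and x
    by (rule linear_scale[OF matrix_vector_mul_linear])
  show "\<exists>K. \<forall>A x. norm ((A::complex^'n^'m) *v x) \<le> norm A * norm x * K"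
    using norm_matrix_vector_le by (intro exI[of _ 1]) auto
qed (auto simp: matrix_vector_mult_add_rdistrib matrix_vector_right_distrib)

lemma measurable_matrix_vector [measurable]:
  fixes A :: "real \<Rightarrow> complex^'n^'m"
  assumes "A \<in> borel_measurable M" "f \<in> borel_measurable M"
  shows "(\<lambda>t. A t *v f t) \<in> borel_measurable M"
  using borel_measurable_continuous_Pair[OF assms, of "(*v)"]
    bounded_bilinear.continuous_on[OF bounded_bilinear_matrix_vector continuous_on_fst[OF continuous_on_id] continuous_on_snd[OF continuous_on_id], of UNIV]
  by blast

section \<open>Essentially bounded matrix functions\<close>

lemma Linf_measurable: "A \<in> Linf \<Longrightarrow> A \<in> borel_measurable Tm"
  by (simp add: Linf_def)

lemma Linf_bound:
  assumes "A \<in> Linf" obtains C where "C \<ge> 0" "AE t in Tm. norm (A t) \<le> C"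
proof -
  obtain C where "AE t in Tm. norm (A t) \<le> C" using assms by (auto simp: Linf_def)
  then have "AE t in Tm. norm (A t) \<le> max C 0" by eventually_elim auto
  with that show thesis by (metis max.cobounded2)
qed

lemma LinfI:
  assumes "A \<in> borel_measurable Tm" "AE t in Tm. norm (A t) \<le> C" shows "A \<in> Linf"
  using assms by (auto simp: Linf_def)

lemma Linf_add: assumes "A \<in> Linf" "B \<in> Linf" shows "(\<lambda>t. A t + B t) \<in> Linf"
proof -
  obtain C D where "AE t in Tm. norm (A t) \<le> C" "AE t in Tm. norm (B t) \<le> D"
    using assms by (auto simp: Linf_def)
  then have "AE t in Tm. norm (A t + B t) \<le> C + D"
    by eventually_elim (metis add_mono norm_triangle_le)
  then show ?thesis using assms by (intro LinfI[of _ "C + D"]) (auto simp: Linf_def)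
qed

lemma Linf_const [simp]: "(\<lambda>t. C) \<in> Linf"
  by (auto simp: Linf_def intro!: exI[of _ "norm C"])

lemma Linf_scaleR: assumes "A \<in> Linf" shows "(\<lambda>t. r *\<^sub>R A t) \<in> Linf"
proof -
  obtain C where "AE t in Tm. norm (A t) \<le> C" using assms by (auto simp: Linf_def)
  then have "AE t in Tm. norm (r *\<^sub>R A t) \<le> \<bar>r\<bar> * C" by eventually_elim (auto intro: mult_left_mono)
  then show ?thesis using assms by (intro LinfI) (auto simp: Linf_def)
qed

lemma Linf_diff: assumes "A \<in> Linf" "B \<in> Linf" shows "(\<lambda>t. A t - B t) \<in> Linf"
  using Linf_add[OF assms(1) Linf_scaleR[OF assms(2), of "-1"]] by simp

lemma measurable_vec_lambda:
  fixes f :: "'i::finite \<Rightarrow> real \<Rightarrow> 'b::euclidean_space"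
  assumes "\<And>i. f i \<in> borel_measurable M" shows "(\<lambda>t. \<chi> i. f i t) \<in> borel_measurable M"
proof -
  have "(\<lambda>t. inner (\<chi> i. f i t) b) \<in> borel_measurable M" if "b \<in> Basis" for b
    unfolding inner_vec_def using assms by (auto intro!: borel_measurable_sum borel_measurable_inner)
  then show ?thesis using borel_measurable_euclidean_space by blast
qed

lemma measurable_vec_nth [measurable]:
  fixes f :: "real \<Rightarrow> 'b::euclidean_space^'i"
  assumes "f \<in> borel_measurable M" shows "(\<lambda>t. f t $ i) \<in> borel_measurable M"
  by (rule borel_measurable_continuous_on[OF _ assms, of "\<lambda>x. x $ i"]) (intro continuous_intros)

lemma norm_cadj: "norm (cadj A) = norm (A :: complex^'n^'m)"
proof -
  have "(norm (cadj A))\<^sup>2 = (norm A)\<^sup>2"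
    unfolding norm_vec_def L2_set_def cadj_def
    by (simp add: real_sqrt_pow2 sum_nonneg) (rule sum.swap)
  then show ?thesis by simp
qed

lemma Linf_cadj: assumes "A \<in> Linf" shows "(\<lambda>t. cadj (A t)) \<in> Linf"
proof -
  have [measurable]: "A \<in> borel_measurable Tm" using assms by (rule Linf_measurable)
  have "(\<lambda>t. cnj (A t $ j $ i)) \<in> borel_measurable Tm" for i j
    by (rule borel_measurable_continuous_on[OF continuous_on_cnj[OF continuous_on_id]]) measurable
  then have "(\<lambda>t. cadj (A t)) \<in> borel_measurable Tm"
    unfolding cadj_def by (intro measurable_vec_lambda)
  then show ?thesis using assms by (simp add: Linf_def norm_cadj)
qed

lemma measurable_matrix_mult:
  fixes A :: "real \<Rightarrow> complex^'n^'m" and B :: "real \<Rightarrow> complex^'k^'n"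
  assumes [measurable]: "A \<in> borel_measurable M" "B \<in> borel_measurable M"
  shows "(\<lambda>t. A t ** B t) \<in> borel_measurable M"
  unfolding matrix_matrix_mult_def by (intro measurable_vec_lambda borel_measurable_sum borel_measurable_times) measurable

lemma Linf_mult:
  fixes A :: "real \<Rightarrow> complex^'n^'m" and B :: "real \<Rightarrow> complex^'k^'n"
  assumes "A \<in> Linf" "B \<in> Linf"
  shows "(\<lambda>t. A t ** B t) \<in> Linf"
proof -
  obtain C where C: "C \<ge> 0" "AE t in Tm. norm (A t) \<le> C" using Linf_bound[OF assms(1)] .
  obtain D where D: "D \<ge> 0" "AE t in Tm. norm (B t) \<le> D" using Linf_bound[OF assms(2)] .
  have "AE t in Tm. norm (A t ** B t) \<le> CARD('m) * (CARD('k) * (C * D))"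
    using C(2) D(2)
  proof eventually_elim
    case (elim t)
    show ?case
    proof (rule norm_matrix_le_of_contractive)
      fix x
      have "norm ((A t ** B t) *v x) \<le> norm (A t) * norm (B t *v x)"
        unfolding matrix_vector_mul_assoc[symmetric] by (rule norm_matrix_vector_le)
      also have "\<dots> \<le> C * (D * norm x)"
        using elim C D by (intro mult_mono norm_matrix_vector_le_mult) auto
      finally show "norm ((A t ** B t) *v x) \<le> C * D * norm x" by (simp add: mult.assoc)
    qed
  qed
  moreover have "(\<lambda>t. A t ** B t) \<in> borel_measurable Tm"
    using assms by (intro measurable_matrix_mult Linf_measurable)
  ultimately show ?thesis by (rule LinfI[rotated])
qed

lemma Linf_scalar:
  assumes [measurable]: "\<phi> \<in> borel_measurable Tm" and b: "AE t in Tm. norm (\<phi> t) \<le> C"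
  shows "(\<lambda>t. mat (\<phi> t) :: complex^'n^'n) \<in> Linf"
proof (rule LinfI)
  show "(\<lambda>t. mat (\<phi> t) :: complex^'n^'n) \<in> borel_measurable Tm"
    unfolding mat_def by (intro measurable_vec_lambda) auto
  show "AE t in Tm. norm (mat (\<phi> t) :: complex^'n^'n) \<le> CARD('n) * (CARD('n) * C)"
    using b
  proof eventually_elim
    case (elim t)
    show ?case
    proof (rule norm_matrix_le_of_contractive)
      fix x :: "complex^'n"
      have "mat (\<phi> t) *v x = \<phi> t *s x"
        by (simp add: mat_def matrix_vector_mult_def vec_eq_iff if_distrib if_distribR cong: if_cong)
      then have "norm (mat (\<phi> t) *v x) = norm (\<phi> t) * norm x"
        by (simp add: norm_vec_def norm_mult L2_set_right_distrib)
      then show "norm (mat (\<phi> t) *v x) \<le> C * norm x" using elim by (simp add: mult_right_mono)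
    qed
  qed
qed

lemma mat_vector: "(mat c :: complex^'n^'n) *v x = c *s x"
  by (simp add: mat_def matrix_vector_mult_def vec_eq_iff if_distrib if_distribR cong: if_cong)

lemma norm_smult: "norm (c *s (x::complex^'n)) = norm c * norm x"
  by (simp add: norm_vec_def norm_mult L2_set_right_distrib)

section \<open>Multiplication operators\<close>

definition mult :: "(real \<Rightarrow> complex^'n^'n) \<Rightarrow> 'n lsq \<Rightarrow> 'n lsq" where
  "mult A x = cls (\<lambda>t. A t *v rep x t)"

lemma mult_L2:
  fixes A :: "real \<Rightarrow> complex^'n^'m"
  assumes A: "A \<in> Linf" and f: "f \<in> L2" shows "(\<lambda>t. A t *v f t) \<in> L2"
proof -
  obtain C where C: "AE t in Tm. norm (A t) \<le> C" using A by (auto simp: Linf_def)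
  then have C': "AE t in Tm. norm (A t *v f t) \<le> C * norm (f t)"
    by eventually_elim (rule norm_matrix_vector_le_mult)
  have m: "(\<lambda>t. A t *v f t) \<in> borel_measurable Tm"
    using Linf_measurable[OF A] L2_measurable[OF f] by (rule measurable_matrix_vector)
  show ?thesis by (rule L2_bound[OF m f C'])
qed

lemma rep_mult: "A \<in> Linf \<Longrightarrow> AE t in Tm. rep (mult A x) t = A t *v rep x t"
  unfolding mult_def by (intro rep_cls mult_L2 rep_L2)

lemma mult_cls:
  assumes "A \<in> Linf" "f \<in> L2" shows "mult A (cls f) = cls (\<lambda>t. A t *v f t)"
  unfolding mult_def using rep_cls[OF assms(2)]
  by (subst cls_eq_iff) (auto intro!: mult_L2 assms)

lemma mult_add: assumes "A \<in> Linf" shows "mult A (x + y) = mult A x + mult A y"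
proof -
  have "AE t in Tm. rep (mult A (x + y)) t = rep (mult A x + mult A y) t"
    using rep_mult[OF assms, of "x + y"] rep_mult[OF assms, of x] rep_mult[OF assms, of y] rep_add[of x y]
      rep_add[of "mult A x" "mult A y"]
    by eventually_elim (simp add: matrix_vector_right_distrib)
  then show ?thesis by (simp add: lsq_eq_iff)
qed

lemma mult_scaleR: assumes "A \<in> Linf" shows "mult A (r *\<^sub>R x) = r *\<^sub>R mult A x"
proof -
  have "AE t in Tm. rep (mult A (r *\<^sub>R x)) t = rep (r *\<^sub>R mult A x) t"
    using rep_mult[OF assms, of "r *\<^sub>R x"] rep_mult[OF assms, of x] rep_scaleR[of r x]
      rep_scaleR[of r "mult A x"]
    by eventually_elim (simp add: linear_scale[OF matrix_vector_mul_linear])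
  then show ?thesis by (simp add: lsq_eq_iff)
qed

lemma norm_mono_AE:
  assumes "AE t in Tm. norm (rep x t) \<le> C * norm (rep y t)" "C \<ge> 0"
  shows "norm x \<le> C * norm y"
proof -
  have "(LINT t|Tm. (norm (rep x t))\<^sup>2) \<le> (LINT t|Tm. C\<^sup>2 * (norm (rep y t))\<^sup>2)"
  proof (rule integral_mono_AE)
    show "integrable Tm (\<lambda>t. (norm (rep x t))\<^sup>2)" "integrable Tm (\<lambda>t. C\<^sup>2 * (norm (rep y t))\<^sup>2)"
      using rep_L2[of x] rep_L2[of y] by (auto simp: L2_def)
    show "AE t in Tm. (norm (rep x t))\<^sup>2 \<le> C\<^sup>2 * (norm (rep y t))\<^sup>2"
      using assms(1)
    proof eventually_elim
      case (elim t)
      then have "(norm (rep x t))\<^sup>2 \<le> (C * norm (rep y t))\<^sup>2" by (intro power_mono) auto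
      then show ?case by (simp add: power_mult_distrib)
    qed
  qed
  then have "(norm x)\<^sup>2 \<le> (C * norm y)\<^sup>2"
    unfolding norm_sq_rep power_mult_distrib by (simp add: divide_right_mono)
  then show ?thesis by (rule power2_le_imp_le) (use assms in simp)
qed

lemma norm_eq_AE:
  assumes "AE t in Tm. norm (rep x t) = norm (rep y t)" shows "norm x = norm y"
proof (rule antisym)
  have "AE t in Tm. norm (rep x t) \<le> 1 * norm (rep y t)" "AE t in Tm. norm (rep y t) \<le> 1 * norm (rep x t)"
    using assms by (eventually_elim, simp)+
  from norm_mono_AE[OF this(1)] norm_mono_AE[OF this(2)] show "norm x \<le> norm y" "norm y \<le> norm x" by auto
qed

lemma bounded_linear_mult: assumes A: "A \<in> Linf" shows "bounded_linear (mult A)"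
proof -
  obtain C where C: "C \<ge> 0" "AE t in Tm. norm (A t) \<le> C" using Linf_bound[OF A] .
  have "norm (mult A x) \<le> C * norm x" for x
  proof (rule norm_mono_AE)
    show "AE t in Tm. norm (rep (mult A x) t) \<le> C * norm (rep x t)"
      using C(2) rep_mult[OF A, of x]
      by eventually_elim (simp add: norm_matrix_vector_le_mult)
  qed (rule C)
  then show ?thesis
    by (intro bounded_linear_intro[of _ C]) (auto simp: mult_add mult_scaleR A mult.commute)
qed

lemma norm_mult_contractive:
  assumes "A \<in> Linf" "AE t in Tm. \<forall>v. norm (A t *v v) \<le> norm v" shows "norm (mult A x) \<le> norm x"
proof -
  have "AE t in Tm. norm (rep (mult A x) t) \<le> 1 * norm (rep x t)"
    using assms(2) rep_mult[OF assms(1), of x] by eventually_elim simp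
  from norm_mono_AE[OF this] show ?thesis by simp
qed

lemma mult_mult: assumes "A \<in> Linf" "B \<in> Linf" shows "mult A (mult B x) = mult (\<lambda>t. A t ** B t) x"
proof -
  have "AE t in Tm. rep (mult A (mult B x)) t = rep (mult (\<lambda>t. A t ** B t) x) t"
    using rep_mult[OF assms(1), of "mult B x"] rep_mult[OF assms(2), of x] rep_mult[OF Linf_mult[OF assms], of x]
    by eventually_elim (simp add: matrix_vector_mul_assoc)
  then show ?thesis by (simp add: lsq_eq_iff)
qed

lemma mult_add_left: assumes "A \<in> Linf" "B \<in> Linf" shows "mult (\<lambda>t. A t + B t) x = mult A x + mult B x"
proof -
  have "AE t in Tm. rep (mult (\<lambda>t. A t + B t) x) t = rep (mult A x + mult B x) t"
    using rep_mult[OF Linf_add[OF assms], of x] rep_mult[OF assms(1), of x] rep_mult[OF assms(2), of x]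
      rep_add[of "mult A x" "mult B x"]
    by eventually_elim (simp add: matrix_vector_mult_add_rdistrib)
  then show ?thesis by (simp add: lsq_eq_iff)
qed

lemma mult_diff_left: assumes "A \<in> Linf" "B \<in> Linf" shows "mult (\<lambda>t. A t - B t) x = mult A x - mult B x"
proof -
  have "mult A x = mult (\<lambda>t. (A t - B t) + B t) x" by simp
  then show ?thesis using mult_add_left[OF Linf_diff[OF assms] assms(2), of x] by simp
qed

lemma mult_one: "mult (\<lambda>t. mat 1) x = x"
  unfolding mult_def by (simp add: mat_vector)

lemma inner_cadj: "inner ((A::complex^'n^'n) *v x) y = inner x (cadj A *v y)"
proof -
  have "inner (a * b) c = inner b (cnj a * c)" for a b c :: complex
    by (simp add: inner_complex_def algebra_simps)
  then show ?thesis
    unfolding inner_vec_def matrix_vector_mult_def cadj_def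
    by (simp add: inner_sum_left inner_sum_right) (rule sum.swap)
qed

lemma inner_mult: assumes "A \<in> Linf" shows "inner (mult A x) y = inner x (mult (\<lambda>t. cadj (A t)) y)"
proof -
  have "(LINT t|Tm. inner (rep (mult A x) t) (rep y t)) = (LINT t|Tm. inner (rep x t) (rep (mult (\<lambda>t. cadj (A t)) y) t))"
  proof (rule integral_cong_AE)
    show "AE t in Tm. inner (rep (mult A x) t) (rep y t) = inner (rep x t) (rep (mult (\<lambda>t. cadj (A t)) y) t)"
      using rep_mult[OF assms, of x] rep_mult[OF Linf_cadj[OF assms], of y]
      by eventually_elim (simp add: inner_cadj)
  qed measurable
  then show ?thesis by (simp add: inner_rep)
qed

section \<open>Powers of z, shifts and multiplication by i\<close>

definition zpow :: "int \<Rightarrow> real \<Rightarrow> complex^'n^'n" where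
  "zpow j t = mat (cis (of_int j * t))"

definition sh :: "int \<Rightarrow> ('n::finite) lsq \<Rightarrow> 'n lsq" where "sh j = mult (zpow j)"
definition im :: "('n::finite) lsq \<Rightarrow> 'n lsq" where "im = mult (\<lambda>t. mat \<i>)"

lemma Linf_zpow [simp]: "zpow j \<in> Linf"
  unfolding zpow_def by (intro Linf_scalar[where C=1]) auto

lemma zpow_vector: "zpow j t *v x = cis (of_int j * t) *s x"
  by (simp add: zpow_def mat_vector)

lemma rep_sh: "AE t in Tm. rep (sh j x) t = cis (of_int j * t) *s rep x t"
  using rep_mult[OF Linf_zpow, of j x] by (simp add: sh_def zpow_vector)

lemma rep_im: "AE t in Tm. rep (im x) t = \<i> *s rep x t"
  using rep_mult[OF Linf_const, of "mat \<i>" x] by (simp add: im_def mat_vector)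

lemma bounded_linear_sh: "bounded_linear (sh j)"
  unfolding sh_def by (rule bounded_linear_mult) simp
lemma bounded_linear_im: "bounded_linear im"
  unfolding im_def by (rule bounded_linear_mult) simp

lemmas sh_add = bl_add[OF bounded_linear_sh]
lemmas sh_scaleR = bl_scaleR[OF bounded_linear_sh]
lemmas sh_zero = bl_zero[OF bounded_linear_sh]
lemmas im_diff = bl_diff[OF bounded_linear_im]
lemmas im_zero = bl_zero[OF bounded_linear_im]
lemma sh_sh: "sh j (sh k x) = sh (j + k) x"
proof -
  have "AE t in Tm. rep (sh j (sh k x)) t = rep (sh (j + k) x) t"
    using rep_sh[of j "sh k x"] rep_sh[of k x] rep_sh[of "j + k" x]
    by eventually_elim (simp add: vector_smult_assoc cis_mult algebra_simps)
  then show ?thesis by (simp add: lsq_eq_iff)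
qed

lemma sh_0 [simp]: "sh 0 x = x"
  using mult_one[of x] by (simp add: sh_def zpow_def[abs_def])

lemma norm_sh [simp]: "norm (sh j x) = norm x"
  by (rule norm_eq_AE) (use rep_sh[of j x] in \<open>eventually_elim, simp add: norm_smult\<close>)

lemma norm_im [simp]: "norm (im x) = norm x"
  by (rule norm_eq_AE) (use rep_im[of x] in \<open>eventually_elim, simp add: norm_smult\<close>)

lemma cadj_mat: "cadj (mat c :: complex^'n^'n) = mat (cnj c)"
  by (auto simp: cadj_def mat_def vec_eq_iff)

lemma inner_sh: "inner (sh j x) y = inner x (sh (- j) y)"
  by (simp add: sh_def inner_mult zpow_def[abs_def] cadj_mat cis_cnj Linf_zpow[unfolded zpow_def[abs_def]])

lemma mult_sh: assumes "A \<in> Linf" shows "mult A (sh j x) = sh j (mult A x)"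
proof -
  have "AE t in Tm. rep (mult A (sh j x)) t = rep (sh j (mult A x)) t"
    using rep_mult[OF assms, of "sh j x"] rep_mult[OF assms, of x] rep_sh[of j x] rep_sh[of j "mult A x"]
    by eventually_elim (simp add: vec.scale)
  then show ?thesis by (simp add: lsq_eq_iff)
qed

lemma mult_im: assumes "A \<in> Linf" shows "mult A (im x) = im (mult A x)"
proof -
  have "AE t in Tm. rep (mult A (im x)) t = rep (im (mult A x)) t"
    using rep_mult[OF assms, of "im x"] rep_mult[OF assms, of x] rep_im[of x] rep_im[of "mult A x"]
    by eventually_elim (simp add: vec.scale)
  then show ?thesis by (simp add: lsq_eq_iff)
qed

lemma sh_im: "sh j (im x) = im (sh j x)"
  unfolding sh_def by (rule mult_im) simp

lemma mult_zpow: assumes "A \<in> Linf" shows "mult (\<lambda>t. zpow j t ** A t) x = sh j (mult A x)"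
  unfolding sh_def by (simp add: mult_mult assms)

subsection \<open>Fourier coefficients\<close>

definition coef :: "int \<Rightarrow> ('n::finite) lsq \<Rightarrow> complex^'n" where "coef j x = fcoef (rep x) j"

definition mon :: "int \<Rightarrow> complex^'n \<Rightarrow> 'n lsq" where
  "mon j v = cls (\<lambda>t. cis (of_int j * t) *s v)"

lemma L2_mon: "(\<lambda>t. cis (of_int j * t) *s v) \<in> L2"
proof -
  have m: "(\<lambda>t. cis (of_int j * t) *s v) \<in> borel_measurable Tm"
    unfolding zpow_vector[symmetric]
    by (intro measurable_matrix_vector Linf_measurable Linf_zpow) auto
  moreover have "integrable Tm (\<lambda>t. (norm (cis (of_int j * t) *s v))\<^sup>2)" by (simp add: norm_smult)
  ultimately show ?thesis by (simp add: L2_def)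
qed

lemma rep_mon: "AE t in Tm. rep (mon j v) t = cis (of_int j * t) *s v"
  unfolding mon_def by (rule rep_cls[OF L2_mon])

lemma L2_component_integrable: assumes "f \<in> L2" shows "integrable Tm (\<lambda>t. f t $ k)"
proof (rule Bochner_Integration.integrable_bound[of _ "\<lambda>t. 1 + (norm (f t))\<^sup>2"])
  show "integrable Tm (\<lambda>t. 1 + (norm (f t))\<^sup>2)" using assms by (auto simp: L2_def)
  show "(\<lambda>t. f t $ k) \<in> borel_measurable Tm" using L2_measurable[OF assms] by measurable
  show "AE t in Tm. norm (f t $ k) \<le> norm (1 + (norm (f t))\<^sup>2)"
  proof (rule AE_I2)
    fix t
    have "norm (f t $ k) \<le> norm (f t)" by (rule Finite_Cartesian_Product.norm_nth_le)
    also have "\<dots> \<le> 1 + (norm (f t))\<^sup>2"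
      using zero_le_power2[of "norm (f t) - 1/2"] by (simp add: power2_diff field_simps power2_eq_square)
    finally show "norm (f t $ k) \<le> norm (1 + (norm (f t))\<^sup>2)" by simp
  qed
qed

lemma fcoef_cong_AE:
  assumes "f \<in> L2" "g \<in> L2" "AE t in Tm. f t = g t" shows "fcoef f j = fcoef g j"
proof -
  have "(LINT t|Tm. f t $ k * cis (- of_int j * t)) = (LINT t|Tm. g t $ k * cis (- of_int j * t))" for k
  proof (rule integral_cong_AE)
    show "(\<lambda>t. f t $ k * cis (- of_int j * t)) \<in> borel_measurable Tm" "(\<lambda>t. g t $ k * cis (- of_int j * t)) \<in> borel_measurable Tm"
      using L2_measurable[OF assms(1)] L2_measurable[OF assms(2)]
      by (auto intro!: borel_measurable_times measurable_vec_nth)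
  qed (use assms(3) in auto)
  then show ?thesis by (simp add: fcoef_def)
qed

lemma coef_cls: "f \<in> L2 \<Longrightarrow> coef j (cls f) = fcoef f j"
  unfolding coef_def by (intro fcoef_cong_AE rep_cls rep_L2)

text \<open>Coefficients are characterised by duality with monomials, so later coefficient
  identities reduce to moving operators across the inner product.\<close>

lemma inner_mon: "inner x (mon j v) = inner (coef j x) v"
proof -
  have int: "integrable Tm (\<lambda>t. rep x t $ k * cis (- of_int j * t))" for k
    by (intro integrable_mult_cis L2_component_integrable rep_L2)
  have "inner x (mon j v) = (LINT t|Tm. inner (rep x t) (cis (of_int j * t) *s v)) / (2*pi)"
    unfolding mon_def using inner_cls[OF rep_L2 L2_mon, of x j v] by simp
  also have "(LINT t|Tm. inner (rep x t) (cis (of_int j * t) *s v))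
      = (LINT t|Tm. (\<Sum>k\<in>UNIV. inner (rep x t $ k * cis (- of_int j * t)) (v $ k)))"
    by (intro Bochner_Integration.integral_cong sum.cong) (auto simp: inner_vec_def inner_complex_def algebra_simps intro!: sum.cong)
  also have "\<dots> = (\<Sum>k\<in>UNIV. inner (LINT t|Tm. rep x t $ k * cis (- of_int j * t)) (v $ k))"
    using int by (subst Bochner_Integration.integral_sum) (auto simp del: mult_minus_left)
  also have "\<dots> / (2*pi) = inner (coef j x) v"
    by (simp add: coef_def fcoef_def inner_vec_def sum_divide_distrib inner_complex_def add_divide_distrib)
  finally show ?thesis .
qed

lemma coef_eqI: "(\<And>v. inner x (mon j v) = inner w v) \<Longrightarrow> coef j x = w"
  using vector_eq_rdot[of "coef j x" w] by (simp add: inner_mon)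

lemma norm_mon [simp]: "norm (mon j v) = norm v"
proof -
  have "norm (mon j v) = L2norm (\<lambda>t. cis (of_int j * t) *s v)" unfolding mon_def by (rule norm_cls[OF L2_mon])
  also have "\<dots> = norm v" by (simp add: L2norm_def norm_smult)
  finally show ?thesis .
qed

lemma norm_coef_le: "norm (coef j x) \<le> norm x"
proof -
  have "(norm (coef j x))\<^sup>2 = inner x (mon j (coef j x))" by (simp add: inner_mon power2_norm_eq_inner)
  also have "\<dots> \<le> norm x * norm (coef j x)" using norm_cauchy_schwarz[of x "mon j (coef j x)"] by simp
  finally show ?thesis by (cases "coef j x = 0") (simp_all add: power2_eq_square)
qed

lemma bounded_linear_coef: "bounded_linear (coef j)"
  by (rule bounded_linear_intro[of _ 1])
    (auto intro!: coef_eqI norm_coef_le simp: inner_add_left inner_mon[symmetric])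

lemmas coef_add = bl_add[OF bounded_linear_coef]
lemmas coef_diff = bl_diff[OF bounded_linear_coef]
lemmas coef_scaleR = bl_scaleR[OF bounded_linear_coef]
lemmas coef_zero = bl_zero[OF bounded_linear_coef]
lemmas coef_tendsto = bounded_linear.tendsto[OF bounded_linear_coef]

lemma sh_mon: "sh i (mon j v) = mon (i + j) v"
proof -
  have "AE t in Tm. rep (sh i (mon j v)) t = rep (mon (i + j) v) t"
    using rep_sh[of i "mon j v"] rep_mon[of j v] rep_mon[of "i + j" v]
    by eventually_elim (simp add: vector_smult_assoc cis_mult algebra_simps)
  then show ?thesis by (simp add: lsq_eq_iff)
qed

lemma im_mon: "im (mon j v) = mon j (\<i> *s v)"
proof -
  have "AE t in Tm. rep (im (mon j v)) t = rep (mon j (\<i> *s v)) t"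
    using rep_im[of "mon j v"] rep_mon[of j v] rep_mon[of j "\<i> *s v"]
    by eventually_elim (simp add: vector_smult_assoc mult.commute)
  then show ?thesis by (simp add: lsq_eq_iff)
qed

lemma coef_sh [simp]: "coef i (sh j x) = coef (i - j) x"
  by (rule coef_eqI) (simp add: inner_sh sh_mon inner_mon[symmetric] algebra_simps)

lemma inner_im: "inner (im x) y = - inner x (im y)"
proof -
  have "mult (\<lambda>t. mat (cnj \<i>)) y = - im y"
  proof -
    have "AE t in Tm. rep (mult (\<lambda>t. mat (cnj \<i>)) y) t = rep ((-1) *\<^sub>R im y) t"
      using rep_mult[OF Linf_const, of "mat (cnj \<i>)" y] rep_im[of y] rep_scaleR[of "-1" "im y"]
      by eventually_elim (simp add: mat_vector vec_eq_iff)
    then show ?thesis by (simp add: lsq_eq_iff)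
  qed
  then show ?thesis by (simp add: im_def inner_mult cadj_mat)
qed

lemma coef_im [simp]: "coef j (im x) = \<i> *s coef j x"
  by (rule coef_eqI) (simp add: inner_im im_mon inner_mon[symmetric] inner_ii_left)

lemma lsq_eq_0I: assumes "\<And>j. coef j x = 0" shows "x = 0"
proof -
  have "AE t in Tm. rep x t $ k = 0" for k
  proof (rule fourier_uniqueness)
    have "(LINT t|Tm. rep x t $ k * cis (- of_int j * t)) = 0" for j :: int
      using assms[of j] by (auto simp: coef_def fcoef_def vec_eq_iff)
    then show "fourier_null (\<lambda>t. rep x t $ k)"
      by (auto simp: fourier_null_def intro!: L2_component_integrable)
  qed
  then have "AE t in Tm. \<forall>k. rep x t $ k = 0" by (simp add: AE_all_countable)
  then have "AE t in Tm. rep x t = rep 0 t" using rep_zero by eventually_elim (simp add: vec_eq_iff)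
  then show ?thesis by (simp add: lsq_eq_iff)
qed

lemma lsq_eqI: assumes "\<And>j. coef j x = coef j y" shows "x = y"
  using lsq_eq_0I[of "x - y"] assms by (simp add: coef_diff)

lemma integral_cis_Tm: "(LINT t|Tm. cis (of_int k * t)) = (if k = 0 then 2*pi else 0)"
proof (cases "k = 0")
  case False
  have "((\<lambda>t. cis (of_int k * t)) has_integral (cis (of_int k * (2*pi)) / (\<i> * of_int k) - cis (of_int k * 0) / (\<i> * of_int k))) {0..2*pi}"
  proof (rule fundamental_theorem_of_calculus)
    fix t :: real
    show "((\<lambda>t. cis (of_int k * t) / (\<i> * of_int k)) has_vector_derivative cis (of_int k * t)) (at t within {0..2*pi})"
      using False unfolding cis_conv_exp
      by (auto intro!: derivative_eq_intros has_vector_derivative_real_field simp: field_simps)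
  qed simp
  moreover have "cis (of_int k * (2*pi)) = 1" using cis_multiple_2pi[of "of_int k"] by (simp add: mult_ac)
  ultimately have "integral {0..2*pi} (\<lambda>t. cis (of_int k * t)) = 0" by (simp add: integral_unique)
  moreover have "integrable Tm (\<lambda>t. cis (of_int k * t))"
    using integrable_mult_cis[of "\<lambda>t. 1" "of_int k"] by simp
  then have "(LINT t|Tm. cis (of_int k * t)) = integral {0..2*pi} (\<lambda>t. cis (of_int k * t))"
    unfolding Tm_def by (intro lebesgue_integral_eq_integral) auto
  ultimately show ?thesis using False by simp
qed (simp add: scaleR_conv_of_real)

lemma coef_mon: "coef i (mon j v) = (if i = j then v else 0)"
proof -
  have "fcoef (\<lambda>t. cis (of_int j * t) *s v) i = (if i = j then v else 0)"
  proof -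
    have "(LINT t|Tm. (cis (of_int j * t) *s v) $ k * cis (- of_int i * t)) = (if i = j then 2*pi else 0) * v $ k" for k
    proof -
      have "(LINT t|Tm. (cis (of_int j * t) *s v) $ k * cis (- of_int i * t)) = (LINT t|Tm. cis (of_int (j - i) * t) * v $ k)"
        by (intro Bochner_Integration.integral_cong) (auto simp: cis_mult algebra_simps)
      also have "\<dots> = (LINT t|Tm. cis (of_int (j - i) * t)) * v $ k" by (rule integral_mult_left_zero)
      finally show ?thesis using integral_cis_Tm[of "j - i"] by auto
    qed
    then show ?thesis by (simp add: fcoef_def vec_eq_iff)
  qed
  then show ?thesis unfolding mon_def coef_cls[OF L2_mon] .
qed

text \<open>The block Laurent structure: the entry depends on i - j only. It translates conditions
  on the coefficients of a symbol into conditions on its multiplication operator.\<close>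

lemma mcoef_mult: assumes "A \<in> Linf" shows "coef i (mult A (mon j v)) = mcoef A (i - j) *v v"
proof -
  have "mult A (mon j v) = cls (\<lambda>t. A t *v (cis (of_int j * t) *s v))"
    unfolding mon_def by (rule mult_cls[OF assms L2_mon])
  then have "coef i (mult A (mon j v)) = fcoef (\<lambda>t. A t *v (cis (of_int j * t) *s v)) i"
    using coef_cls[OF mult_L2[OF assms L2_mon]] by simp
  also have "\<dots> = mcoef A (i - j) *v v"
  proof -
    have [measurable]: "A \<in> borel_measurable Tm" by (rule Linf_measurable[OF assms])
    obtain C where C: "C \<ge> 0" "AE t in Tm. norm (A t) \<le> C" using Linf_bound[OF assms] .
    have int: "integrable Tm (\<lambda>t. A t $ a $ b)" for a b
    proof (rule Bochner_Integration.integrable_bound[of _ "\<lambda>t. C"])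
      show "AE t in Tm. norm (A t $ a $ b) \<le> norm C"
        using C(2) by eventually_elim (use C(1) in \<open>metis Finite_Cartesian_Product.norm_nth_le abs_of_nonneg order_trans real_norm_def\<close>)
      show "(\<lambda>t. A t $ a $ b) \<in> borel_measurable Tm" by measurable
    qed simp
    have int': "integrable Tm (\<lambda>t. A t $ a $ b * cis (- of_int k * t) * v $ b)" for a b and k :: int
      using integrable_mult_cis[OF int[of a b], of "- of_int k"] by (simp del: mult_minus_left)
    have "(LINT t|Tm. (A t *v (cis (of_int j * t) *s v)) $ a * cis (- of_int i * t))
        = (\<Sum>b\<in>UNIV. (LINT t|Tm. A t $ a $ b * cis (- of_int (i - j) * t)) * v $ b)" for a
    proof -
      have "(LINT t|Tm. (A t *v (cis (of_int j * t) *s v)) $ a * cis (- of_int i * t))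
        = (LINT t|Tm. (\<Sum>b\<in>UNIV. A t $ a $ b * cis (- of_int (i - j) * t) * v $ b))"
      proof (intro Bochner_Integration.integral_cong refl)
        fix t
        have eq: "cis (- of_int (i - j) * t) = cis (of_int j * t) * cis (- of_int i * t)"
          by (simp add: cis_mult algebra_simps)
        show "(A t *v (cis (of_int j * t) *s v)) $ a * cis (- of_int i * t) =
          (\<Sum>b\<in>UNIV. A t $ a $ b * cis (- of_int (i - j) * t) * v $ b)"
          unfolding eq matrix_vector_mult_def by (simp add: sum_distrib_left mult_ac)
      qed
      also have "\<dots> = (\<Sum>b\<in>UNIV. (LINT t|Tm. A t $ a $ b * cis (- of_int (i - j) * t) * v $ b))"
        using int' by (intro Bochner_Integration.integral_sum) blast
      also have "\<dots> = (\<Sum>b\<in>UNIV. (LINT t|Tm. A t $ a $ b * cis (- of_int (i - j) * t)) * v $ b)"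
        by (intro sum.cong refl integral_mult_left_zero)
      finally show ?thesis .
    qed
    then show ?thesis by (simp add: fcoef_def mcoef_def vec_eq_iff matrix_vector_mult_def sum_divide_distrib)
  qed
  finally show ?thesis .
qed

section \<open>Hardy spaces and the Riesz projections\<close>

definition H2s :: "('n::finite) lsq set" where "H2s = {x. \<forall>j<0. coef j x = 0}"
definition H2ms :: "('n::finite) lsq set" where "H2ms = {x. \<forall>j\<ge>0. coef j x = 0}"

lemma subspace_coef_vanish: "subspace {x. \<forall>j\<in>S. coef j x = 0}"
  by (auto simp: subspace_def coef_add coef_scaleR coef_zero)

lemma closed_coef_vanish: "closed {x :: ('n::finite) lsq. \<forall>j\<in>S. coef j x = 0}"
proof -
  have "closed {x :: 'n lsq. coef j x = 0}" for j
    by (intro closed_Collect_eq bounded_linear.continuous_on[OF bounded_linear_coef] continuous_intros)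
  then have "closed (\<Inter>j\<in>S. {x :: 'n lsq. coef j x = 0})" by blast
  moreover have "{x :: 'n lsq. \<forall>j\<in>S. coef j x = 0} = (\<Inter>j\<in>S. {x. coef j x = 0})" by auto
  ultimately show ?thesis by simp
qed

lemma H2s_alt: "H2s = {x. \<forall>j\<in>{..<0}. coef j x = 0}" by (auto simp: H2s_def)
lemma H2ms_alt: "H2ms = {x. \<forall>j\<in>{0..}. coef j x = 0}" by (auto simp: H2ms_def)

lemma subspace_H2s: "subspace H2s" and closed_H2s: "closed H2s"
  unfolding H2s_alt by (rule subspace_coef_vanish, rule closed_coef_vanish)
lemma subspace_H2ms: "subspace H2ms" and closed_H2ms: "closed H2ms"
  unfolding H2ms_alt by (rule subspace_coef_vanish, rule closed_coef_vanish)

lemma im_H2s: "x \<in> H2s \<Longrightarrow> im x \<in> H2s" by (simp add: H2s_def)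
lemma im_H2ms: "x \<in> H2ms \<Longrightarrow> im x \<in> H2ms" by (simp add: H2ms_def)
lemma sh_H2s: "x \<in> H2s \<Longrightarrow> j \<ge> 0 \<Longrightarrow> sh j x \<in> H2s" by (simp add: H2s_def)
lemma sh_H2ms: "x \<in> H2ms \<Longrightarrow> j \<le> 0 \<Longrightarrow> sh j x \<in> H2ms" by (simp add: H2ms_def)
lemma mon_H2s: "j \<ge> 0 \<Longrightarrow> mon j v \<in> H2s" by (simp add: H2s_def coef_mon)
lemma mon_H2ms: "j < 0 \<Longrightarrow> mon j v \<in> H2ms" by (simp add: H2ms_def coef_mon)

text \<open>The orthogonal projection onto the closed subspace \<open>H2ms\<close> does it: the
  remainder is orthogonal to every monomial of negative index. No Fourier series is summed.\<close>

lemma Pm_exists: "\<exists>p. \<forall>j. coef j p = (if j < 0 then coef j x else 0)"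
proof -
  obtain p where p: "p \<in> H2ms" "\<And>m. m \<in> H2ms \<Longrightarrow> inner (x - p) m = 0"
    using hilbert_projection[OF subspace_H2ms closed_H2ms] by blast
  have "coef j (x - p) = 0" if "j < 0" for j
    by (rule coef_eqI) (simp add: p(2)[OF mon_H2ms[OF that]])
  then show ?thesis using p(1) by (auto simp: H2ms_def coef_diff intro!: exI[of _ p])
qed

definition Pm :: "('n::finite) lsq \<Rightarrow> 'n lsq" where
  "Pm x = (SOME p. \<forall>j. coef j p = (if j < 0 then coef j x else 0))"
definition Pp :: "('n::finite) lsq \<Rightarrow> 'n lsq" where "Pp x = x - Pm x"

lemma coef_Pm: "coef j (Pm x) = (if j < 0 then coef j x else 0)"
  using someI_ex[OF Pm_exists[of x]] unfolding Pm_def by blast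

lemma coef_Pp: "coef j (Pp x) = (if j < 0 then 0 else coef j x)"
  by (simp add: Pp_def coef_diff coef_Pm)

lemma Pm_H2ms [simp]: "Pm x \<in> H2ms" by (simp add: H2ms_def coef_Pm)
lemma Pp_H2s [simp]: "Pp x \<in> H2s" by (simp add: H2s_def coef_Pp)

lemma Pm_eqI: "p \<in> H2ms \<Longrightarrow> (\<And>j. j < 0 \<Longrightarrow> coef j p = coef j x) \<Longrightarrow> Pm x = p"
  by (rule lsq_eqI) (auto simp: coef_Pm H2ms_def)

lemma Pp_id: "x \<in> H2s \<Longrightarrow> Pp x = x" by (rule lsq_eqI) (auto simp: coef_Pp H2s_def)
lemma Pm_eq_0: "x \<in> H2s \<Longrightarrow> Pm x = 0" using Pp_id[of x] by (simp add: Pp_def)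

text \<open>The projection of x onto \<open>H2ms\<close> shares its negative coefficients with x,
  which are zero, and has no others. By uniqueness it vanishes, so x equals its component orthogonal
  to \<open>H2ms\<close>.\<close>

lemma H2s_orthogonal_H2ms:
  assumes "x \<in> H2s" "y \<in> H2ms" shows "inner x y = 0"
proof -
  obtain p where p: "p \<in> H2ms" "\<And>m. m \<in> H2ms \<Longrightarrow> inner (x - p) m = 0"
    using hilbert_projection[OF subspace_H2ms closed_H2ms] by blast
  have "coef j (x - p) = 0" if "j < 0" for j
    by (rule coef_eqI) (simp add: p(2)[OF mon_H2ms[OF that]])
  then have "p = 0" using p(1) assms(1) by (intro lsq_eq_0I) (auto simp: H2ms_def H2s_def coef_diff not_less[symmetric])
  then show ?thesis using p(2)[OF assms(2)] by simp
qed

lemma Pm_add: "Pm (x + y) = Pm x + Pm y"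
  by (rule lsq_eqI) (simp add: coef_Pm coef_add)
lemma Pm_scaleR: "Pm (r *\<^sub>R x) = r *\<^sub>R Pm x"
  by (rule lsq_eqI) (simp add: coef_Pm coef_scaleR)
lemma Pm_im: "Pm (im x) = im (Pm x)"
  by (rule lsq_eqI) (simp add: coef_Pm)

lemma norm_Pm_Pp: "(norm x)\<^sup>2 = (norm (Pm x))\<^sup>2 + (norm (Pp x))\<^sup>2"
proof -
  have "x = Pp x + Pm x" by (simp add: Pp_def)
  then have "(norm x)\<^sup>2 = (norm (Pp x + Pm x))\<^sup>2" by simp
  also have "\<dots> = (norm (Pm x))\<^sup>2 + (norm (Pp x))\<^sup>2"
    by (simp add: norm_add_sq H2s_orthogonal_H2ms)
  finally show ?thesis .
qed

lemma norm_Pm_le: "norm (Pm x) \<le> norm x" and norm_Pp_le: "norm (Pp x) \<le> norm x"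
proof -
  show "norm (Pm x) \<le> norm x" by (rule power2_le_imp_le) (simp_all add: norm_Pm_Pp[of x])
  show "norm (Pp x) \<le> norm x" by (rule power2_le_imp_le) (simp_all add: norm_Pm_Pp[of x])
qed

lemma bounded_linear_Pm: "bounded_linear Pm"
  by (rule bounded_linear_intro[of _ 1]) (auto simp: Pm_add Pm_scaleR norm_Pm_le)
lemma bounded_linear_Pp: "bounded_linear Pp"
  unfolding Pp_def by (intro bounded_linear_sub bounded_linear_ident bounded_linear_Pm)

lemma Pp_im: "Pp (im x) = im (Pp x)"
  by (simp add: Pp_def Pm_im im_diff)

lemma inner_Pp_H2s: "y \<in> H2s \<Longrightarrow> inner (Pp x) y = inner x y"
  using H2s_orthogonal_H2ms[OF _ Pm_H2ms, of y x] by (simp add: Pp_def inner_diff_left inner_commute[of "Pm x"])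

section \<open>Hankel operators on classes of functions\<close>

definition hk :: "(real \<Rightarrow> complex^'n^'n) \<Rightarrow> 'n lsq \<Rightarrow> 'n lsq" where "hk A x = Pm (mult A x)"

lemma bounded_linear_hk: "A \<in> Linf \<Longrightarrow> bounded_linear (hk A)"
  unfolding hk_def by (intro bounded_linear_compose[OF bounded_linear_Pm] bounded_linear_mult)

text \<open>The adjoint symbol maps monomials of negative index into \<open>H2ms\<close>, because
  the pairing with a monomial of index i \<ge> 0 involves only the coefficient j - i < 0 of
  \<open>A\<close>. By duality \<open>A\<close> preserves \<open>H2s\<close>.\<close>

lemma hk_eq_0:
  assumes A: "A \<in> Linf" "\<And>j. j < 0 \<Longrightarrow> mcoef A j = 0" and x: "x \<in> H2s"
  shows "hk A x = 0"
proof -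
  have "coef j (mult A x) = 0" if j: "j < 0" for j
  proof (rule coef_eqI)
    fix v
    have "coef i (mult (\<lambda>t. cadj (A t)) (mon j v)) = 0" if i: "i \<ge> 0" for i
    proof (rule coef_eqI)
      fix w
      have "inner (mult (\<lambda>t. cadj (A t)) (mon j v)) (mon i w) = inner (mon i w) (mult (\<lambda>t. cadj (A t)) (mon j v))"
        by (rule inner_commute)
      also have "\<dots> = inner (coef j (mult A (mon i w))) v"
        unfolding inner_mult[OF A(1), symmetric] by (rule inner_mon)
      also have "\<dots> = 0" using A(2)[of "j - i"] i j by (simp add: mcoef_mult[OF A(1)])
      finally show "inner (mult (\<lambda>t. cadj (A t)) (mon j v)) (mon i w) = inner 0 w" by simp
    qed
    then have "mult (\<lambda>t. cadj (A t)) (mon j v) \<in> H2ms" by (simp add: H2ms_def)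
    then show "inner (mult A x) (mon j v) = inner 0 v"
      using H2s_orthogonal_H2ms[OF x] by (simp add: inner_mult[OF A(1)])
  qed
  then have "mult A x \<in> H2s" by (simp add: H2s_def)
  then show ?thesis by (simp add: hk_def Pm_eq_0)
qed

lemma mcoef_diff:
  assumes "A \<in> Linf" "B \<in> Linf" shows "mcoef (\<lambda>t. A t - B t) j = mcoef A j - (mcoef B j :: complex^'n^'n)"
proof -
  have "mcoef (\<lambda>t. A t - B t) j *v v = (mcoef A j - mcoef B j) *v v" for v
    using mcoef_mult[OF Linf_diff[OF assms], of j 0 v] mcoef_mult[OF assms(1), of j 0 v] mcoef_mult[OF assms(2), of j 0 v]
    by (simp add: mult_diff_left[OF assms] coef_diff matrix_vector_mult_diff_rdistrib)
  then show ?thesis by (simp add: matrix_eq)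
qed

lemma hk_cong:
  assumes "A \<in> Linf" "B \<in> Linf" "\<And>j. j < 0 \<Longrightarrow> mcoef A j = mcoef B j" and x: "x \<in> H2s"
  shows "hk A x = hk B x"
proof -
  have "hk (\<lambda>t. A t - B t) x = 0"
    by (rule hk_eq_0[OF Linf_diff[OF assms(1,2)] _ x]) (simp add: mcoef_diff assms)
  moreover have "hk (\<lambda>t. A t - B t) x = hk A x - hk B x"
    by (simp add: hk_def mult_diff_left assms bl_diff[OF bounded_linear_Pm])
  ultimately show ?thesis by simp
qed

section \<open>Pointwise products\<close>

definition cip :: "('n::finite) lsq \<Rightarrow> 'n lsq \<Rightarrow> real \<Rightarrow> complex" where
  "cip x y t = (\<Sum>k\<in>UNIV. rep x t $ k * cnj (rep y t $ k))"

lemma cnj_measurable: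
  assumes "f \<in> borel_measurable M" shows "(\<lambda>t. cnj (f t)) \<in> borel_measurable M"
  by (rule borel_measurable_continuous_on[OF continuous_on_cnj[OF continuous_on_id] assms])

lemma integrable_cip: "integrable Tm (cip x y)"
proof -
  have "integrable Tm (\<lambda>t. rep x t $ k * cnj (rep y t $ k))" for k
  proof (rule Bochner_Integration.integrable_bound[of _ "\<lambda>t. (norm (rep x t))\<^sup>2 + (norm (rep y t))\<^sup>2"])
    show "integrable Tm (\<lambda>t. (norm (rep x t))\<^sup>2 + (norm (rep y t))\<^sup>2)"
      using rep_L2[of x] rep_L2[of y] by (auto simp: L2_def)
    show "(\<lambda>t. rep x t $ k * cnj (rep y t $ k)) \<in> borel_measurable Tm"
      by (intro borel_measurable_times cnj_measurable) measurable
    show "AE t in Tm. norm (rep x t $ k * cnj (rep y t $ k)) \<le> norm ((norm (rep x t))\<^sup>2 + (norm (rep y t))\<^sup>2)"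
    proof (rule AE_I2)
      fix t
      have "norm (rep x t $ k * cnj (rep y t $ k)) \<le> norm (rep x t) * norm (rep y t)"
        unfolding norm_mult complex_mod_cnj by (intro mult_mono Finite_Cartesian_Product.norm_nth_le) auto
      also have "2 * (norm (rep x t) * norm (rep y t)) \<le> (norm (rep x t))\<^sup>2 + (norm (rep y t))\<^sup>2"
        using sum_squares_bound[of "norm (rep x t)" "norm (rep y t)"] by (simp add: mult.assoc)
      then have "norm (rep x t) * norm (rep y t) \<le> (norm (rep x t))\<^sup>2 + (norm (rep y t))\<^sup>2"
        using mult_nonneg_nonneg[OF norm_ge_zero norm_ge_zero, of "rep x t" "rep y t"] by linarith
      finally show "norm (rep x t $ k * cnj (rep y t $ k)) \<le> norm ((norm (rep x t))\<^sup>2 + (norm (rep y t))\<^sup>2)" by simp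
    qed
  qed
  then show ?thesis unfolding cip_def[abs_def] by (intro Bochner_Integration.integrable_sum)
qed

text \<open>The coefficients of the pointwise Hermitian product are the complex Hermitian products
  of x with z^j y. The imaginary part is the real inner product with i y in place of y.\<close>

lemma cip_coef:
  "(LINT t|Tm. cip x y t * cis (- of_int j * t)) = 2 * pi * Complex (inner x (sh j y)) (inner x (sh j (im y)))"
proof -
  have int: "integrable Tm (\<lambda>t. cip x y t * cis (- of_int j * t))"
    by (intro integrable_mult_cis integrable_cip)
  have re: "Re (\<Sum>k\<in>UNIV. a $ k * cnj (b $ k)) = inner a b" for a b :: "complex^'a"
    by (simp add: inner_vec_def inner_complex_def)
  have mul: "cip x y t * cis (- of_int j * t) = (\<Sum>k\<in>UNIV. rep x t $ k * cnj ((cis (of_int j * t) *s rep y t) $ k))" for t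
    by (simp add: cip_def sum_distrib_left cis_cnj mult_ac)
  have mul': "cip x y t * cis (- of_int j * t) = \<i> * (\<Sum>k\<in>UNIV. rep x t $ k * cnj ((cis (of_int j * t) *s (\<i> *s rep y t)) $ k))" for t
    unfolding mul sum_distrib_left by (intro sum.cong) (auto simp: algebra_simps)
  have "Re (LINT t|Tm. cip x y t * cis (- of_int j * t)) = (LINT t|Tm. Re (cip x y t * cis (- of_int j * t)))"
    by (rule integral_Re[OF int, symmetric])
  also have "\<dots> = (LINT t|Tm. inner (rep x t) (rep (sh j y) t))"
  proof (rule integral_cong_AE)
    show "AE t in Tm. Re (cip x y t * cis (- of_int j * t)) = inner (rep x t) (rep (sh j y) t)"
      using rep_sh[of j y] by eventually_elim (simp only: mul re)
    show "(\<lambda>t. Re (cip x y t * cis (- of_int j * t))) \<in> borel_measurable Tm" using int by measurable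
  qed measurable
  finally have 1: "Re (LINT t|Tm. cip x y t * cis (- of_int j * t)) = 2 * pi * inner x (sh j y)"
    by (simp add: inner_rep)
  have "Im (LINT t|Tm. cip x y t * cis (- of_int j * t)) = (LINT t|Tm. Im (cip x y t * cis (- of_int j * t)))"
    by (rule integral_Im[OF int, symmetric])
  also have "\<dots> = (LINT t|Tm. inner (rep x t) (rep (sh j (im y)) t))"
  proof (rule integral_cong_AE)
    show "AE t in Tm. Im (cip x y t * cis (- of_int j * t)) = inner (rep x t) (rep (sh j (im y)) t)"
      using rep_sh[of j "im y"] rep_im[of y] by eventually_elim (simp only: mul' re Im_i_times)
    show "(\<lambda>t. Im (cip x y t * cis (- of_int j * t))) \<in> borel_measurable Tm" using int by measurable
  qed measurable
  finally have 2: "Im (LINT t|Tm. cip x y t * cis (- of_int j * t)) = 2 * pi * inner x (sh j (im y))"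
    by (simp add: inner_rep)
  show ?thesis using 1 2 by (simp add: complex_eq_iff)
qed

lemma cip_zero:
  assumes "\<And>j. inner x (sh j y) = 0" "\<And>j. inner x (sh j (im y)) = 0"
  shows "AE t in Tm. cip x y t = 0"
  by (rule fourier_uniqueness)
    (unfold fourier_null_def cip_coef, simp add: assms integrable_cip complex_eq_iff)

lemma cip_const:
  assumes "\<And>j. j \<noteq> 0 \<Longrightarrow> inner x (sh j y) = 0" "\<And>j. j \<noteq> 0 \<Longrightarrow> inner x (sh j (im y)) = 0"
  shows "\<exists>c. AE t in Tm. cip x y t = c"
proof -
  define c where "c = Complex (inner x y) (inner x (im y))"
  have "fourier_null (\<lambda>t. cip x y t - c)"
    unfolding fourier_null_def
  proof (intro conjI allI)
    show "integrable Tm (\<lambda>t. cip x y t - c)" using integrable_cip by (intro Bochner_Integration.integrable_diff) auto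
    fix j :: int
    have i1: "integrable Tm (\<lambda>t. cip x y t * cis (- of_int j * t))"
      by (intro integrable_mult_cis integrable_cip)
    have i2: "integrable Tm (\<lambda>t. c * cis (- of_int j * t))"
      by (intro integrable_mult_cis) auto
    have "(LINT t|Tm. (cip x y t - c) * cis (- of_int j * t))
       = (LINT t|Tm. cip x y t * cis (- of_int j * t)) - (LINT t|Tm. c * cis (- of_int j * t))"
      unfolding left_diff_distrib by (rule Bochner_Integration.integral_diff[OF i1 i2])
    also have "(LINT t|Tm. c * cis (- of_int j * t)) = c * (LINT t|Tm. cis (of_int (- j) * t))"
      unfolding of_int_minus by (rule integral_mult_right_zero)
    also have "(LINT t|Tm. cip x y t * cis (- of_int j * t)) - c * (LINT t|Tm. cis (of_int (- j) * t)) = 0"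
      unfolding cip_coef integral_cis_Tm using assms
      by (cases "j = 0") (auto simp: c_def complex_eq_iff)
    finally show "(LINT t|Tm. (cip x y t - c) * cis (- of_int j * t)) = 0" .
  qed
  from fourier_uniqueness[OF this] show ?thesis by auto
qed

section \<open>Wandering vectors and annihilators\<close>

lemma rep_sum:
  assumes "finite S" shows "AE t in Tm. rep (\<Sum>i\<in>S. g i) t = (\<Sum>i\<in>S. rep (g i) t)"
  using assms
proof (induction S)
  case empty
  then show ?case using rep_zero by simp
next
  case (insert i S)
  show ?case using insert.IH rep_add[of "g i" "\<Sum>i\<in>S. g i"]
    by eventually_elim (simp add: insert.hyps)
qed

text \<open>A complex linear combination, written with \<open>im\<close> because classes carry real
  scalar multiplication only.\<close>

definition lincomb :: "complex^'n \<Rightarrow> ('n \<Rightarrow> 'm lsq) \<Rightarrow> ('m::finite) lsq" where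
  "lincomb c e = (\<Sum>b\<in>UNIV. Re (c $ b) *\<^sub>R e b + Im (c $ b) *\<^sub>R im (e b))"

lemma rep_lincomb: "AE t in Tm. rep (lincomb c e) t = (\<Sum>b\<in>UNIV. c $ b *s rep (e b) t)"
proof -
  have "AE t in Tm. rep (Re (c $ b) *\<^sub>R e b + Im (c $ b) *\<^sub>R im (e b)) t = c $ b *s rep (e b) t" for b
    using rep_add[of "Re (c $ b) *\<^sub>R e b" "Im (c $ b) *\<^sub>R im (e b)"] rep_scaleR[of "Re (c $ b)" "e b"]
      rep_scaleR[of "Im (c $ b)" "im (e b)"] rep_im[of "e b"]
    by eventually_elim (subst ii_vector_scale, simp)
  then have "AE t in Tm. \<forall>b. rep (Re (c $ b) *\<^sub>R e b + Im (c $ b) *\<^sub>R im (e b)) t = c $ b *s rep (e b) t"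
    by (simp add: AE_all_countable)
  then show ?thesis
    unfolding lincomb_def using rep_sum[OF finite_class.finite_UNIV, of "\<lambda>b. Re (c $ b) *\<^sub>R e b + Im (c $ b) *\<^sub>R im (e b)"]
    by eventually_elim simp
qed

lemma coef_lincomb: "coef j (lincomb c e) = (\<Sum>b\<in>UNIV. c $ b *s coef j (e b))"
  unfolding lincomb_def bl_sum[OF bounded_linear_coef]
  by (intro sum.cong refl, subst ii_vector_scale) (simp add: coef_add coef_scaleR)

lemma norm_sq_complex: "complex_of_real ((norm (w::complex^'n))\<^sup>2) = (\<Sum>k\<in>UNIV. w $ k * cnj (w $ k))"
  unfolding norm_vec_def L2_set_def
  by (simp add: sum_nonneg complex_norm_square[symmetric])

lemma norm_sq_combination:
  fixes u :: "'n::finite \<Rightarrow> complex^'m" and c :: "complex^'n"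
  shows "complex_of_real ((norm (\<Sum>b\<in>UNIV. c $ b *s u b))\<^sup>2)
    = (\<Sum>b\<in>UNIV. \<Sum>a\<in>UNIV. c $ b * cnj (c $ a) * (\<Sum>k\<in>UNIV. u b $ k * cnj (u a $ k)))"
proof -
  have "complex_of_real ((norm (\<Sum>b\<in>UNIV. c $ b *s u b))\<^sup>2)
    = (\<Sum>k\<in>UNIV. (\<Sum>b\<in>UNIV. c $ b * u b $ k) * (\<Sum>a\<in>UNIV. cnj (c $ a) * cnj (u a $ k)))"
    unfolding norm_sq_complex by simp
  also have "\<dots> = (\<Sum>k\<in>UNIV. \<Sum>b\<in>UNIV. \<Sum>a\<in>UNIV. c $ b * cnj (c $ a) * (u b $ k * cnj (u a $ k)))"
    unfolding sum_product by (intro sum.cong refl) (simp add: mult_ac)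
  also have "\<dots> = (\<Sum>b\<in>UNIV. \<Sum>k\<in>UNIV. \<Sum>a\<in>UNIV. c $ b * cnj (c $ a) * (u b $ k * cnj (u a $ k)))"
    by (rule sum.swap)
  also have "\<dots> = (\<Sum>b\<in>UNIV. \<Sum>a\<in>UNIV. \<Sum>k\<in>UNIV. c $ b * cnj (c $ a) * (u b $ k * cnj (u a $ k)))"
    by (intro sum.cong refl sum.swap)
  finally show ?thesis by (simp add: sum_distrib_left)
qed

text \<open>Replacing each \<open>f b\<close> by its component orthogonal to the annihilated functions vanishing at the
  origin gives wandering vectors \<open>e b\<close>; their Gram matrix is constant on the circle, hence
  they form a basis almost everywhere.\<close>

theorem annihilator_zero:
  fixes A :: "real \<Rightarrow> complex^'n^'n" and f :: "'n \<Rightarrow> 'n lsq"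
  assumes A: "A \<in> Linf" and f: "\<And>b. f b \<in> H2s" "\<And>b. mult A (f b) = 0" "\<And>b. coef 0 (f b) = axis b 1"
  shows "AE t in Tm. A t = 0"
proof -
  define Y where "Y = H2s \<inter> {x. mult A x = 0} \<inter> {x. coef 0 x = 0}"
  have sub: "subspace Y"
    unfolding Y_def
    by (intro subspace_inter subspace_H2s)
      (auto simp: subspace_def mult_add mult_scaleR A coef_add coef_scaleR coef_zero bl_zero[OF bounded_linear_mult[OF A]])
  have clos: "closed Y"
    unfolding Y_def
    by (intro closed_Int closed_H2s closed_Collect_eq bounded_linear.continuous_on[OF bounded_linear_mult[OF A]]
        bounded_linear.continuous_on[OF bounded_linear_coef] continuous_intros)
  have "\<forall>b. \<exists>p. p \<in> Y \<and> (\<forall>m\<in>Y. inner (f b - p) m = 0)"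
    using hilbert_projection[OF sub clos] by metis
  then obtain p where p: "\<And>b. p b \<in> Y" "\<And>b m. m \<in> Y \<Longrightarrow> inner (f b - p b) m = 0" by metis
  define e where "e b = f b - p b" for b
  have e: "e b \<in> H2s" "mult A (e b) = 0" "coef 0 (e b) = axis b 1" for b
    using p(1)[of b] f[of b] subspace_diff[OF subspace_H2s, of "f b" "p b"]
    by (auto simp: Y_def e_def coef_diff bl_diff[OF bounded_linear_mult[OF A]])
  have eY: "inner (e b) m = 0" if "m \<in> Y" for b m using p(2)[OF that] by (simp add: e_def)
  \<comment> \<open>Multiplication by a positive power of z keeps a function annihilated and makes
    it vanish at the origin. Hence each \<open>e b\<close> is orthogonal to all z^j e a with j > 0,
    and by symmetry to those with j < 0.\<close>
  have shY: "sh j x \<in> Y" if "x \<in> H2s" "mult A x = 0" "j > 0" for j x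
    using that by (auto simp: Y_def sh_H2s mult_sh A sh_zero H2s_def)
  have pos: "inner (e b) (sh j (e a)) = 0" "inner (e b) (sh j (im (e a))) = 0" if "j > 0" for j a b
    using that e by (auto intro!: eY shY im_H2s simp: mult_im A im_zero)
  have neg: "inner (e b) (sh j (e a)) = 0" "inner (e b) (sh j (im (e a))) = 0" if "j < 0" for j a b
  proof -
    have "inner (e b) (sh j (e a)) = inner (sh (- j) (e b)) (e a)" by (simp add: inner_sh)
    then show "inner (e b) (sh j (e a)) = 0" using pos(1)[of "- j" a b] that by (simp add: inner_commute)
    have "inner (e b) (sh j (im (e a))) = inner (sh (- j) (e b)) (im (e a))" by (simp add: inner_sh)
    also have "\<dots> = - inner (e a) (sh (- j) (im (e b)))"
      by (simp add: sh_im inner_im[of "e a" "sh (- j) (e b)", symmetric] inner_commute)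
    finally show "inner (e b) (sh j (im (e a))) = 0" using pos(2)[of "- j" a b] that by simp
  qed
  have "\<exists>c. AE t in Tm. cip (e b) (e a) t = c" for a b
    by (rule cip_const) (use pos neg in \<open>metis linorder_neqE\<close>)+
  then obtain Q where Q: "\<And>a b. AE t in Tm. cip (e b) (e a) t = Q b a" by metis
  then have Q': "AE t in Tm. \<forall>b a. cip (e b) (e a) t = Q b a" by (simp add: AE_all_countable)
  have mA: "AE t in Tm. \<forall>b. A t *v rep (e b) t = 0"
  proof -
    have "AE t in Tm. A t *v rep (e b) t = 0" for b
      using rep_mult[OF A, of "e b", unfolded e(2)] rep_zero[where ?'a='n] by eventually_elim simp
    then show ?thesis by (simp add: AE_all_countable)
  qed
  show ?thesis using Q' mA
  proof eventually_elim
    case (elim t)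
    define M :: "complex^'n^'n" where "M = (\<chi> i b. rep (e b) t $ i)"
    have Mv: "M *v c = (\<Sum>b\<in>UNIV. c $ b *s rep (e b) t)" for c
      by (simp add: M_def matrix_vector_mult_def vec_eq_iff mult.commute)
    \<comment> \<open>Since the Gram matrix is constant, a linear relation among the vectors at the
      single point t holds almost everywhere. The coefficient at index 0, where the
      \<open>e b\<close> are the standard basis, then shows c = 0.\<close>
    have "c = 0" if c: "M *v c = 0" for c
    proof -
      define y where "y = lincomb c e"
      have ry: "AE s in Tm. rep y s = (\<Sum>b\<in>UNIV. c $ b *s rep (e b) s)"
        unfolding y_def by (rule rep_lincomb)
      have gram: "complex_of_real ((norm (\<Sum>b\<in>UNIV. c $ b *s rep (e b) s))\<^sup>2)
          = (\<Sum>b\<in>UNIV. \<Sum>a\<in>UNIV. c $ b * cnj (c $ a) * cip (e b) (e a) s)" for s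
        unfolding cip_def by (rule norm_sq_combination)
      have q0: "complex_of_real 0 = (\<Sum>b\<in>UNIV. \<Sum>a\<in>UNIV. c $ b * cnj (c $ a) * Q b a)"
        using gram[of t] c elim(1) by (simp add: Mv)
      have "AE s in Tm. rep y s = rep 0 s"
        using ry Q' rep_zero[where ?'a='n]
      proof eventually_elim
        case (elim s)
        then have "complex_of_real ((norm (rep y s))\<^sup>2) = of_real 0" using gram[of s] q0 by simp
        then show ?case using elim by simp
      qed
      then have "y = 0" by (simp add: lsq_eq_iff)
      then have "coef 0 y = 0" by (simp add: coef_zero)
      moreover have "coef 0 y = (\<Sum>b\<in>UNIV. c $ b *s axis b 1)"
        unfolding y_def coef_lincomb e ..
      moreover have "(\<Sum>b\<in>UNIV. c $ b *s axis b 1) = c"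
        by (simp add: vec_eq_iff axis_def if_distrib cong: if_cong)
      ultimately show "c = 0" by simp
    qed
    then obtain B where "B ** M = mat 1" using matrix_left_invertible_ker[of M] by blast
    then have B: "M ** B = mat 1" by (simp add: matrix_left_right_inverse)
    have AM: "A t ** M = 0"
      using elim(2) by (simp add: M_def matrix_matrix_mult_def matrix_vector_mult_def vec_eq_iff)
    have "A t ** (M ** B) = 0"
      unfolding matrix_mul_assoc AM by (simp add: matrix_matrix_mult_def vec_eq_iff)
    then show "A t = 0" by (simp add: B)
  qed
qed

text \<open>Conjugation followed by multiplication with z^-1 sends index j to -1 - j. It exchanges
  \<open>H2s\<close> with \<open>H2ms\<close> and the first coefficients 0 and -1.\<close>

definition conj_refl :: "('n::finite) lsq \<Rightarrow> 'n lsq" where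
  "conj_refl x = cls (\<lambda>t. cis (- t) *s (\<chi> k. cnj (rep x t $ k)))"

lemma L2_conj_refl: "(\<lambda>t. cis (- t) *s (\<chi> k. cnj (rep x t $ k))) \<in> L2"
proof (rule L2_bound[OF _ rep_L2[of x], of _ 1])
  have "(\<lambda>t. \<chi> k. cis (- t) * cnj (rep x t $ k)) \<in> borel_measurable Tm"
    using cis_measurable[of "-1"] by (intro measurable_vec_lambda borel_measurable_times cnj_measurable measurable_vec_nth rep_measurable) simp
  moreover have "(\<lambda>t. cis (- t) *s (\<chi> k. cnj (rep x t $ k))) = (\<lambda>t. \<chi> k. cis (- t) * cnj (rep x t $ k))"
    by (auto simp: vec_eq_iff)
  ultimately show "(\<lambda>t. cis (- t) *s (\<chi> k. cnj (rep x t $ k))) \<in> borel_measurable Tm" by simp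
  show "AE t in Tm. norm (cis (- t) *s (\<chi> k. cnj (rep x t $ k))) \<le> 1 * norm (rep x t)"
    unfolding norm_smult by (simp add: norm_vec_def)
qed

lemma coef_conj_refl: "coef j (conj_refl x) = (\<chi> k. cnj (coef (-1 - j) x $ k))"
proof -
  have "(LINT t|Tm. (cis (- t) *s (\<chi> k. cnj (rep x t $ k))) $ k * cis (- of_int j * t))
      = cnj (LINT t|Tm. rep x t $ k * cis (- of_int (-1 - j) * t))" for k
    unfolding Bochner_Integration.integral_cnj[symmetric]
    by (intro Bochner_Integration.integral_cong) (auto simp: cis_cnj cis_mult algebra_simps)
  then show ?thesis unfolding conj_refl_def coef_cls[OF L2_conj_refl] coef_def[of _ x]
    by (simp add: fcoef_def vec_eq_iff)
qed

text \<open>\<open>conj_refl\<close> reduces this to the analytic case for the entrywise conjugate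
  of \<open>A\<close>.\<close>

corollary annihilator_zero_minus:
  fixes A :: "real \<Rightarrow> complex^'n^'n" and g :: "'n \<Rightarrow> 'n lsq"
  assumes A: "A \<in> Linf" and g: "\<And>b. g b \<in> H2ms" "\<And>b. mult A (g b) = 0" "\<And>b. coef (-1) (g b) = axis b 1"
  shows "AE t in Tm. A t = 0"
proof -
  define B where "B t = (\<chi> i j. cnj (A t $ i $ j))" for t
  have B: "B \<in> Linf"
  proof -
    have "B \<in> borel_measurable Tm" unfolding B_def using Linf_measurable[OF A]
      by (intro measurable_vec_lambda cnj_measurable measurable_vec_nth)
    moreover have "norm (B t) = norm (A t)" for t by (simp add: B_def norm_vec_def)
    ultimately show ?thesis using A by (simp add: Linf_def)
  qed
  have "mult B (conj_refl (g b)) = 0" for b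
  proof -
    have "AE t in Tm. rep (mult B (conj_refl (g b))) t = rep 0 t"
      using rep_mult[OF B, of "conj_refl (g b)"] rep_cls[OF L2_conj_refl[of "g b"], folded conj_refl_def]
        rep_mult[OF A, of "g b"] rep_zero[where ?'a='n]
    proof eventually_elim
      case (elim t)
      have "A t *v rep (g b) t = 0" using elim g(2)[of b] by simp
      then have "(\<Sum>j\<in>UNIV. cnj (A t $ i $ j * rep (g b) t $ j)) = 0" for i
        unfolding cnj_sum[symmetric] by (simp add: matrix_vector_mult_def vec_eq_iff)
      then have "B t *v (\<chi> k. cnj (rep (g b) t $ k)) = 0"
        by (simp add: B_def matrix_vector_mult_def vec_eq_iff)
      then show ?case using elim by (simp add: vec.scale)
    qed
    then show ?thesis by (simp add: lsq_eq_iff)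
  qed
  moreover have "conj_refl (g b) \<in> H2s" for b
    using g(1)[of b] by (auto simp: H2s_def H2ms_def coef_conj_refl vec_eq_iff)
  moreover have "coef 0 (conj_refl (g b)) = axis b 1" for b
    by (simp add: coef_conj_refl g(3) axis_def vec_eq_iff)
  ultimately have "AE t in Tm. B t = 0" by (intro annihilator_zero[OF B])
  then show ?thesis by eventually_elim (simp add: B_def vec_eq_iff)
qed

section \<open>One-step extensions of Hankel operators\<close>

text \<open>In matrix form, the Hankel operator of this symbol has \<open>C\<close> only in its
  upper left corner, and deleting either its first row or its first column leaves the Hankel
  operator of \<Psi>.\<close>

definition extend :: "(real \<Rightarrow> complex^'n^'n) \<Rightarrow> complex^'n^'n \<Rightarrow> real \<Rightarrow> complex^'n^'n" where
  "extend \<Psi> C t = zpow (-1) t ** (\<Psi> t + C)"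

lemma Linf_extend: "\<Psi> \<in> Linf \<Longrightarrow> extend \<Psi> C \<in> Linf"
  unfolding extend_def by (intro Linf_mult Linf_add Linf_const Linf_zpow)

lemma coef_mult_const: "coef j (mult (\<lambda>t. C) x) = C *v coef j x"
proof (rule coef_eqI)
  fix v
  have "mult (\<lambda>t. cadj C) (mon j v) = mon j (cadj C *v v)"
  proof -
    have "AE t in Tm. rep (mult (\<lambda>t. cadj C) (mon j v)) t = rep (mon j (cadj C *v v)) t"
      using rep_mult[OF Linf_const, of "cadj C" "mon j v"] rep_mon[of j v] rep_mon[of j "cadj C *v v"]
      by eventually_elim (simp add: vec.scale)
    then show ?thesis by (simp add: lsq_eq_iff)
  qed
  then show "inner (mult (\<lambda>t. C) x) (mon j v) = inner (C *v coef j x) v"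
    by (simp add: inner_mult inner_mon[symmetric] inner_cadj)
qed

lemma mult_extend: "\<Psi> \<in> Linf \<Longrightarrow> mult (extend \<Psi> C) x = sh (-1) (mult \<Psi> x + mult (\<lambda>t. C) x)"
  unfolding extend_def[abs_def] by (simp add: mult_zpow Linf_add mult_add_left)

lemma hk_const: "x \<in> H2s \<Longrightarrow> Pm (mult (\<lambda>t. C) x) = 0"
  by (rule Pm_eq_0) (simp add: H2s_def coef_mult_const)

lemma Pm_backward_shift: "Pm (sh (-1) h) = sh (-1) (Pm h + mon 0 (coef 0 h))"
  by (rule lsq_eqI) (auto simp: coef_Pm coef_add coef_mon)

lemma norm_Pm_backward_shift: "(norm (Pm (sh (-1) h)))\<^sup>2 = (norm (Pm h))\<^sup>2 + (norm (coef 0 h))\<^sup>2"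
  unfolding Pm_backward_shift norm_sh norm_add_sq by (simp add: inner_mon coef_Pm)

lemma coef_hk_extend:
  "\<Psi> \<in> Linf \<Longrightarrow> coef (-1) (hk (extend \<Psi> C) x) = coef 0 (mult \<Psi> x) + C *v coef 0 x"
  by (simp add: hk_def mult_extend coef_Pm coef_add coef_mult_const)

lemma norm_hk_extend:
  assumes "\<Psi> \<in> Linf" "x \<in> H2s"
  shows "(norm (hk (extend \<Psi> C) x))\<^sup>2 = (norm (hk \<Psi> x))\<^sup>2 + (norm (coef 0 (mult \<Psi> x) + C *v coef 0 x))\<^sup>2"
  using assms
  by (simp add: hk_def mult_extend norm_Pm_backward_shift Pm_add hk_const coef_add coef_mult_const)

text \<open>\<open>H\<close> is what remains after deleting the first row, and \<open>T\<close> is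
  that row without \<open>C\<close>. The projection \<open>Pp\<close> is inserted because the locale
  works on a whole Hilbert space, whereas \<open>H2s\<close> is a subset of one.\<close>

lemma corner_hankel:
  fixes \<Psi> :: "real \<Rightarrow> complex^'n^'n"
  assumes \<Psi>: "\<Psi> \<in> Linf" and le: "\<And>x. x \<in> H2s \<Longrightarrow> norm (hk \<Psi> x) \<le> norm x"
  shows "corner (\<lambda>x. hk \<Psi> (Pp x)) (\<lambda>x. coef 0 (mult \<Psi> (Pp x))) (coef 0) im"
proof (rule corner.intro)
  show "bounded_linear (\<lambda>x. hk \<Psi> (Pp x))"
    by (intro bounded_linear_compose[OF bounded_linear_hk[OF \<Psi>] bounded_linear_Pp])
  show "bounded_linear (\<lambda>x. coef 0 (mult \<Psi> (Pp x)))"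
    by (intro bounded_linear_compose[OF bounded_linear_coef] bounded_linear_compose[OF bounded_linear_mult[OF \<Psi>] bounded_linear_Pp])
  show "bounded_linear (coef 0 :: 'n lsq \<Rightarrow> _)" "bounded_linear (im :: 'n lsq \<Rightarrow> _)"
    by (rule bounded_linear_coef bounded_linear_im)+
  show "norm (hk \<Psi> (Pp (im x))) = norm (hk \<Psi> (Pp x))" for x
    by (simp add: hk_def Pp_im mult_im \<Psi> Pm_im)
  show "coef 0 (mult \<Psi> (Pp (im x))) = \<i> *s coef 0 (mult \<Psi> (Pp x))" for x
    by (simp add: Pp_im mult_im \<Psi>)
  show "\<exists>x. coef 0 x = w \<and> norm x \<le> norm w" for w :: "complex^'n"
    by (intro exI[of _ "mon 0 w"]) (simp add: coef_mon)
  show "norm (hk \<Psi> (Pp x)) \<le> norm x" for x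
    using le[OF Pp_H2s, of x] norm_Pp_le[of x] by linarith
qed simp_all

text \<open>Parrott's second hypothesis concerns the deleted first column: if the coefficient of x
  at 0 vanishes, then Pp x = z y, and the remaining operator acts on y as
  \<open>hk \<Psi>\<close>.\<close>

lemma nehari_step:
  fixes \<Psi> :: "real \<Rightarrow> complex^'n^'n"
  assumes \<Psi>: "\<Psi> \<in> Linf" and le: "\<And>x. x \<in> H2s \<Longrightarrow> norm (hk \<Psi> x) \<le> norm x"
  shows "\<exists>C. \<forall>x\<in>H2s. norm (hk (extend \<Psi> C) x) \<le> norm x"
proof -
  interpret corner "\<lambda>x. hk \<Psi> (Pp x)" "\<lambda>x. coef 0 (mult \<Psi> (Pp x))" "coef 0" im
    by (rule corner_hankel[OF assms])
  have "\<exists>C. \<forall>x. norm (G C x) \<le> norm x"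
  proof (rule parrott)
    fix x :: "'n lsq" assume x: "coef 0 x = 0"
    define y where "y = sh (-1) (Pp x)"
    have "coef j y = 0" if "j < 0" for j
      using that x by (cases "j = -1") (auto simp: y_def coef_Pp)
    then have y: "y \<in> H2s" by (simp add: H2s_def)
    have Px: "Pp x = sh 1 y" by (simp add: y_def sh_sh)
    have "(norm (hk \<Psi> (Pp x)))\<^sup>2 + (norm (coef 0 (mult \<Psi> (Pp x))))\<^sup>2 = (norm (Pm (sh (-1) (mult \<Psi> (Pp x)))))\<^sup>2"
      by (simp add: norm_Pm_backward_shift hk_def)
    also have "sh (-1) (mult \<Psi> (Pp x)) = mult \<Psi> y" by (simp add: Px mult_sh \<Psi> sh_sh)
    also have "(norm (Pm (mult \<Psi> y)))\<^sup>2 \<le> (norm y)\<^sup>2" using le[OF y] by (simp add: hk_def)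
    also have "\<dots> \<le> (norm x)\<^sup>2" using norm_Pp_le[of x] by (simp add: y_def)
    finally show "(norm (hk \<Psi> (Pp x)))\<^sup>2 + (norm (coef 0 (mult \<Psi> (Pp x))))\<^sup>2 \<le> (norm x)\<^sup>2" .
  qed
  then obtain C where C: "\<And>x. norm (G C x) \<le> norm x" by blast
  have "norm (hk (extend \<Psi> C) x) \<le> norm x" if x: "x \<in> H2s" for x
  proof (rule power2_le_imp_le)
    have "(norm (hk (extend \<Psi> C) x))\<^sup>2 = (norm (G C x))\<^sup>2"
      by (simp add: norm_hk_extend \<Psi> x norm_G_sq toprow_def Pp_id)
    also have "\<dots> \<le> (norm x)\<^sup>2" using C by (intro power_mono) auto
    finally show "(norm (hk (extend \<Psi> C) x))\<^sup>2 \<le> (norm x)\<^sup>2" .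
  qed simp
  then show ?thesis by blast
qed

lemma extremal_extension:
  fixes \<Psi> :: "real \<Rightarrow> complex^'n^'n"
  assumes \<Psi>: "\<Psi> \<in> Linf" and le: "\<And>x. x \<in> H2s \<Longrightarrow> norm (hk \<Psi> x) \<le> norm x"
    and ess: "ess_contracts \<theta> (\<lambda>x. hk \<Psi> (Pp x))" "0 \<le> \<theta>" "\<theta> < 1"
  obtains C where "\<And>x. x \<in> H2s \<Longrightarrow> norm (hk (extend \<Psi> C) x) \<le> norm x"
    "(\<forall>w. \<exists>x\<in>H2s. norm (hk (extend \<Psi> C) x) = norm x \<and> coef 0 x = w) \<or>
     (\<forall>w. \<exists>x\<in>H2s. norm (hk (extend \<Psi> C) x) = norm x \<and> coef (-1) (hk (extend \<Psi> C) x) = w)"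
    "ess_contracts \<theta> (\<lambda>x. hk (extend \<Psi> C) (Pp x))"
proof -
  interpret corner "\<lambda>x. hk \<Psi> (Pp x)" "\<lambda>x. coef 0 (mult \<Psi> (Pp x))" "coef 0" im
    by (rule corner_hankel[OF \<Psi> le])
  have sq: "(norm (hk (extend \<Psi> C) (Pp x)))\<^sup>2 = (norm (G C x))\<^sup>2" for C x
    using norm_hk_extend[OF \<Psi> Pp_H2s, of C x] by (simp add: norm_G_sq toprow_def coef_Pp)
  then have eq: "norm (hk (extend \<Psi> C) (Pp x)) = norm (G C x)" for C x
    by (rule power2_eq_imp_eq) auto
  have "\<exists>C. \<forall>x. norm (G C x) \<le> norm x"
  proof -
    obtain C where C: "\<forall>x\<in>H2s. norm (hk (extend \<Psi> C) x) \<le> norm x" using nehari_step[OF \<Psi> le] by blast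
    have "norm (G C x) \<le> norm x" for x
      using C Pp_H2s[of x] norm_Pp_le[of x] eq[of C x] by (metis order_trans)
    then show ?thesis by blast
  qed
  then obtain C where C: "\<And>x. norm (G C x) \<le> norm x"
      and alt: "coef 0 ` maxv 1 C = UNIV \<or> toprow C ` maxv 1 C = UNIV"
    using extremal_completion[OF _ ess] by metis
  \<comment> \<open>\<open>G C\<close> ignores the part of x in \<open>H2ms\<close>, so such a part
    would only lengthen x; a maximising vector has none.\<close>
  have E: "x \<in> H2s \<and> norm (hk (extend \<Psi> C) x) = norm x" if "x \<in> maxv 1 C" for x
  proof -
    have "G C x = G C (Pp x)" by (simp add: G_def toprow_def coef_Pp Pp_id)
    then have "norm x \<le> norm (Pp x)" using C[of "Pp x"] that by (simp add: maxv_def)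
    then have "(norm x)\<^sup>2 \<le> (norm (Pp x))\<^sup>2" by (intro power_mono) auto
    then have "norm (Pm x) = 0" using norm_Pm_Pp[of x] by simp
    then have "Pp x = x" by (simp add: Pp_def)
    then show ?thesis using Pp_H2s[of x] eq[of C x] that by (simp add: maxv_def)
  qed
  have tr: "toprow C x = coef (-1) (hk (extend \<Psi> C) x)" if "x \<in> H2s" for x
    using that by (simp add: toprow_def coef_hk_extend \<Psi> Pp_id)
  show thesis
  proof (rule that[of C])
    show "norm (hk (extend \<Psi> C) x) \<le> norm x" if "x \<in> H2s" for x
      using eq[of C x] C[of x] that by (simp add: Pp_id)
    show "(\<forall>w. \<exists>x\<in>H2s. norm (hk (extend \<Psi> C) x) = norm x \<and> coef 0 x = w) \<or>
     (\<forall>w. \<exists>x\<in>H2s. norm (hk (extend \<Psi> C) x) = norm x \<and> coef (-1) (hk (extend \<Psi> C) x) = w)"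
    proof (rule disj_forward[OF alt])
      assume *: "coef 0 ` maxv 1 C = UNIV"
      show "\<forall>w. \<exists>x\<in>H2s. norm (hk (extend \<Psi> C) x) = norm x \<and> coef 0 x = w"
      proof
        fix w
        have "w \<in> coef 0 ` maxv 1 C" unfolding * by simp
        then obtain x where "x \<in> maxv 1 C" "w = coef 0 x" by (rule imageE)
        then show "\<exists>x\<in>H2s. norm (hk (extend \<Psi> C) x) = norm x \<and> coef 0 x = w"
          using E[of x] by auto
      qed
    next
      assume *: "toprow C ` maxv 1 C = UNIV"
      show "\<forall>w. \<exists>x\<in>H2s. norm (hk (extend \<Psi> C) x) = norm x \<and> coef (-1) (hk (extend \<Psi> C) x) = w"
      proof
        fix w
        have "w \<in> toprow C ` maxv 1 C" unfolding * by simp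
        then obtain x where "x \<in> maxv 1 C" "w = toprow C x" by (rule imageE)
        then show "\<exists>x\<in>H2s. norm (hk (extend \<Psi> C) x) = norm x \<and> coef (-1) (hk (extend \<Psi> C) x) = w"
          using E[of x] tr[of x] by auto
      qed
    qed
    have lin: "bounded_linear (\<lambda>x. hk (extend \<Psi> C) (Pp x))"
      by (intro bounded_linear_compose[OF bounded_linear_hk[OF Linf_extend[OF \<Psi>]] bounded_linear_Pp])
    have "norm (hk (extend \<Psi> C) (Pp x) - hk (extend \<Psi> C) (Pp y)) = norm (G C x - G C y)" for x y
      using eq[of C "x - y"] bl_diff[OF lin] by (simp add: G.diff)
    moreover have "ess_contracts \<theta> (G C)"
      unfolding G_def by (intro ess_contracts_Pair ess bl_toprow)
    ultimately show "ess_contracts \<theta> (\<lambda>x. hk (extend \<Psi> C) (Pp x))"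
      by (simp add: ess_contracts_def)
  qed
qed

section \<open>Nehari's theorem for matrix symbols\<close>

lemma subspace_closure:
  fixes S :: "'a::real_normed_vector set"
  assumes S: "subspace S" shows "subspace (closure S)"
proof (rule subspaceI)
  show "0 \<in> closure S" using subspace_0[OF S] closure_subset by blast
next
  fix x y assume "x \<in> closure S" "y \<in> closure S"
  then obtain u w where "\<And>n. u n \<in> S" "u \<longlonglongrightarrow> x" "\<And>n. w n \<in> S" "w \<longlonglongrightarrow> y"
    unfolding closure_sequential by blast
  then have "(\<forall>n. u n + w n \<in> S) \<and> (\<lambda>n. u n + w n) \<longlonglongrightarrow> x + y"
    by (auto intro: tendsto_add subspace_add[OF S])
  then show "x + y \<in> closure S" unfolding closure_sequential by (intro exI[of _ "\<lambda>n. u n + w n"])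
next
  fix c :: real and x assume "x \<in> closure S"
  then obtain u where "\<And>n. u n \<in> S" "u \<longlonglongrightarrow> x" unfolding closure_sequential by blast
  then have "(\<forall>n. c *\<^sub>R u n \<in> S) \<and> (\<lambda>n. c *\<^sub>R u n) \<longlonglongrightarrow> c *\<^sub>R x"
    by (auto intro: tendsto_scaleR subspace_scale[OF S])
  then show "c *\<^sub>R x \<in> closure S" unfolding closure_sequential by (intro exI[of _ "\<lambda>n. c *\<^sub>R u n"])
qed

text \<open>The remainder of the projection onto the closure is orthogonal to all monomials, hence
  zero by uniqueness of coefficients.\<close>

lemma closure_span_mon: "closure (span {mon j v | j v. True}) = (UNIV :: ('n::finite) lsq set)"
proof -
  let ?S = "span {mon j v | j v. True} :: 'n lsq set"
  have "x \<in> closure ?S" for x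
  proof -
    obtain p where p: "p \<in> closure ?S" "\<And>m. m \<in> closure ?S \<Longrightarrow> inner (x - p) m = 0"
      using hilbert_projection[OF subspace_closure[OF subspace_span] closed_closure, of "{mon j v | j v. True}" x] by blast
    have "mon j v \<in> closure ?S" for j v
      by (rule subsetD[OF closure_subset], rule span_base) auto
    then have "coef j (x - p) = 0" for j by (intro coef_eqI) (simp add: p(2))
    then have "x - p = 0" by (rule lsq_eq_0I)
    then show ?thesis using p(1) by simp
  qed
  then show ?thesis by auto
qed

text \<open>\<open>step_symbol \<Psi> k\<close> is \<open>z\<^sup>-\<^sup>k (\<Psi> + C\<^sub>0 + C\<^sub>1 z + \<dots> + C\<^sub>k\<^sub>-\<^sub>1 z\<^sup>k\<^sup>-\<^sup>1)\<close> for corners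
  \<open>C\<^sub>j\<close> provided by Parrott's theorem.\<close>

fun step_symbol :: "(real \<Rightarrow> complex^'n^'n) \<Rightarrow> nat \<Rightarrow> real \<Rightarrow> complex^'n^'n" where
  "step_symbol \<Psi> 0 = \<Psi>"
| "step_symbol \<Psi> (Suc k) = extend (step_symbol \<Psi> k)
     (SOME C. \<forall>x\<in>H2s. norm (hk (extend (step_symbol \<Psi> k) C) x) \<le> norm x)"

locale nehari =
  fixes \<Psi> :: "real \<Rightarrow> complex^'n^'n"
  assumes Linf_\<Psi>: "\<Psi> \<in> Linf" and hk_\<Psi>_le: "\<And>x. x \<in> H2s \<Longrightarrow> norm (hk \<Psi> x) \<le> norm x"
begin

abbreviation A :: "nat \<Rightarrow> real \<Rightarrow> complex^'n^'n" where "A \<equiv> step_symbol \<Psi>"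

lemma Linf_A: "A k \<in> Linf"
  by (induction k) (auto simp: Linf_\<Psi> Linf_extend)

lemma hk_A_le: "x \<in> H2s \<Longrightarrow> norm (hk (A k) x) \<le> norm x"
proof (induction k arbitrary: x)
  case (Suc k)
  have "\<exists>C. \<forall>x\<in>H2s. norm (hk (extend (A k) C) x) \<le> norm x"
    by (rule nehari_step[OF Linf_A Suc.IH])
  from someI_ex[OF this] show ?case using Suc.prems by simp
qed (simp add: hk_\<Psi>_le)

lemma coef_A_Suc:
  assumes "x \<in> H2s" "j < int k"
  shows "coef (j - int (Suc k)) (mult (A (Suc k)) x) = coef (j - int k) (mult (A k) x)"
proof -
  have "coef (j - int k) x = 0" using assms by (simp add: H2s_def)
  then show ?thesis by (simp add: mult_extend Linf_A coef_add coef_mult_const)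
qed

text \<open>The corner added when passing from k to k + 1 multiplies the coefficient of x at j - k,
  which vanishes for j < k. Coefficients once fixed are not altered by later steps.\<close>

lemma coef_A_stable:
  assumes "x \<in> H2s" "j < int k" "k \<le> m"
  shows "coef (j - int m) (mult (A m) x) = coef (j - int k) (mult (A k) x)"
  using assms(3)
proof (induction m rule: dec_induct)
  case (step m)
  then have "j < int m" using assms(2) by simp
  then show ?case using coef_A_Suc[OF assms(1), of j m] step.IH by simp
qed simp

text \<open>The shift is undone, so this is the truncation to indices below k of the function Z x
  constructed as a limit.\<close>

definition Zk :: "nat \<Rightarrow> 'n lsq \<Rightarrow> 'n lsq" where "Zk k x = sh (int k) (hk (A k) x)"

lemma coef_Zk: "coef j (Zk k x) = (if j < int k then coef (j - int k) (mult (A k) x) else 0)"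
  by (simp add: Zk_def hk_def coef_Pm)

text \<open>Both truncations agree below index k and the shorter one stops there, so the increment
  is orthogonal to it. Their squared norms increase and stay bounded, which makes the sequence
  Cauchy.\<close>

lemma Zk_orthogonal:
  assumes x: "x \<in> H2s" and "k \<le> m"
  shows "(norm (Zk m x))\<^sup>2 = (norm (Zk k x))\<^sup>2 + (norm (Zk m x - Zk k x))\<^sup>2"
proof -
  have "sh (- int k) (Zk m x - Zk k x) \<in> H2s"
    using coef_A_stable[OF x _ \<open>k \<le> m\<close>] \<open>k \<le> m\<close> by (auto simp: H2s_def coef_diff coef_Zk)
  moreover have "sh (- int k) (Zk k x) \<in> H2ms"
    by (simp add: Zk_def sh_sh hk_def)
  ultimately have "inner (sh (- int k) (Zk m x - Zk k x)) (sh (- int k) (Zk k x)) = 0"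
    by (rule H2s_orthogonal_H2ms)
  then have "inner (Zk k x) (Zk m x - Zk k x) = 0" by (simp add: inner_sh sh_sh inner_commute)
  then show ?thesis using norm_add_sq[of "Zk k x" "Zk m x - Zk k x"] by simp
qed

lemma Zk_le: "x \<in> H2s \<Longrightarrow> norm (Zk k x) \<le> norm x"
  by (simp add: Zk_def hk_A_le)

lemma Zk_convergent: assumes x: "x \<in> H2s" shows "convergent (\<lambda>k. Zk k x)"
proof -
  define a where "a k = (norm (Zk k x))\<^sup>2" for k
  have "incseq a"
  proof (rule incseq_SucI)
    show "a n \<le> a (Suc n)" for n using Zk_orthogonal[OF x, of n "Suc n"] by (simp add: a_def)
  qed
  moreover have "a k \<le> (norm x)\<^sup>2" for k unfolding a_def using Zk_le[OF x] by (intro power_mono) auto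
  ultimately have "Cauchy a" using incseq_convergent LIMSEQ_imp_Cauchy by metis
  have "Cauchy (\<lambda>k. Zk k x)"
  proof (rule metric_CauchyI)
    fix e :: real assume e: "e > 0"
    then obtain N where N: "\<And>m k. m \<ge> N \<Longrightarrow> k \<ge> N \<Longrightarrow> \<bar>a m - a k\<bar> < e\<^sup>2"
      using CauchyD[OF \<open>Cauchy a\<close>, of "e\<^sup>2"] by auto
    have main: "norm (Zk m x - Zk k x) < e" if "k \<ge> N" "m \<ge> k" for k m
    proof -
      have "(norm (Zk m x - Zk k x))\<^sup>2 = a m - a k" using Zk_orthogonal[OF x that(2)] by (simp add: a_def)
      also have "\<dots> < e\<^sup>2" using N[of m k] that by simp
      finally show ?thesis using e by (simp add: power_less_imp_less_base)
    qed
    show "\<exists>N. \<forall>m\<ge>N. \<forall>k\<ge>N. dist (Zk m x) (Zk k x) < e"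
    proof (intro exI[of _ N] allI impI)
      fix m k assume "m \<ge> N" "k \<ge> N"
      then show "dist (Zk m x) (Zk k x) < e"
        using main[of k m] main[of m k] by (cases "m \<ge> k") (auto simp: dist_norm norm_minus_commute)
    qed
  qed
  then show ?thesis by (rule Cauchy_convergent)
qed

section \<open>The limit operator and its symbol\<close>

definition Z :: "'n lsq \<Rightarrow> 'n lsq" where "Z x = lim (\<lambda>k. Zk k x)"

lemma Z_lim: "x \<in> H2s \<Longrightarrow> (\<lambda>k. Zk k x) \<longlonglongrightarrow> Z x"
  using Zk_convergent by (simp add: Z_def convergent_LIMSEQ_iff)

lemma Z_le: "x \<in> H2s \<Longrightarrow> norm (Z x) \<le> norm x"
  by (rule LIMSEQ_le_const2[OF tendsto_norm[OF Z_lim]]) (auto simp: Zk_le)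

lemma coef_Z:
  assumes x: "x \<in> H2s" and j: "j < int k"
  shows "coef j (Z x) = coef (j - int k) (mult (A k) x)"
proof (rule LIMSEQ_unique)
  show "(\<lambda>m. coef j (Zk m x)) \<longlonglongrightarrow> coef j (Z x)" by (intro coef_tendsto Z_lim x)
  show "(\<lambda>m. coef j (Zk m x)) \<longlonglongrightarrow> coef (j - int k) (mult (A k) x)"
  proof (rule tendsto_eventually)
    have "coef j (Zk m x) = coef (j - int k) (mult (A k) x)" if "m \<ge> k" for m
      using coef_A_stable[OF x j that] that j by (simp add: coef_Zk)
    then show "\<forall>\<^sub>F m in sequentially. coef j (Zk m x) = coef (j - int k) (mult (A k) x)"
      unfolding eventually_sequentially by blast
  qed
qed

lemma coef_Z_ex: "\<exists>k. \<forall>x\<in>H2s. coef j (Z x) = coef (j - int k) (mult (A k) x)"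
proof -
  have "j < int (Suc (nat \<bar>j\<bar>))" by simp
  then show ?thesis using coef_Z by blast
qed

lemma Z_add: "x \<in> H2s \<Longrightarrow> y \<in> H2s \<Longrightarrow> Z (x + y) = Z x + Z y"
proof (rule lsq_eqI)
  fix j assume xy: "x \<in> H2s" "y \<in> H2s"
  obtain k where k: "\<And>x. x \<in> H2s \<Longrightarrow> coef j (Z x) = coef (j - int k) (mult (A k) x)"
    using coef_Z_ex[of j] by blast
  show "coef j (Z (x + y)) = coef j (Z x + Z y)"
    using k[OF xy(1)] k[OF xy(2)] k[OF subspace_add[OF subspace_H2s xy]]
    by (simp add: coef_add mult_add Linf_A)
qed

lemma Z_scaleR: "x \<in> H2s \<Longrightarrow> Z (r *\<^sub>R x) = r *\<^sub>R Z x"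
proof (rule lsq_eqI)
  fix j assume x: "x \<in> H2s"
  obtain k where k: "\<And>x. x \<in> H2s \<Longrightarrow> coef j (Z x) = coef (j - int k) (mult (A k) x)"
    using coef_Z_ex[of j] by blast
  show "coef j (Z (r *\<^sub>R x)) = coef j (r *\<^sub>R Z x)"
    using k[OF x] k[OF subspace_scale[OF subspace_H2s x]]
    by (simp add: coef_scaleR mult_scaleR Linf_A)
qed

lemma Z_sh: assumes x: "x \<in> H2s" and m: "m \<ge> 0" shows "Z (sh m x) = sh m (Z x)"
proof (rule lsq_eqI)
  fix j
  define k where "k = nat \<bar>j\<bar> + nat \<bar>j - m\<bar> + 1"
  have jk: "j < int k" "j - m < int k" by (auto simp: k_def)
  show "coef j (Z (sh m x)) = coef j (sh m (Z x))"
    using coef_Z[OF sh_H2s[OF x m] jk(1)] coef_Z[OF x jk(2)]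
    by (simp add: mult_sh Linf_A algebra_simps)
qed

text \<open>An operator commuting with multiplication by z is determined by its values on constants;
  these supply the columns of its symbol.\<close>

definition F :: "real \<Rightarrow> complex^'n^'n" where
  "F t = (\<chi> i b. rep (Z (mon 0 (axis b 1))) t $ i)"

lemma F_measurable [measurable]: "F \<in> borel_measurable Tm"
  unfolding F_def by (intro measurable_vec_lambda measurable_vec_nth rep_measurable)

text \<open>Formulated pointwise because \<open>F\<close> is not yet known to be essentially
  bounded, so \<open>mult F\<close> cannot be used.\<close>

definition represents :: "'n lsq \<Rightarrow> bool" where
  "represents x \<longleftrightarrow> x \<in> H2s \<and> (AE t in Tm. F t *v rep x t = rep (Z x) t)"

lemma represents_mon0: "represents (mon 0 v)"
proof -
  have eq: "Z (mon 0 v) = lincomb v (\<lambda>b. Z (mon 0 (axis b 1)))"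
  proof (rule lsq_eqI)
    fix j
    obtain k where k: "\<And>x. x \<in> H2s \<Longrightarrow> coef j (Z x) = coef (j - int k) (mult (A k) x)"
      using coef_Z_ex[of j] by blast
    define M where "M = mcoef (A k) (j - int k)"
    have M: "coef j (Z (mon 0 w)) = M *v w" for w
      using k[OF mon_H2s, of 0 w] by (simp add: mcoef_mult Linf_A M_def)
    have "M *v v = (\<Sum>b\<in>UNIV. v $ b *s (M *v axis b 1))"
      by (simp add: vec_eq_iff matrix_vector_mult_def axis_def if_distrib mult.commute cong: if_cong)
    then show "coef j (Z (mon 0 v)) = coef j (lincomb v (\<lambda>b. Z (mon 0 (axis b 1))))"
      by (simp add: coef_lincomb M)
  qed
  have "AE t in Tm. F t *v rep (mon 0 v) t = rep (Z (mon 0 v)) t"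
    using rep_mon[of 0 v] rep_lincomb[of v "\<lambda>b. Z (mon 0 (axis b 1))", folded eq]
    by eventually_elim (simp add: F_def matrix_vector_mult_def vec_eq_iff mult.commute)
  then show ?thesis by (simp add: represents_def mon_H2s)
qed

lemma represents_sh: assumes x: "represents x" and m: "m \<ge> 0" shows "represents (sh m x)"
proof -
  have xH: "x \<in> H2s" and ae: "AE t in Tm. F t *v rep x t = rep (Z x) t" using x by (auto simp: represents_def)
  have "AE t in Tm. F t *v rep (sh m x) t = rep (Z (sh m x)) t"
    using ae rep_sh[of m x] rep_sh[of m "Z x", folded Z_sh[OF xH m]]
    by eventually_elim (simp add: vec.scale)
  then show ?thesis using xH m by (simp add: represents_def sh_H2s)
qed

lemma represents_combination:
  assumes x: "represents x" and y: "represents y" shows "represents (c *\<^sub>R x + y)"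
proof -
  have H: "x \<in> H2s" "y \<in> H2s" and ae: "AE t in Tm. F t *v rep x t = rep (Z x) t" "AE t in Tm. F t *v rep y t = rep (Z y) t"
    using x y by (auto simp: represents_def)
  have Hc: "c *\<^sub>R x \<in> H2s" by (rule subspace_scale[OF subspace_H2s H(1)])
  have ZZ: "Z (c *\<^sub>R x + y) = c *\<^sub>R Z x + Z y" by (simp add: Z_add Hc H Z_scaleR)
  have "AE t in Tm. F t *v rep (c *\<^sub>R x + y) t = rep (Z (c *\<^sub>R x + y)) t"
    unfolding ZZ using ae rep_add[of "c *\<^sub>R x" y] rep_scaleR[of c x] rep_add[of "c *\<^sub>R Z x" "Z y"] rep_scaleR[of c "Z x"]
    by eventually_elim (simp add: matrix_vector_right_distrib linear_scale[OF matrix_vector_mul_linear])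
  then show ?thesis by (simp add: represents_def subspace_add[OF subspace_H2s Hc H(2)])
qed

text \<open>A trigonometric polynomial becomes analytic after multiplication by a high power of z,
  and there the symbol is already known to act as \<open>Z\<close>.\<close>

lemma represents_trig:
  assumes "x \<in> span {mon j v | j v. True}" shows "\<exists>m\<ge>0. represents (sh m x)"
  using assms
proof (induction rule: span_induct_alt)
  case base
  have "represents (0 *\<^sub>R mon 0 0 + mon 0 0)" by (intro represents_combination represents_mon0)
  moreover have "mon 0 (0::complex^'n) = 0" by (rule lsq_eq_0I) (simp add: coef_mon)
  ultimately show ?case by (intro exI[of _ 0]) simp
next
  case (step c x y)
  obtain j v where x: "x = mon j v" using step by blast
  obtain m where m: "m \<ge> 0" "represents (sh m y)" using step by blast
  \<comment> \<open>This makes both k - m and k + j nonnegative, so the two summands share one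
    shift.\<close>
  define k where "k = m + \<bar>j\<bar>"
  have "represents (sh (k - m) (sh m y))" "represents (sh (k + j) (mon 0 v))"
    by (rule represents_sh, use m represents_mon0 in \<open>auto simp: k_def\<close>)+
  then have "represents (sh k y)" "represents (sh k x)" by (simp_all add: sh_sh sh_mon x)
  then have "represents (sh k (c *\<^sub>R x + y))"
    using represents_combination[of "sh k x" "sh k y" c] by (simp add: sh_add sh_scaleR)
  then show ?case using m by (intro exI[of _ k]) (simp add: k_def)
qed

lemma F_trig:
  assumes "x \<in> span {mon j v | j v. True}"
  shows "(\<lambda>t. F t *v rep x t) \<in> L2" "norm (cls (\<lambda>t. F t *v rep x t)) \<le> norm x"
proof -
  obtain m where m: "m \<ge> 0" "sh m x \<in> H2s" "AE t in Tm. F t *v rep (sh m x) t = rep (Z (sh m x)) t"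
    using represents_trig[OF assms] by (auto simp: represents_def)
  define y where "y = sh (- m) (Z (sh m x))"
  have ae: "AE t in Tm. rep y t = F t *v rep x t"
    unfolding y_def using m(3) rep_sh[of m x] rep_sh[of "- m" "Z (sh m x)"]
  proof eventually_elim
    case (elim t)
    have "rep (sh (- m) (Z (sh m x))) t = cis (of_int (- m) * t) *s (F t *v (cis (of_int m * t) *s rep x t))"
      using elim by simp
    also have "\<dots> = (cis (of_int (- m) * t) * cis (of_int m * t)) *s (F t *v rep x t)"
      by (simp add: vec.scale vector_smult_assoc)
    also have "cis (of_int (- m) * t) * cis (of_int m * t) = 1" by (simp add: cis_mult)
    finally show ?case by simp
  qed
  show L: "(\<lambda>t. F t *v rep x t) \<in> L2"
    by (rule L2_cong[OF rep_L2 _ ae]) measurable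
  have "cls (\<lambda>t. F t *v rep x t) = y"
    using cls_eq_iff[OF rep_L2[of y] L] ae by simp
  moreover have "norm y \<le> norm x" using Z_le[OF m(2)] by (simp add: y_def)
  ultimately show "norm (cls (\<lambda>t. F t *v rep x t)) \<le> norm x" by simp
qed

text \<open>Trigonometric polynomials are dense, and along an almost everywhere convergent
  subsequence Fatou's lemma carries the bound to every x. The slack e accounts for the norms of the
  approximants.\<close>

lemma F_contractive_L2: "(\<lambda>t. F t *v rep x t) \<in> L2" "norm (cls (\<lambda>t. F t *v rep x t)) \<le> norm x"
proof -
  have "x \<in> closure (span {mon j v | j v. True})" by (simp only: closure_span_mon UNIV_I)
  then obtain X where X: "\<And>k. X k \<in> span {mon j v | j v. True}" "X \<longlonglongrightarrow> x"
    unfolding closure_sequential by blast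
  have main: "(\<lambda>t. F t *v rep x t) \<in> L2 \<and> norm (cls (\<lambda>t. F t *v rep x t)) \<le> norm x + e" if e: "e > 0" for e
  proof -
    have "\<exists>N. \<forall>k\<ge>N. norm (X k - x) < e" using X(2) e by (intro LIMSEQ_D)
    then obtain N where N: "\<And>k. k \<ge> N \<Longrightarrow> norm (X k - x) < e" by blast
    have "(\<lambda>k. X (k + N)) \<longlonglongrightarrow> x" by (rule LIMSEQ_ignore_initial_segment[OF X(2)])
    then obtain r where r: "strict_mono (r::nat\<Rightarrow>nat)" "AE t in Tm. (\<lambda>k. rep (X (r k + N)) t) \<longlonglongrightarrow> rep x t"
      using lsq_limit_AE_subseq[of "\<lambda>k. X (k + N)" x] by blast
    have bound: "norm (cls (\<lambda>t. F t *v rep (X (r k + N)) t)) \<le> norm x + e" for k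
    proof -
      have "norm (cls (\<lambda>t. F t *v rep (X (r k + N)) t)) \<le> norm (X (r k + N))" by (rule F_trig[OF X(1)])
      also have "\<dots> \<le> norm x + norm (X (r k + N) - x)" by (rule norm_triangle_sub)
      finally show ?thesis using N[of "r k + N"] by simp
    qed
    have "AE t in Tm. (\<lambda>k. F t *v rep (X (r k + N)) t) \<longlonglongrightarrow> F t *v rep x t"
      using r(2) by eventually_elim (intro bounded_linear.tendsto[OF matrix_vector_mul_bounded_linear])
    moreover have "(\<lambda>t. F t *v rep x t) \<in> borel_measurable Tm" by measurable
    ultimately show ?thesis
      using L2_Fatou[of "\<lambda>k t. F t *v rep (X (r k + N)) t" "norm x + e" "\<lambda>t. F t *v rep x t"] F_trig(1)[OF X(1)] bound
      by blast
  qed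
  show "(\<lambda>t. F t *v rep x t) \<in> L2" using main[of 1] by simp
  show "norm (cls (\<lambda>t. F t *v rep x t)) \<le> norm x" by (rule field_le_epsilon) (use main in blast)
qed

text \<open>Testing with v times the indicator of the set where the inequality fails shows that this
  set is null.\<close>

lemma F_contractive_vector: "AE t in Tm. norm (F t *v v) \<le> norm v"
proof -
  define S where "S = {t \<in> space Tm. norm (F t *v v) > norm v}"
  have [measurable]: "S \<in> sets Tm" unfolding S_def by measurable
  define f where "f t = indicator S t *\<^sub>R v" for t
  have fL: "f \<in> L2"
  proof (rule L2_bound[OF _ L2_mon[of 0 v], of _ 1])
    show "f \<in> borel_measurable Tm" unfolding f_def by measurable
    show "AE t in Tm. norm (f t) \<le> 1 * norm (cis (of_int 0 * t) *s v)"
      by (auto simp: f_def indicator_def)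
  qed
  let ?x = "cls f"
  have ae: "AE t in Tm. F t *v rep ?x t = F t *v f t" using rep_cls[OF fL] by eventually_elim simp
  have FL: "(\<lambda>t. F t *v f t) \<in> L2"
  proof (rule L2_cong[OF F_contractive_L2(1)[of ?x] _ ae])
    show "(\<lambda>t. F t *v f t) \<in> borel_measurable Tm" using L2_measurable[OF fL] by measurable
  qed
  have "cls (\<lambda>t. F t *v rep ?x t) = cls (\<lambda>t. F t *v f t)"
    using cls_eq_iff[OF F_contractive_L2(1)[of ?x] FL] ae by simp
  then have "L2norm (\<lambda>t. F t *v f t) \<le> L2norm f"
    using F_contractive_L2(2)[of ?x] norm_cls[OF FL] norm_cls[OF fL] by simp
  then have "(LINT t|Tm. (norm (F t *v f t))\<^sup>2) \<le> (LINT t|Tm. (norm (f t))\<^sup>2)"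
    by (simp add: L2norm_def divide_le_cancel)
  moreover have i: "integrable Tm (\<lambda>t. (norm (F t *v f t))\<^sup>2)" "integrable Tm (\<lambda>t. (norm (f t))\<^sup>2)"
    using FL fL by (auto simp: L2_def)
  ultimately have le: "(LINT t|Tm. (norm (F t *v f t))\<^sup>2 - (norm (f t))\<^sup>2) \<le> 0" by simp
  have ptw: "0 \<le> (norm (F t *v f t))\<^sup>2 - (norm (f t))\<^sup>2" for t
    by (cases "t \<in> S") (auto simp: f_def S_def intro!: power_mono)
  have "(LINT t|Tm. (norm (F t *v f t))\<^sup>2 - (norm (f t))\<^sup>2) = 0"
    by (rule antisym[OF le integral_nonneg_AE]) (intro AE_I2 ptw)
  then have "AE t in Tm. (norm (F t *v f t))\<^sup>2 - (norm (f t))\<^sup>2 = 0"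
    by (rule integral_nonneg_eq_0_iff_AE[THEN iffD1, rotated 2])
      (intro Bochner_Integration.integrable_diff i AE_I2 ptw)+
  then show ?thesis
    using AE_space
  proof eventually_elim
    case (elim t)
    show ?case
    proof (rule ccontr)
      assume "\<not> norm (F t *v v) \<le> norm v"
      then have "t \<in> S" "(norm (F t *v v))\<^sup>2 > (norm v)\<^sup>2" using elim(2) by (auto simp: S_def intro!: power_strict_mono)
      then show False using elim(1) by (simp add: f_def)
    qed
  qed
qed

text \<open>The exceptional null set depends on v, so the quantifiers are exchanged over a countable
  dense set and the inequality is extended by continuity.\<close>

lemma F_contractive: "AE t in Tm. \<forall>v. norm (F t *v v) \<le> norm v"
proof -
  obtain D :: "(complex^'n) set" where D: "countable D" "\<And>U. open U \<Longrightarrow> U \<noteq> {} \<Longrightarrow> \<exists>d\<in>D. d \<in> U"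
    using countable_dense_setE by blast
  have "AE t in Tm. \<forall>v\<in>D. norm (F t *v v) \<le> norm v"
    using D(1) F_contractive_vector by (simp add: AE_ball_countable)
  then show ?thesis
  proof eventually_elim
    case (elim t)
    have cl: "closed {v. norm (F t *v v) \<le> norm v}"
      by (intro closed_Collect_le continuous_intros bounded_linear.continuous_on[OF matrix_vector_mul_bounded_linear])
    have "- {v. norm (F t *v v) \<le> norm v} = {}"
      using D(2)[of "- {v. norm (F t *v v) \<le> norm v}"] cl elim by (auto simp: open_closed)
    then show ?case by auto
  qed
qed

lemma Linf_F: "F \<in> Linf"
proof (rule LinfI)
  show "AE t in Tm. norm (F t) \<le> real CARD('n) * (real CARD('n) * 1)"
    using F_contractive by eventually_elim (rule norm_matrix_le_of_contractive, simp)
qed measurable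

lemma mcoef_F: assumes "j < 0" shows "mcoef F j = mcoef \<Psi> j"
proof -
  have "mcoef F j *v v = mcoef \<Psi> j *v v" for v
  proof -
    have "AE t in Tm. rep (mult F (mon 0 v)) t = rep (Z (mon 0 v)) t"
      using rep_mult[OF Linf_F, of "mon 0 v"] represents_mon0[of v, unfolded represents_def, THEN conjunct2]
      by eventually_elim simp
    then have "mult F (mon 0 v) = Z (mon 0 v)" by (simp add: lsq_eq_iff)
    then have "coef j (mult F (mon 0 v)) = coef j (mult \<Psi> (mon 0 v))"
      using coef_Z[OF mon_H2s[of 0 v], of j 0] assms by simp
    then show ?thesis using mcoef_mult[OF Linf_F, of j 0 v] mcoef_mult[OF Linf_\<Psi>, of j 0 v] by simp
  qed
  then show ?thesis by (simp add: matrix_eq)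
qed

end

theorem nehari_theorem:
  assumes "\<Psi> \<in> Linf" "\<And>x. x \<in> H2s \<Longrightarrow> norm (hk \<Psi> x) \<le> norm x"
  obtains F where "F \<in> Linf" "AE t in Tm. \<forall>v. norm (F t *v v) \<le> norm v"
    "\<And>j. j < 0 \<Longrightarrow> mcoef F j = mcoef \<Psi> j"
proof -
  interpret nehari \<Psi> by unfold_locales (use assms in auto)
  from that[OF Linf_F F_contractive mcoef_F] show thesis by blast
qed

section \<open>Unitary extensions\<close>

text \<open>The row x(t)^* is divided by 1 + |x(t)| to become bounded and repeated to become square.
  In this form an orthogonality statement about x falls under the annihilator theorem for bounded
  square symbols.\<close>

lemma normalized_row_Linf:
  "(\<lambda>t. \<chi> i j. cnj (rep x t $ j) / of_real (1 + norm (rep x t)) :: complex^'n^'n) \<in> Linf"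
proof (rule LinfI)
  have [measurable]: "(\<lambda>t. cnj (rep x t $ j)) \<in> borel_measurable Tm" for j
    by (intro cnj_measurable measurable_vec_nth rep_measurable)
  show "(\<lambda>t. \<chi> i j. cnj (rep x t $ j) / of_real (1 + norm (rep x t)) :: complex^'n^'n) \<in> borel_measurable Tm"
    by (intro measurable_vec_lambda) measurable
  show "AE t in Tm. norm (\<chi> i j. cnj (rep x t $ j) / of_real (1 + norm (rep x t)) :: complex^'n^'n)
      \<le> real CARD('n) * (real CARD('n) * 1)"
  proof (rule AE_I2)
    fix t
    let ?M = "\<chi> i j. cnj (rep x t $ j) / of_real (1 + norm (rep x t)) :: complex^'n^'n"
    have e: "norm (?M $ i $ j) \<le> 1" for i j
    proof -
      have "norm (rep x t $ j) \<le> 1 + norm (rep x t)"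
        using Finite_Cartesian_Product.norm_nth_le[of "rep x t" j] by simp
      moreover have "norm (complex_of_real (1 + norm (rep x t))) = 1 + norm (rep x t)"
        by (simp only: norm_of_real) simp
      ultimately show ?thesis by (simp add: norm_divide pos_divide_le_eq add_pos_nonneg del: of_real_add)
    qed
    have "norm ?M \<le> (\<Sum>i\<in>UNIV. norm (?M $ i))"
      unfolding norm_vec_def[of ?M] by (rule L2_set_le_sum) auto
    also have "\<dots> \<le> (\<Sum>i\<in>(UNIV::'n set). \<Sum>j\<in>(UNIV::'n set). 1)"
    proof (rule sum_mono)
      fix i
      have "norm (?M $ i) \<le> (\<Sum>j\<in>UNIV. norm (?M $ i $ j))"
        unfolding norm_vec_def[of "?M $ i"] by (rule L2_set_le_sum) auto
      also have "\<dots> \<le> (\<Sum>j\<in>(UNIV::'n set). 1)" by (rule sum_mono) (rule e)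
      finally show "norm (?M $ i) \<le> (\<Sum>j\<in>(UNIV::'n set). 1)" .
    qed
    finally show "norm ?M \<le> real CARD('n) * (real CARD('n) * 1)" by simp
  qed
qed

lemma zero_if_normalized_row_zero:
  assumes "AE t in Tm. (\<chi> i j. cnj (rep x t $ j) / of_real (1 + norm (rep x t)) :: complex^'n^'n) = 0"
  shows "x = 0"
proof -
  have "AE t in Tm. rep x t = rep 0 t"
    using assms rep_zero[where ?'a='n]
  proof eventually_elim
    case (elim t)
    have "1 + norm (rep x t) > 0" by (simp add: add_pos_nonneg)
    then have ne: "complex_of_real (1 + norm (rep x t)) \<noteq> 0" by (metis less_irrefl of_real_eq_0_iff)
    have "cnj (rep x t $ j) / of_real (1 + norm (rep x t)) = 0" for j
      using elim(1) by (simp only: vec_eq_iff vec_lambda_beta zero_index)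
    then have "rep x t $ j = 0" for j using ne by (simp del: of_real_add)
    then show ?case using elim(2) by (simp add: vec_eq_iff)
  qed
  then show ?thesis by (simp add: lsq_eq_iff)
qed

lemma mult_normalized_row:
  assumes "AE t in Tm. cip f x t = 0"
  shows "mult (\<lambda>t. \<chi> i j. cnj (rep x t $ j) / of_real (1 + norm (rep x t))) f = 0"
proof -
  have "AE t in Tm. rep (mult (\<lambda>t. \<chi> i j. cnj (rep x t $ j) / of_real (1 + norm (rep x t))) f) t = rep 0 t"
    using assms rep_mult[OF normalized_row_Linf, of x f] rep_zero[where ?'a='a]
  proof eventually_elim
    case (elim t)
    have "(\<Sum>j\<in>UNIV. cnj (rep x t $ j) / of_real (1 + norm (rep x t)) * rep f t $ j)
        = cip f x t / of_real (1 + norm (rep x t))"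
      unfolding cip_def sum_divide_distrib by (intro sum.cong refl) simp
    then show ?case using elim by (simp add: matrix_vector_mult_def vec_eq_iff del: of_real_add)
  qed
  then show ?thesis by (simp add: lsq_eq_iff)
qed

lemma orthogonal_to_spanning_zero:
  fixes x :: "('n::finite) lsq"
  assumes "\<And>b. f b \<in> H2s" "\<And>b. coef 0 (f b) = axis b 1" "\<And>b. AE t in Tm. cip (f b) x t = 0"
  shows "x = 0"
proof (rule zero_if_normalized_row_zero, rule annihilator_zero[OF normalized_row_Linf, of f])
qed (rule assms mult_normalized_row[OF assms(3)])+

lemma orthogonal_to_spanning_minus_zero:
  fixes x :: "('n::finite) lsq"
  assumes "\<And>b. g b \<in> H2ms" "\<And>b. coef (-1) (g b) = axis b 1" "\<And>b. AE t in Tm. cip (g b) x t = 0"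
  shows "x = 0"
proof (rule zero_if_normalized_row_zero, rule annihilator_zero_minus[OF normalized_row_Linf, of g])
qed (rule assms mult_normalized_row[OF assms(3)])+

section \<open>Unitary-valued symbols\<close>

lemma norm_unitary: assumes "unitary_mat U" shows "norm (U *v x) = norm x"
proof -
  have "(norm (U *v x))\<^sup>2 = inner x (cadj U *v (U *v x))" by (simp add: power2_norm_eq_inner inner_cadj)
  also have "\<dots> = (norm x)\<^sup>2"
    using assms by (simp add: unitary_mat_def matrix_vector_mul_assoc power2_norm_eq_inner)
  finally show ?thesis by simp
qed

lemma cadj_cadj [simp]: "cadj (cadj A) = A" by (simp add: cadj_def vec_eq_iff)

lemma unitary_cadj: "unitary_mat U \<Longrightarrow> unitary_mat (cadj U)" by (simp add: unitary_mat_def)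

lemma norm_mult_unitary:
  assumes "U \<in> Linf" "AE t in Tm. unitary_mat (U t)" shows "norm (mult U x) = norm x"
  by (rule norm_eq_AE) (use assms(2) rep_mult[OF assms(1), of x] in \<open>eventually_elim, simp add: norm_unitary\<close>)

lemma mult_unitary_cancel:
  assumes "U \<in> Linf" "AE t in Tm. unitary_mat (U t)"
  shows "mult U (mult (\<lambda>t. cadj (U t)) x) = x"
proof -
  have "AE t in Tm. rep (mult U (mult (\<lambda>t. cadj (U t)) x)) t = rep x t"
    using assms(2) rep_mult[OF assms(1), of "mult (\<lambda>t. cadj (U t)) x"] rep_mult[OF Linf_cadj[OF assms(1)], of x]
    by eventually_elim (simp add: matrix_vector_mul_assoc unitary_mat_def)
  then show ?thesis by (simp add: lsq_eq_iff)
qed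

text \<open>If \<open>F\<close> is unitary-valued with \<open>\<parallel>H\<^sub>F\<parallel>\<^sub>e < 1\<close> and \<open>T\<^sub>F\<^sup>*\<close> is injective, then the Toeplitz operator \<open>T\<^sub>F\<close>
  has closed dense range, so that \<open>T\<^sub>F\<^sup>*\<close> is bounded below.\<close>

lemma hk_cadj_contractive:
  fixes F :: "real \<Rightarrow> complex^'n^'n"
  assumes F: "F \<in> Linf" "AE t in Tm. unitary_mat (F t)"
    and ess: "ess_contracts \<theta> (\<lambda>x. hk F (Pp x))" "0 \<le> \<theta>" "\<theta> < 1"
    and inj: "\<And>g. g \<in> H2s \<Longrightarrow> mult (\<lambda>t. cadj (F t)) g \<in> H2ms \<Longrightarrow> g = 0"
  obtains \<gamma> where "0 \<le> \<gamma>" "\<gamma> < 1" "\<And>g. g \<in> H2s \<Longrightarrow> norm (hk (\<lambda>t. cadj (F t)) g) \<le> \<gamma> * norm g"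
proof -
  let ?F' = "\<lambda>t. cadj (F t)"
  have F': "?F' \<in> Linf" "AE t in Tm. unitary_mat (?F' t)"
    using F unitary_cadj by (auto intro: Linf_cadj elim: eventually_mono)
  define G where "G x = hk F (Pp x)" for x
  define T where "T x = Pp (mult F x)" for x
  have blG: "bounded_linear G"
    unfolding G_def by (intro bounded_linear_compose[OF bounded_linear_hk[OF F(1)] bounded_linear_Pp])
  have blT: "bounded_linear T"
    unfolding T_def by (intro bounded_linear_compose[OF bounded_linear_Pp bounded_linear_mult[OF F(1)]])
  \<comment> \<open>A unitary symbol splits the squared norm exactly between its Hankel and its
    Toeplitz part, so an upper bound for one is a lower bound for the other.\<close>
  have pyth: "(norm x)\<^sup>2 = (norm (hk F x))\<^sup>2 + (norm (T x))\<^sup>2" for x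
    using norm_Pm_Pp[of "mult F x"] by (simp add: norm_mult_unitary[OF F] hk_def T_def)
  have hk_le: "norm (hk F x) \<le> norm x" for x
    by (rule power2_le_imp_le) (simp_all add: pyth[of x])
  have G_le: "norm (G x) \<le> norm (Pp x)" for x by (simp add: G_def hk_le)
  have G_le': "norm (G x) \<le> norm x" for x using G_le[of x] norm_Pp_le[of x] by simp
  define E where "E = {x. norm (G x) = 1 * norm x}"
  have subE: "subspace E" unfolding E_def by (rule subspace_maximising_vectors[OF blG]) (auto simp: G_le')
  have clE: "closed E" unfolding E_def by (rule closed_maximising_vectors[OF blG])
  \<comment> \<open>Vectors on which the Hankel operator is isometric lie in the kernel of the
    Toeplitz operator. On their orthogonal complement \<open>X\<close> in \<open>H2s\<close> the gap
    \<gamma> bounds \<open>T\<close> below by c.\<close>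
  have EH: "e \<in> H2s \<and> T e = 0" if "e \<in> E" for e
  proof -
    have "(norm e)\<^sup>2 \<le> (norm (Pp e))\<^sup>2" using that G_le[of e] by (intro power_mono) (auto simp: E_def)
    then have "norm (Pm e) = 0" using norm_Pm_Pp[of e] by simp
    then have Pe: "Pp e = e" by (simp add: Pp_def)
    then have "norm (hk F e) = norm e" using that by (simp add: E_def G_def)
    then have "T e = 0" using pyth[of e] by simp
    then show ?thesis using Pe Pp_H2s[of e] by simp
  qed
  obtain \<gamma> where \<gamma>: "0 \<le> \<gamma>" "\<gamma> < 1"
    "\<And>d. (\<And>e. norm (G e) = norm e \<Longrightarrow> inner d e = 0) \<Longrightarrow> norm (G d) \<le> \<gamma> * norm d"
    using gap_orthogonal_to_maximising_vectors[OF blG G_le' ess(1)[folded G_def] ess(2,3)] by blast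
  define X where "X = H2s \<inter> {d. \<forall>e\<in>E. inner d e = 0}"
  define c where "c = sqrt (1 - \<gamma>\<^sup>2)"
  have g1: "\<gamma>\<^sup>2 < 1" using \<gamma> by (simp add: abs_square_less_1)
  then have c: "c > 0" "c\<^sup>2 = 1 - \<gamma>\<^sup>2" by (auto simp: c_def)
  have subX: "subspace X"
    unfolding X_def by (intro subspace_inter subspace_H2s) (auto simp: subspace_def inner_add_left)
  have clX: "closed X"
  proof -
    have "X = H2s \<inter> (\<Inter>e\<in>E. {d. inner d e = 0})" by (auto simp: X_def)
    then show ?thesis by (simp add: closed_Int closed_H2s closed_INT closed_Collect_eq continuous_intros)
  qed
  have cg: "(c * norm d)\<^sup>2 = (norm d)\<^sup>2 - (\<gamma> * norm d)\<^sup>2" for d :: "'n lsq"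
    by (simp add: power_mult_distrib c(2) left_diff_distrib)
  have below: "norm (T d) \<ge> c * norm d" if d: "d \<in> X" for d
  proof (rule power2_le_imp_le)
    have "norm (G d) \<le> \<gamma> * norm d" using d by (intro \<gamma>(3)) (auto simp: X_def E_def)
    then have "(norm (hk F d))\<^sup>2 \<le> (\<gamma> * norm d)\<^sup>2" using d by (intro power_mono) (auto simp: G_def X_def Pp_id)
    then show "(c * norm d)\<^sup>2 \<le> (norm (T d))\<^sup>2"
      using pyth[of d] cg[of d] by linarith
  qed simp
  have clR: "closed (T ` X)"
    using complete_isometric_image[OF c(1) subX blT] below clX by (simp add: complete_eq_closed)
  have subR: "subspace (T ` X)" by (rule linear_subspace_image[OF bounded_linear.linear[OF blT] subX])
  have surj: "\<exists>d\<in>X. g = T d" if g: "g \<in> H2s" for g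
  proof -
    obtain r where r: "r \<in> T ` X" "\<And>m. m \<in> T ` X \<Longrightarrow> inner (g - r) m = 0"
      using hilbert_projection[OF subR clR] by blast
    define u where "u = g - r"
    have uH: "u \<in> H2s" unfolding u_def using r(1) g by (intro subspace_diff[OF subspace_H2s]) (auto simp: T_def)
    \<comment> \<open>u is known to be orthogonal only to the image of \<open>X\<close>; subtracting
      the projection of y onto \<open>E\<close> does not change T y and lands in
      \<open>X\<close>.\<close>
    have uT: "inner u (T y) = 0" if y: "y \<in> H2s" for y
    proof -
      obtain e where e: "e \<in> E" "\<And>m. m \<in> E \<Longrightarrow> inner (y - e) m = 0"
        using hilbert_projection[OF subE clE] by blast
      have "y - e \<in> X" using e EH[OF e(1)] y subspace_diff[OF subspace_H2s, of y e] by (auto simp: X_def)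
      moreover have "T y = T (y - e)" using EH[OF e(1)] by (simp add: bl_diff[OF blT])
      ultimately show ?thesis using r(2) by (auto simp: u_def)
    qed
    have "inner (mult ?F' u) y = 0" if y: "y \<in> H2s" for y
    proof -
      have "inner (mult ?F' u) y = inner (mult F y) u"
        by (subst inner_commute) (simp add: inner_mult[OF F(1)])
      also have "\<dots> = inner (T y) u" unfolding T_def by (rule inner_Pp_H2s[OF uH, symmetric])
      finally show ?thesis using uT[OF y] by (simp add: inner_commute)
    qed
    then have "coef j (mult ?F' u) = 0" if "j \<ge> 0" for j
      using that by (intro coef_eqI) (simp add: mon_H2s)
    then have "mult ?F' u \<in> H2ms" by (simp add: H2ms_def)
    then have "u = 0" by (rule inj[OF uH])
    then show ?thesis using r(1) by (auto simp: u_def)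
  qed
  show thesis
  proof (rule that[OF \<gamma>(1,2)])
    fix g :: "'n lsq" assume g: "g \<in> H2s"
    obtain d where d: "d \<in> X" "g = T d" using surj[OF g] by blast
    let ?p = "Pp (mult ?F' g)"
    \<comment> \<open>Duality: solving T d = g with c |d| \<le> |g| bounds the adjoint Toeplitz
      operator, g to \<open>?p\<close>, below by c. By the splitting for the adjoint symbol its
      Hankel operator is bounded by \<gamma>.\<close>
    have "(norm g)\<^sup>2 = inner (T d) g" using d by (simp add: power2_norm_eq_inner)
    also have "\<dots> = inner (mult F d) g" unfolding T_def by (rule inner_Pp_H2s[OF g])
    also have "\<dots> = inner d (mult ?F' g)" by (rule inner_mult[OF F(1)])
    also have "\<dots> = inner ?p d"
      using inner_Pp_H2s[of d "mult ?F' g"] d(1) by (simp add: X_def inner_commute[of d])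
    also have "\<dots> \<le> norm ?p * norm d" by (rule norm_cauchy_schwarz)
    finally have "c * (norm g)\<^sup>2 \<le> norm ?p * (c * norm d)" using c(1) by (simp add: mult_ac)
    also have "\<dots> \<le> norm ?p * norm g" using below[OF d(1)] d(2) by (intro mult_left_mono) auto
    finally have "norm g * (c * norm g) \<le> norm g * norm ?p" by (simp add: power2_eq_square mult_ac)
    then have "c * norm g \<le> norm ?p" by (cases "g = 0") auto
    then have "(c * norm g)\<^sup>2 \<le> (norm ?p)\<^sup>2" using c by (intro power_mono) auto
    moreover have "(norm g)\<^sup>2 = (norm (hk ?F' g))\<^sup>2 + (norm ?p)\<^sup>2"
      using norm_Pm_Pp[of "mult ?F' g"] by (simp add: norm_mult_unitary[OF F'] hk_def)
    ultimately have "(norm (hk ?F' g))\<^sup>2 \<le> (\<gamma> * norm g)\<^sup>2" using cg[of g] by linarith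
    then show "norm (hk ?F' g) \<le> \<gamma> * norm g" by (rule power2_le_imp_le) (use \<gamma> in simp)
  qed
qed

theorem unitary_extension:
  fixes \<Psi> :: "real \<Rightarrow> complex^'n^'n"
  assumes \<Psi>: "\<Psi> \<in> Linf" and le: "\<And>x. x \<in> H2s \<Longrightarrow> norm (hk \<Psi> x) \<le> norm x"
    and ess: "ess_contracts \<theta> (\<lambda>x. hk \<Psi> (Pp x))" "0 \<le> \<theta>" "\<theta> < 1"
  obtains C F \<gamma> where "F \<in> Linf" "AE t in Tm. unitary_mat (F t)"
    "\<And>j. j < 0 \<Longrightarrow> mcoef F j = mcoef (extend \<Psi> C) j"
    "0 \<le> \<gamma>" "\<gamma> < 1" "\<And>x. x \<in> H2s \<Longrightarrow> norm (hk (\<lambda>t. cadj (F t)) x) \<le> \<gamma> * norm x"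
proof -
  obtain C where leA: "\<And>x. x \<in> H2s \<Longrightarrow> norm (hk (extend \<Psi> C) x) \<le> norm x"
    and alt: "(\<forall>w. \<exists>x\<in>H2s. norm (hk (extend \<Psi> C) x) = norm x \<and> coef 0 x = w) \<or>
     (\<forall>w. \<exists>x\<in>H2s. norm (hk (extend \<Psi> C) x) = norm x \<and> coef (-1) (hk (extend \<Psi> C) x) = w)"
    and essA: "ess_contracts \<theta> (\<lambda>x. hk (extend \<Psi> C) (Pp x))"
    using extremal_extension[OF \<Psi> le ess] by blast
  let ?A = "extend \<Psi> C"
  have A: "?A \<in> Linf" by (rule Linf_extend[OF \<Psi>])
  obtain F where F: "F \<in> Linf" and contr: "AE t in Tm. \<forall>v. norm (F t *v v) \<le> norm v"
    and co: "\<And>j. j < 0 \<Longrightarrow> mcoef F j = mcoef ?A j"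
    using nehari_theorem[OF A leA] by blast
  let ?F' = "\<lambda>t. cadj (F t)"
  have F': "?F' \<in> Linf" by (rule Linf_cadj[OF F])
  have hkF: "hk F x = hk ?A x" if "x \<in> H2s" for x by (rule hk_cong[OF F A co that])
  have nF: "norm (mult F x) \<le> norm x" for x by (rule norm_mult_contractive[OF F contr])
  have nF': "norm (mult ?F' y) \<le> norm y" for y
  proof -
    have "(norm (mult ?F' y))\<^sup>2 = inner (mult F (mult ?F' y)) y"
      by (simp add: inner_mult[OF F] power2_norm_eq_inner)
    also have "\<dots> \<le> norm (mult F (mult ?F' y)) * norm y" by (rule norm_cauchy_schwarz)
    also have "\<dots> \<le> norm (mult ?F' y) * norm y" by (intro mult_right_mono nF) auto
    finally show ?thesis by (cases "mult ?F' y = 0") (auto simp: power2_eq_square)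
  qed
  \<comment> \<open>The antianalytic part of F x already has the norm of x, so contractivity leaves
    nothing for the analytic part. Equality in norm then forces F^* F x = x.\<close>
  have max: "mult F x = hk ?A x \<and> mult ?F' (mult F x) = x"
    if x: "x \<in> H2s" "norm (hk ?A x) = norm x" for x
  proof
    have "(norm (mult F x))\<^sup>2 = (norm x)\<^sup>2 + (norm (Pp (mult F x)))\<^sup>2"
      using norm_Pm_Pp[of "mult F x"] hkF[OF x(1)] x(2) by (simp add: hk_def)
    moreover have "(norm (mult F x))\<^sup>2 \<le> (norm x)\<^sup>2" using nF by (intro power_mono) auto
    ultimately have P0: "Pp (mult F x) = 0" and n: "(norm (mult F x))\<^sup>2 = (norm x)\<^sup>2" by auto
    then show "mult F x = hk ?A x" using hkF[OF x(1)] by (simp add: Pp_def hk_def)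
    have "(norm (mult ?F' (mult F x) + (-1) *\<^sub>R x))\<^sup>2
        = (norm (mult ?F' (mult F x)))\<^sup>2 - 2 * inner (mult ?F' (mult F x)) x + (norm x)\<^sup>2"
      by (subst norm_add_sq) simp
    also have "inner (mult ?F' (mult F x)) x = (norm (mult F x))\<^sup>2"
      by (subst inner_commute) (simp add: inner_mult[OF F, symmetric] power2_norm_eq_inner)
    also have "(norm (mult ?F' (mult F x)))\<^sup>2 \<le> (norm (mult F x))\<^sup>2" using nF' by (intro power_mono) auto
    finally have "(norm (mult ?F' (mult F x) - x))\<^sup>2 \<le> 0" using n by simp
    then show "mult ?F' (mult F x) = x" by simp
  qed
  obtain f where fH: "\<And>b. f b \<in> H2s" and fmax: "\<And>b. norm (hk ?A (f b)) = norm (f b)"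
    and fspan: "(\<forall>b. coef 0 (f b) = axis b 1) \<or> (\<forall>b. coef (-1) (hk ?A (f b)) = axis b 1)"
  proof -
    note intro = that
    \<comment> \<open>The functional \<open>q\<close> stands for either of the two coefficients, so
      both alternatives share one choice of vectors.\<close>
    have ch: thesis
      if all: "\<forall>w. \<exists>x\<in>H2s. norm (hk ?A x) = norm x \<and> q x = w"
        and P: "\<And>f. (\<forall>b. q (f b) = axis b 1) \<Longrightarrow>
          (\<forall>b. coef 0 (f b) = axis b 1) \<or> (\<forall>b. coef (-1) (hk ?A (f b)) = axis b 1)"
      for q :: "'n lsq \<Rightarrow> complex^'n"
    proof -
      have "\<forall>b. \<exists>x. x \<in> H2s \<and> norm (hk ?A x) = norm x \<and> q x = axis b 1" using all by blast
      from choice[OF this] obtain f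
        where "\<forall>b. f b \<in> H2s \<and> norm (hk ?A (f b)) = norm (f b) \<and> q (f b) = axis b 1" ..
      then show thesis using intro[of f] P[of f] by simp
    qed
    from alt show thesis
    proof
      assume "\<forall>w. \<exists>x\<in>H2s. norm (hk ?A x) = norm x \<and> coef 0 x = w"
      then show thesis by (rule ch) simp
    next
      assume "\<forall>w. \<exists>x\<in>H2s. norm (hk ?A x) = norm x \<and> coef (-1) (hk ?A x) = w"
      then show thesis by (rule ch) simp
    qed
  qed
  define g where "g b = mult F (f b)" for b
  have g: "g b = hk ?A (f b)" "mult ?F' (g b) = f b" "g b \<in> H2ms" for b
    using max[OF fH fmax, of b] by (auto simp: g_def hk_def)
  have uni: "AE t in Tm. unitary_mat (F t)"
  proof -
    have l: "mult (\<lambda>t. ?F' t ** F t - mat 1) (f b) = 0" for b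
      using g(2)[of b] by (simp add: mult_diff_left Linf_mult F F' mult_mult[symmetric] mult_one g_def)
    have r: "mult (\<lambda>t. F t ** ?F' t - mat 1) (g b) = 0" for b
      using g(2)[of b] by (simp add: mult_diff_left Linf_mult F F' mult_mult[symmetric] mult_one g_def)
    \<comment> \<open>When the values f(0) form a basis, the annihilator theorem applies to F^* F -
      1; when the first coefficients of the g do, its antianalytic form applies to F F^* - 1. For
      square matrices each identity implies the other.\<close>
    have "AE t in Tm. ?F' t ** F t - mat 1 = 0 \<or> F t ** ?F' t - mat 1 = 0"
    proof (cases "\<forall>b. coef 0 (f b) = axis b 1")
      case True
      have "AE t in Tm. ?F' t ** F t - mat 1 = 0"
        using True by (intro annihilator_zero[of _ f] Linf_diff Linf_mult F F' Linf_const fH l) auto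
      then show ?thesis by eventually_elim simp
    next
      case False
      then have s: "coef (-1) (g b) = axis b 1" for b using fspan g(1) by metis
      have "AE t in Tm. F t ** ?F' t - mat 1 = 0"
        by (intro annihilator_zero_minus[of _ g] Linf_diff Linf_mult F F' Linf_const g r s)
      then show ?thesis by eventually_elim simp
    qed
    then show ?thesis
      by eventually_elim (auto simp: unitary_mat_def matrix_left_right_inverse)
  qed
  have inj: "u = 0" if u: "u \<in> H2s" "mult ?F' u \<in> H2ms" for u
  proof -
    define h where "h = mult ?F' u"
    have FF: "inner (f b) (sh j (mult ?F' w)) = inner (g b) (sh j w)" for b j w
      by (simp add: g_def inner_mult[OF F] mult_sh F')
    have z: "inner (g b) (sh j u) = 0" "inner (g b) (sh j (im u)) = 0" for b j
    proof -
      \<comment> \<open>For j \<ge> 0 the function z^j w is analytic while \<open>g b\<close> is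
        antianalytic. For j < 0 the adjoint of \<open>F\<close> moves the product to f b, where z^j
        F^* w is antianalytic.\<close>
      have *: "inner (g b) (sh j w) = 0" if "w \<in> H2s" "mult ?F' w \<in> H2ms" for w
      proof (cases "j \<ge> 0")
        case True
        then show ?thesis using H2s_orthogonal_H2ms[OF sh_H2s[OF that(1) True] g(3)[of b]] by (simp add: inner_commute)
      next
        case False
        then show ?thesis using H2s_orthogonal_H2ms[OF fH[of b] sh_H2ms[OF that(2), of j]] FF by simp
      qed
      show "inner (g b) (sh j u) = 0" by (rule *[OF u])
      show "inner (g b) (sh j (im u)) = 0" using u by (intro *) (auto simp: im_H2s mult_im F' im_H2ms)
    qed
    have cg: "AE t in Tm. cip (g b) u t = 0" for b by (rule cip_zero) (rule z)+
    have cf: "AE t in Tm. cip (f b) h t = 0" for b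
    proof (rule cip_zero)
      show "inner (f b) (sh j h) = 0" for j by (simp add: h_def FF z)
      show "inner (f b) (sh j (im h)) = 0" for j
        using FF[of b j "im u"] by (simp add: h_def z mult_im F')
    qed
    \<comment> \<open>Orthogonality to the \<open>f b\<close> kills h, and u = F h by unitarity;
      orthogonality to the \<open>g b\<close> kills u directly.\<close>
    show "u = 0"
    proof (cases "\<forall>b. coef 0 (f b) = axis b 1")
      case True
      then have "h = 0" using orthogonal_to_spanning_zero[of f h] fH cf by blast
      then show ?thesis
        using mult_unitary_cancel[OF F uni, of u] bl_zero[OF bounded_linear_mult[OF F]]
        by (simp add: h_def)
    next
      case False
      then have "coef (-1) (g b) = axis b 1" for b using fspan g(1) by metis
      then show ?thesis using orthogonal_to_spanning_minus_zero[of g u] g(3) cg by blast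
    qed
  qed
  have "(\<lambda>x. hk F (Pp x)) = (\<lambda>x. hk ?A (Pp x))" by (simp add: hkF)
  then have essF: "ess_contracts \<theta> (\<lambda>x. hk F (Pp x))" using essA by simp
  obtain \<gamma> where \<gamma>: "0 \<le> \<gamma>" "\<gamma> < 1" "\<And>x. x \<in> H2s \<Longrightarrow> norm (hk ?F' x) \<le> \<gamma> * norm x"
    using hk_cadj_contractive[OF F uni essF ess(2,3) inj] by blast
  show thesis by (rule that[OF F uni co \<gamma>])
qed

section \<open>Operators on function representatives\<close>

lemma H2_L2: "f \<in> H2 \<Longrightarrow> f \<in> L2" by (simp add: H2_def)
lemma cls_H2s: "f \<in> H2 \<Longrightarrow> cls f \<in> H2s" by (simp add: H2_def H2s_def coef_cls)
lemma rep_H2: "x \<in> H2s \<Longrightarrow> rep x \<in> H2" by (simp add: H2_def H2s_def coef_def)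
lemma H2I: "f \<in> L2 \<Longrightarrow> cls f \<in> H2s \<Longrightarrow> f \<in> H2" by (simp add: H2_def H2s_def coef_cls)
lemma H2minusI: "f \<in> L2 \<Longrightarrow> cls f \<in> H2ms \<Longrightarrow> f \<in> H2minus" by (simp add: H2minus_def H2ms_def coef_cls)
lemma H2minus_L2: "f \<in> H2minus \<Longrightarrow> f \<in> L2" by (simp add: H2minus_def)

text \<open>The choice in \<open>Pminus\<close> is determined only up to null functions, so it is
  identified through its class.\<close>

lemma Pminus_L2:
  assumes g: "g \<in> L2" shows "Pminus g \<in> L2" "cls (Pminus g) = Pm (cls g)"
proof -
  have "rep (Pm (cls g)) \<in> H2minus \<and> (\<forall>j<0. fcoef (rep (Pm (cls g))) j = fcoef g j)"
    using Pm_H2ms[of "cls g"] by (auto intro!: H2minusI simp: coef_def[symmetric] coef_Pm coef_cls[OF g])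
  then have P: "Pminus g \<in> H2minus \<and> (\<forall>j<0. fcoef (Pminus g) j = fcoef g j)"
    unfolding Pminus_def by (rule someI[of "\<lambda>h. h \<in> H2minus \<and> (\<forall>j<0. fcoef h j = fcoef g j)"])
  then show L: "Pminus g \<in> L2" by (simp add: H2minus_def)
  show "cls (Pminus g) = Pm (cls g)"
    using P by (intro Pm_eqI[symmetric]) (auto simp: H2ms_def H2minus_def coef_cls[OF L] coef_cls[OF g])
qed

lemma hankel_L2:
  assumes "A \<in> Linf" "f \<in> L2"
  shows "hankel A f \<in> L2" "cls (hankel A f) = hk A (cls f)"
  unfolding hankel_def using Pminus_L2[OF mult_L2[OF assms]] by (simp_all add: hk_def mult_cls[OF assms])

lemma zero_H2: "(\<lambda>t. 0) \<in> H2"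
  by (rule H2I[OF L2_zero]) (simp add: cls_zero subspace_0[OF subspace_H2s])

lemma L2norm_zero: "L2norm (\<lambda>t. 0) = 0" by (simp add: L2norm_def)

section \<open>Operator norms as real suprema\<close>

lemma opnorm_le:
  assumes "\<And>f. f \<in> H2 \<Longrightarrow> L2norm f \<le> 1 \<Longrightarrow> L2norm (T f) \<le> c" shows "opnorm T \<le> c"
  unfolding opnorm_def
proof (rule cSup_least)
  show "{L2norm (T f) | f. f \<in> H2 \<and> L2norm f \<le> 1} \<noteq> {}"
    using zero_H2 L2norm_zero by (metis (mono_tags, lifting) empty_iff mem_Collect_eq zero_le_one)
qed (use assms in auto)

text \<open>A real \<open>Sup\<close> says something only about bounded sets, so the bound c is
  carried along as an assumption.\<close>

lemma le_opnorm:
  assumes "\<And>f. f \<in> H2 \<Longrightarrow> L2norm f \<le> 1 \<Longrightarrow> L2norm (T f) \<le> c" "f \<in> H2" "L2norm f \<le> 1"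
  shows "L2norm (T f) \<le> opnorm T"
  unfolding opnorm_def by (rule cSup_upper) (use assms in \<open>auto simp: bdd_above_def\<close>)

lemma L2norm_nonneg: "L2norm f \<ge> 0"
  by (simp add: L2norm_def)

lemma opnorm_nonneg:
  assumes "\<And>f. f \<in> H2 \<Longrightarrow> L2norm f \<le> 1 \<Longrightarrow> L2norm (T f) \<le> c" shows "opnorm T \<ge> 0"
  using le_opnorm[of T c, OF assms zero_H2] L2norm_zero L2norm_nonneg order_trans by (metis zero_le_one)

lemma hankel_bounded:
  fixes A :: "real \<Rightarrow> complex^'n^'n"
  assumes A: "A \<in> Linf"
  obtains c where "\<And>f. f \<in> H2 \<Longrightarrow> L2norm f \<le> 1 \<Longrightarrow> L2norm (hankel A f) \<le> c"
proof -
  obtain K where K: "K > 0" "\<And>x. norm (hk A x) \<le> norm x * K"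
    using bounded_linear.pos_bounded[OF bounded_linear_hk[OF A]] by blast
  show thesis
  proof (rule that[of K])
    fix f :: "real \<Rightarrow> complex^'n" assume f: "f \<in> H2" "L2norm f \<le> 1"
    have "L2norm (hankel A f) = norm (hk A (cls f))"
      using hankel_L2[OF A H2_L2[OF f(1)]] norm_cls by metis
    also have "\<dots> \<le> norm (cls f) * K" by (rule K)
    also have "\<dots> \<le> 1 * K" using f K norm_cls[OF H2_L2[OF f(1)]] by (intro mult_right_mono) auto
    finally show "L2norm (hankel A f) \<le> K" by simp
  qed
qed

lemma opnorm_hankel_le_1_iff:
  fixes A :: "real \<Rightarrow> complex^'n^'n"
  assumes A: "A \<in> Linf"
  shows "opnorm (hankel A) \<le> 1 \<longleftrightarrow> (\<forall>x\<in>H2s. norm (hk A x) \<le> norm x)"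
proof
  assume le: "opnorm (hankel A) \<le> 1"
  obtain c where c: "\<And>f. f \<in> H2 \<Longrightarrow> L2norm f \<le> 1 \<Longrightarrow> L2norm (hankel A f) \<le> c"
    using hankel_bounded[OF A] by blast
  show "\<forall>x\<in>H2s. norm (hk A x) \<le> norm x"
  proof
    fix x :: "'n lsq" assume x: "x \<in> H2s"
    show "norm (hk A x) \<le> norm x"
    proof (cases "x = 0")
      case False
      define y where "y = x /\<^sub>R norm x"
      have y: "y \<in> H2s" "norm y = 1" using x False by (auto simp: y_def intro!: subspace_scale[OF subspace_H2s])
      have "norm (hk A y) = L2norm (hankel A (rep y))"
        using hankel_L2[OF A rep_L2[of y]] norm_cls by (metis cls_rep)
      also have "\<dots> \<le> opnorm (hankel A)"
        using y norm_cls[OF rep_L2[of y]] by (intro le_opnorm[OF c] rep_H2) auto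
      finally have "norm (hk A y) \<le> 1" using le by simp
      moreover have "hk A y = hk A x /\<^sub>R norm x"
        unfolding y_def by (rule bl_scaleR[OF bounded_linear_hk[OF A]])
      ultimately show ?thesis using False by (simp add: field_simps)
    qed (simp add: bl_zero[OF bounded_linear_hk[OF A]])
  qed
next
  assume le: "\<forall>x\<in>H2s. norm (hk A x) \<le> norm x"
  show "opnorm (hankel A) \<le> 1"
  proof (rule opnorm_le)
    fix f :: "real \<Rightarrow> complex^'n" assume f: "f \<in> H2" "L2norm f \<le> 1"
    have "L2norm (hankel A f) = norm (hk A (cls f))"
      using hankel_L2[OF A H2_L2[OF f(1)]] norm_cls by metis
    also have "\<dots> \<le> norm (cls f)" using le cls_H2s[OF f(1)] by blast
    finally show "L2norm (hankel A f) \<le> 1" using f norm_cls[OF H2_L2[OF f(1)]] by simp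
  qed
qed

lemma L2_cscale: "f \<in> L2 \<Longrightarrow> (\<lambda>t. c *s f t) \<in> L2"
  using mult_L2[OF Linf_const[of "mat c"], of f] by (simp add: mat_vector)

lemma cls_cscale:
  assumes "f \<in> L2" shows "cls (\<lambda>t. c *s f t) = Re c *\<^sub>R cls f + Im c *\<^sub>R im (cls f)"
proof -
  have "AE t in Tm. c *s f t = rep (Re c *\<^sub>R cls f + Im c *\<^sub>R im (cls f)) t"
    using rep_add[of "Re c *\<^sub>R cls f" "Im c *\<^sub>R im (cls f)"] rep_scaleR[of "Re c" "cls f"]
      rep_scaleR[of "Im c" "im (cls f)"] rep_im[of "cls f"] rep_cls[OF assms]
    by eventually_elim (subst ii_vector_scale, simp)
  then show ?thesis
    using cls_eq_iff[OF L2_cscale[OF assms] rep_L2] by simp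
qed

lemma H2_combination:
  assumes "f \<in> H2" "g \<in> H2" shows "(\<lambda>t. c *s f t + g t) \<in> H2"
proof (rule H2I)
  show "(\<lambda>t. c *s f t + g t) \<in> L2" by (intro L2_add L2_cscale H2_L2 assms)
  have "cls (\<lambda>t. c *s f t + g t) = Re c *\<^sub>R cls f + Im c *\<^sub>R im (cls f) + cls g"
    using assms by (simp add: cls_add L2_cscale H2_L2 cls_cscale)
  also have "\<dots> \<in> H2s"
    using assms by (intro subspace_add[OF subspace_H2s] subspace_scale[OF subspace_H2s] im_H2s cls_H2s)
  finally show "cls (\<lambda>t. c *s f t + g t) \<in> H2s" .
qed

section \<open>Compact operators and the essential norm\<close>

lemma compact_op_L2: "compact_op K \<Longrightarrow> f \<in> H2 \<Longrightarrow> K f \<in> L2"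
  by (simp add: compact_op_def H2minus_L2)

lemma compact_op_linear:
  assumes K: "compact_op K" and "f \<in> H2" "g \<in> H2"
  shows "cls (K (\<lambda>s. of_real c *s f s + g s)) = c *\<^sub>R cls (K f) + cls (K g)"
proof -
  have L: "K f \<in> L2" "K g \<in> L2" "K (\<lambda>s. of_real c *s f s + g s) \<in> L2"
    by (intro compact_op_L2[OF K] assms H2_combination)+
  have ae: "AE t in Tm. K (\<lambda>s. of_real c *s f s + g s) t = of_real c *s K f t + K g t"
    using K assms by (simp add: compact_op_def)
  have "cls (K (\<lambda>s. of_real c *s f s + g s)) = cls (\<lambda>t. of_real c *s K f t + K g t)"
    using ae by (subst cls_eq_iff) (auto intro!: L L2_add L2_cscale)
  then show ?thesis using L by (simp add: cls_add L2_cscale cls_cscale)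
qed

text \<open>Unit vectors with images of norm above k would have no subsequence with Cauchy images.
  The bound makes the suprema in the definition of the essential norm meaningful.\<close>

lemma compact_op_bounded:
  assumes K: "compact_op K"
  obtains B where "\<And>f. f \<in> H2 \<Longrightarrow> L2norm f \<le> 1 \<Longrightarrow> L2norm (K f) \<le> B"
proof (rule ccontr)
  assume neg: "\<not> thesis"
  have "\<forall>k::nat. \<exists>f. f \<in> H2 \<and> L2norm f \<le> 1 \<and> L2norm (K f) > real k"
    using neg that by (meson not_le)
  from choice[OF this] obtain u where u: "\<forall>k. u k \<in> H2 \<and> L2norm (u k) \<le> 1 \<and> L2norm (K (u k)) > real k" ..
  then have "\<exists>r::nat\<Rightarrow>nat. strict_mono r \<and> (\<forall>e>0. \<exists>N. \<forall>p\<ge>N. \<forall>q\<ge>N.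
       L2norm (\<lambda>t. K (u (r p)) t - K (u (r q)) t) < e)"
    using K unfolding compact_op_def by (elim conjE allE[of _ u]) simp
  then obtain r where r: "strict_mono (r::nat\<Rightarrow>nat)"
    and "\<forall>e>0. \<exists>N. \<forall>p\<ge>N. \<forall>q\<ge>N. L2norm (\<lambda>t. K (u (r p)) t - K (u (r q)) t) < e" by blast
  then obtain N where N: "\<forall>p\<ge>N. \<forall>q\<ge>N. L2norm (\<lambda>t. K (u (r p)) t - K (u (r q)) t) < 1"
    using zero_less_one by blast
  have L: "K (u k) \<in> L2" for k using u by (intro compact_op_L2[OF K]) auto
  define x where "x k = cls (K (u (r k)))" for k
  obtain p where p: "p \<ge> N" "real p > 1 + norm (x N)"
    using reals_Archimedean2[of "1 + norm (x N)"] by (metis (no_types, opaque_lifting) le_cases le_less_trans less_le_trans of_nat_le_iff)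
  have "norm (x p - x N) < 1"
    using N p(1) norm_cls[OF L2_diff[OF L L], of "r p" "r N"] by (simp add: x_def cls_diff[OF L L])
  then have "norm (x p) < 1 + norm (x N)" using norm_triangle_sub[of "x p" "x N"] by simp
  moreover have "norm (x p) > real (r p)" using u norm_cls[OF L] by (simp add: x_def)
  moreover have "r p \<ge> p" by (rule seq_suble[OF r])
  ultimately show False using p(2) by linarith
qed

lemma zero_compact_op: "compact_op (\<lambda>f t. 0)"
  unfolding compact_op_def
proof (intro conjI ballI allI impI)
  show "(\<lambda>t. 0) \<in> H2minus"
    by (rule H2minusI[OF L2_zero]) (simp add: cls_zero subspace_0[OF subspace_H2ms])
  show "\<exists>r::nat\<Rightarrow>nat. strict_mono r \<and> (\<forall>e>0. \<exists>N. \<forall>p\<ge>N. \<forall>q\<ge>N. L2norm (\<lambda>t. (0::complex^'b) - 0) < e)"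
    by (intro exI[of _ id]) (auto simp: strict_mono_id L2norm_zero)
qed auto

lemma opnorm_diff_compact_bounded:
  fixes A :: "real \<Rightarrow> complex^'n^'n"
  assumes A: "A \<in> Linf" and K: "compact_op K"
  obtains c where "\<And>f. f \<in> H2 \<Longrightarrow> L2norm f \<le> 1 \<Longrightarrow> L2norm (\<lambda>t. hankel A f t - K f t) \<le> c"
proof -
  obtain a where a: "\<And>f. f \<in> H2 \<Longrightarrow> L2norm f \<le> 1 \<Longrightarrow> L2norm (hankel A f) \<le> a"
    using hankel_bounded[OF A] by blast
  obtain b where b: "\<And>f. f \<in> H2 \<Longrightarrow> L2norm f \<le> 1 \<Longrightarrow> L2norm (K f) \<le> b"
    using compact_op_bounded[OF K] by blast
  show thesis
  proof (rule that[of "a + b"])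
    fix f :: "real \<Rightarrow> complex^'n" assume f: "f \<in> H2" "L2norm f \<le> 1"
    have L: "hankel A f \<in> L2" "K f \<in> L2" using f by (auto intro: hankel_L2[OF A] H2_L2 compact_op_L2[OF K])
    have "L2norm (\<lambda>t. hankel A f t - K f t) = norm (cls (hankel A f) - cls (K f))"
      using norm_cls[OF L2_diff[OF L]] by (simp add: cls_diff[OF L])
    also have "\<dots> \<le> norm (cls (hankel A f)) + norm (cls (K f))" by (rule norm_triangle_ineq4)
    also have "\<dots> \<le> a + b" using a[OF f] b[OF f] by (simp add: norm_cls L)
    finally show "L2norm (\<lambda>t. hankel A f t - K f t) \<le> a + b" .
  qed
qed

lemma ess_norm_le:
  fixes A :: "real \<Rightarrow> complex^'n^'n"
  assumes A: "A \<in> Linf" and K: "compact_op K"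
    and le: "\<And>f. f \<in> H2 \<Longrightarrow> L2norm f \<le> 1 \<Longrightarrow> L2norm (\<lambda>t. hankel A f t - K f t) \<le> c"
  shows "ess_norm (hankel A) \<le> c"
proof -
  have "ess_norm (hankel A) \<le> opnorm (\<lambda>f t. hankel A f t - K f t)"
    unfolding ess_norm_def
  proof (rule cInf_lower)
    show "bdd_below {opnorm (\<lambda>f t. hankel A f t - K f t) | K. compact_op K}"
    proof (rule bdd_belowI[of _ 0])
      fix y assume "y \<in> {opnorm (\<lambda>f t. hankel A f t - K f t) | K. compact_op K}"
      then obtain K where y: "y = opnorm (\<lambda>f t. hankel A f t - K f t)" "compact_op K" by blast
      obtain c where "\<And>f. f \<in> H2 \<Longrightarrow> L2norm f \<le> 1 \<Longrightarrow> L2norm (\<lambda>t. hankel A f t - K f t) \<le> c"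
        using opnorm_diff_compact_bounded[OF A y(2)] by blast
      then show "0 \<le> y" unfolding y(1) by (rule opnorm_nonneg)
    qed
  qed (use K in blast)
  also have "\<dots> \<le> c" by (rule opnorm_le[OF le])
  finally show ?thesis .
qed

text \<open>Choose a compact K whose distance \<theta> from the Hankel operator is below 1. On u_p -
  u_q the Hankel operator exceeds the factor \<theta> by at most the norm of the K-image, which
  tends to zero along a subsequence.\<close>

lemma ess_norm_less_1D:
  fixes A :: "real \<Rightarrow> complex^'n^'n"
  assumes A: "A \<in> Linf" and ess: "ess_norm (hankel A) < 1"
  obtains \<theta> where "0 \<le> \<theta>" "\<theta> < 1" "ess_contracts \<theta> (\<lambda>x. hk A (Pp x))"
proof -
  have "{opnorm (\<lambda>f t. hankel A f t - K f t) | K. compact_op K} \<noteq> {}" using zero_compact_op by blast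
  from cInf_lessD[OF this ess[unfolded ess_norm_def]]
  obtain K where K: "compact_op K" and lt: "opnorm (\<lambda>f t. hankel A f t - K f t) < 1" by blast
  define \<theta> where "\<theta> = opnorm (\<lambda>f t. hankel A f t - K f t)"
  obtain c0 where c0: "\<And>f. f \<in> H2 \<Longrightarrow> L2norm f \<le> 1 \<Longrightarrow> L2norm (\<lambda>t. hankel A f t - K f t) \<le> c0"
    using opnorm_diff_compact_bounded[OF A K] by blast
  have \<theta>: "0 \<le> \<theta>" "\<theta> < 1" using opnorm_nonneg[of "\<lambda>f t. hankel A f t - K f t" c0, OF c0] lt by (auto simp: \<theta>_def)
  have lin: "hk A (r *\<^sub>R x) = r *\<^sub>R hk A x" "hk A (x + y) = hk A x + hk A y" for r x y
    using bl_scaleR[OF bounded_linear_hk[OF A]]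
      bl_add[OF bounded_linear_hk[OF A]] by auto
  have ball: "norm (hk A (cls f) - cls (K f)) \<le> \<theta>" if f: "f \<in> H2" "norm (cls f) \<le> 1" for f
  proof -
    have L: "hankel A f \<in> L2" "K f \<in> L2" using f by (auto intro: hankel_L2[OF A] H2_L2 compact_op_L2[OF K])
    have "L2norm (\<lambda>t. hankel A f t - K f t) = norm (hk A (cls f) - cls (K f))"
      using norm_cls[OF L2_diff[OF L]] by (simp add: cls_diff[OF L] hankel_L2[OF A H2_L2[OF f(1)]])
    then show ?thesis using le_opnorm[of "\<lambda>f t. hankel A f t - K f t" c0 f, OF c0 f(1)] f(2) norm_cls[OF H2_L2[OF f(1)]] by (simp add: \<theta>_def)
  qed
  have K0: "cls (K (\<lambda>t. 0)) = 0"
    using compact_op_linear[OF K zero_H2 zero_H2, of 1] by simp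
  have scaled: "c * norm (hk A (cls f) - cls (K f)) \<le> \<theta>" if f: "f \<in> H2" and c: "c \<ge> 0" "c * norm (cls f) \<le> 1" for c f
  proof -
    define h where "h t = of_real c *s f t + 0" for t
    have hH: "h \<in> H2" unfolding h_def by (rule H2_combination[OF f zero_H2])
    have ch: "cls h = c *\<^sub>R cls f"
      unfolding h_def using cls_cscale[OF H2_L2[OF f], of "of_real c"] by simp
    have "cls (K h) = c *\<^sub>R cls (K f)"
      unfolding h_def using compact_op_linear[OF K f zero_H2, of c] by (simp add: K0)
    then have "hk A (cls h) - cls (K h) = c *\<^sub>R (hk A (cls f) - cls (K f))"
      by (simp add: ch lin scaleR_diff_right)
    moreover have "norm (hk A (cls h) - cls (K h)) \<le> \<theta>" using c by (intro ball hH) (simp add: ch)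
    ultimately show ?thesis using c by simp
  qed
  have bound: "norm (hk A (cls f) - cls (K f)) \<le> \<theta> * norm (cls f)" if f: "f \<in> H2" for f
  proof (cases "cls f = 0")
    case False
    then show ?thesis using scaled[OF f, of "1 / norm (cls f)"] by (simp add: field_simps)
  next
    case True
    \<comment> \<open>K acts on functions, not on classes. If f vanishes almost everywhere, all its
      multiples stay in the unit ball, and a nonzero difference could be scaled up to norm 2, above
      \<theta>.\<close>
    let ?n = "norm (hk A (cls f) - cls (K f))"
    have "?n = 0"
    proof (rule ccontr)
      assume "?n \<noteq> 0"
      then have "?n > 0" by simp
      then have "(2 / ?n) * ?n \<le> \<theta>" using True by (intro scaled f) auto
      then show False using \<open>?n > 0\<close> \<theta> by simp
    qed
    then show ?thesis using True by simp
  qed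
  have "ess_contracts \<theta> (\<lambda>x. hk A (Pp x))"
    unfolding ess_contracts_def
  proof (intro allI impI)
    fix u :: "nat \<Rightarrow> 'n lsq" assume u: "\<forall>k. norm (u k) \<le> 1"
    define f where "f k = rep (Pp (u k))" for k
    have f: "f k \<in> H2" "cls (f k) = Pp (u k)" for k by (auto simp: f_def rep_H2)
    have "L2norm (f k) \<le> 1" for k
      using norm_cls[OF H2_L2[OF f(1)], of k] f(2)[of k] norm_Pp_le[of "u k"] u by (metis order_trans)
    then have "\<forall>k. f k \<in> H2 \<and> L2norm (f k) \<le> 1" using f by simp
    then have "\<exists>r::nat\<Rightarrow>nat. strict_mono r \<and> (\<forall>e>0. \<exists>N. \<forall>p\<ge>N. \<forall>q\<ge>N.
       L2norm (\<lambda>t. K (f (r p)) t - K (f (r q)) t) < e)"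
      using K unfolding compact_op_def by (elim conjE allE[of _ f]) simp
    then obtain r where r: "strict_mono (r::nat\<Rightarrow>nat)"
      and rK: "\<forall>e>0. \<exists>N. \<forall>p\<ge>N. \<forall>q\<ge>N. L2norm (\<lambda>t. K (f (r p)) t - K (f (r q)) t) < e" by blast
    have main: "norm (hk A (Pp (u p)) - hk A (Pp (u q))) \<le> \<theta> * norm (u p - u q) + L2norm (\<lambda>t. K (f p) t - K (f q) t)" for p q
    proof -
      define h where "h t = of_real (-1) *s f q t + f p t" for t
      have hH: "h \<in> H2" unfolding h_def by (rule H2_combination[OF f(1) f(1)])
      have ch: "cls h = Pp (u p - u q)"
      proof -
        have "cls h = cls (\<lambda>t. of_real (-1) *s f q t) + cls (f p)"
          unfolding h_def by (rule cls_add) (intro L2_cscale H2_L2 f)+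
        also have "\<dots> = Pp (u p) - Pp (u q)" using cls_cscale[OF H2_L2[OF f(1)], of "of_real (-1)" q] by (simp add: f)
        also have "\<dots> = Pp (u p - u q)" by (simp add: bl_diff[OF bounded_linear_Pp])
        finally show ?thesis .
      qed
      have cK: "cls (K h) = cls (K (f p)) - cls (K (f q))"
        unfolding h_def using compact_op_linear[OF K f(1) f(1), of "-1" q p] by simp
      have LK: "K (f p) \<in> L2" "K (f q) \<in> L2" by (intro compact_op_L2[OF K] f)+
      have eq: "hk A (Pp (u p)) - hk A (Pp (u q)) = hk A (cls h)"
        unfolding ch by (simp add: bl_diff[OF bounded_linear_Pp]
            bl_diff[OF bounded_linear_hk[OF A]])
      have "norm (hk A (cls h)) \<le> norm (cls (K h)) + norm (hk A (cls h) - cls (K h))" by (rule norm_triangle_sub)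
      moreover have "norm (hk A (cls h) - cls (K h)) \<le> \<theta> * norm (cls h)" by (rule bound[OF hH])
      moreover have "\<theta> * norm (cls h) \<le> \<theta> * norm (u p - u q)"
        unfolding ch using \<theta> by (intro mult_left_mono norm_Pp_le) auto
      moreover have "norm (cls (K h)) = L2norm (\<lambda>t. K (f p) t - K (f q) t)"
        unfolding cK using norm_cls[OF L2_diff[OF LK]] by (simp add: cls_diff[OF LK])
      ultimately show ?thesis unfolding eq by linarith
    qed
    have "\<exists>N. \<forall>p\<ge>N. \<forall>q\<ge>N. norm (hk A (Pp (u (r p))) - hk A (Pp (u (r q)))) \<le> \<theta> * norm (u (r p) - u (r q)) + e"
      if e: "e > 0" for e
    proof -
      obtain N where N: "\<forall>p\<ge>N. \<forall>q\<ge>N. L2norm (\<lambda>t. K (f (r p)) t - K (f (r q)) t) < e" using rK e by blast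
      have "\<forall>p\<ge>N. \<forall>q\<ge>N. norm (hk A (Pp (u (r p))) - hk A (Pp (u (r q)))) \<le> \<theta> * norm (u (r p) - u (r q)) + e"
      proof (intro allI impI)
        fix p q assume "p \<ge> N" "q \<ge> N"
        then have "L2norm (\<lambda>t. K (f (r p)) t - K (f (r q)) t) < e" using N by blast
        then show "norm (hk A (Pp (u (r p))) - hk A (Pp (u (r q)))) \<le> \<theta> * norm (u (r p) - u (r q)) + e"
          using main[of "r p" "r q"] by linarith
      qed
      then show ?thesis by blast
    qed
    then show "\<exists>r::nat\<Rightarrow>nat. strict_mono r \<and> (\<forall>e>0. \<exists>N. \<forall>p\<ge>N. \<forall>q\<ge>N.
       norm (hk A (Pp (u (r p))) - hk A (Pp (u (r q)))) \<le> \<theta> * norm (u (r p) - u (r q)) + e)"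
      using r by blast
  qed
  with \<theta> that show thesis by blast
qed

text \<open>Multiplying the symbol by \<open>z\<^sup>-\<^sup>1\<close> perturbs the (shifted) Hankel operator by a finite rank operator.\<close>

lemma ess_norm_backward_shift:
  fixes A :: "real \<Rightarrow> complex^'n^'n"
  assumes A: "A \<in> Linf" and le: "\<And>x. x \<in> H2s \<Longrightarrow> norm (hk A x) \<le> \<gamma> * norm x" and \<gamma>: "0 \<le> \<gamma>"
  shows "ess_norm (hankel (\<lambda>t. zpow (-1) t ** A t)) \<le> \<gamma>"
proof -
  have zA: "(\<lambda>t. zpow (-1) t ** A t) \<in> Linf" by (intro Linf_mult Linf_zpow A)
  \<comment> \<open>Multiplication by z^-1 moves exactly one new coefficient, that of index 0, into
    negative indices; \<open>K\<close> extracts it.\<close>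
  define w where "w f = coef 0 (mult A (cls f))" for f
  define K where "K f t = cis (of_int (-1) * t) *s w f" for f t
  have KL: "K f \<in> L2" for f unfolding K_def by (rule L2_mon)
  have cK: "cls (K f) = mon (-1) (w f)" for f unfolding K_def mon_def ..
  have mon_diff: "mon j a - mon j b = mon j (a - b)" for j and a b :: "complex^'n"
    by (rule lsq_eqI) (simp add: coef_diff coef_mon)
  have "compact_op K"
    unfolding compact_op_def
  proof (intro conjI ballI allI impI)
    show "K f \<in> H2minus" for f by (rule H2minusI[OF KL]) (simp add: cK mon_H2ms)
  next
    fix f g :: "real \<Rightarrow> complex^'n" and c assume fg: "f \<in> H2" "g \<in> H2"
    have "w (\<lambda>s. c *s f s + g s) = c *s w f + w g"
      unfolding w_def using fg
      by (subst ii_vector_scale)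
        (simp add: cls_add L2_cscale H2_L2 cls_cscale mult_add mult_scaleR mult_im A coef_add coef_scaleR)
    then show "AE t in Tm. K (\<lambda>s. c *s f s + g s) t = c *s K f t + K g t"
      by (simp add: K_def vec_eq_iff algebra_simps)
  next
    fix u :: "nat \<Rightarrow> real \<Rightarrow> complex^'n" assume u: "\<forall>k. u k \<in> H2 \<and> L2norm (u k) \<le> 1"
    obtain B where B: "B > 0" "\<And>x. norm (mult A x) \<le> norm x * B"
      using bounded_linear.pos_bounded[OF bounded_linear_mult[OF A]] by blast
    have "norm (w (u k)) \<le> B" for k
    proof -
      have "norm (w (u k)) \<le> norm (mult A (cls (u k)))" unfolding w_def by (rule norm_coef_le)
      also have "\<dots> \<le> norm (cls (u k)) * B" by (rule B)
      also have "\<dots> \<le> 1 * B" using u B norm_cls[OF H2_L2, of "u k"] by (intro mult_right_mono) auto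
      finally show ?thesis by simp
    qed
    then have "bounded (range (\<lambda>k. w (u k)))" by (auto simp: bounded_iff)
    then obtain l r where r: "strict_mono (r::nat\<Rightarrow>nat)" "(\<lambda>k. w (u (r k))) \<longlonglongrightarrow> l"
      using bounded_imp_convergent_subsequence[of "\<lambda>k. w (u k)"] by (auto simp: o_def)
    then have C: "Cauchy (\<lambda>k. w (u (r k)))" by (intro LIMSEQ_imp_Cauchy)
    have "L2norm (\<lambda>t. K (u p) t - K (u q) t) = norm (w (u p) - w (u q))" for p q
      using norm_cls[OF L2_diff[OF KL KL], of "u p" "u q"] by (simp add: cls_diff[OF KL KL] cK mon_diff)
    then show "\<exists>r::nat\<Rightarrow>nat. strict_mono r \<and> (\<forall>e>0. \<exists>N. \<forall>p\<ge>N. \<forall>q\<ge>N. L2norm (\<lambda>t. K (u (r p)) t - K (u (r q)) t) < e)"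
      using r(1) CauchyD[OF C] by (intro exI[of _ r]) auto
  qed
  then show ?thesis
  proof (rule ess_norm_le[OF zA])
    fix f :: "real \<Rightarrow> complex^'n" assume f: "f \<in> H2" "L2norm f \<le> 1"
    let ?x = "cls f"
    note L = hankel_L2[OF zA H2_L2[OF f(1)]]
    have "hk (\<lambda>t. zpow (-1) t ** A t) ?x = sh (-1) (hk A ?x) + mon (-1) (w f)"
      by (simp add: hk_def mult_zpow A Pm_backward_shift sh_add sh_mon w_def)
    then have "cls (hankel (\<lambda>t. zpow (-1) t ** A t) f) - cls (K f) = sh (-1) (hk A ?x)"
      by (simp add: L cK)
    then have "L2norm (\<lambda>t. hankel (\<lambda>t. zpow (-1) t ** A t) f t - K f t) = norm (hk A ?x)"
      using norm_cls[OF L2_diff[OF L(1) KL[of f]]] by (simp add: cls_diff[OF L(1) KL])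
    also have "\<dots> \<le> \<gamma> * norm ?x" by (rule le[OF cls_H2s[OF f(1)]])
    also have "\<dots> \<le> \<gamma>" using f(2) \<gamma> norm_cls[OF H2_L2[OF f(1)]] by (simp add: mult_left_le)
    finally show "L2norm (\<lambda>t. hankel (\<lambda>t. zpow (-1) t ** A t) f t - K f t) \<le> \<gamma>" .
  qed
qed

section \<open>Adjoints, powers of z and the interpolant\<close>

lemma cadj_mult: "cadj (A ** B) = cadj B ** cadj (A :: complex^'n^'n)"
  by (simp add: cadj_def matrix_matrix_mult_def vec_eq_iff mult.commute)

lemma cadj_zpow: "cadj (zpow j t) = zpow (- j) t"
  by (simp add: zpow_def cadj_mat cis_cnj)

lemma zpow_mult: "zpow i t ** zpow j t = zpow (i + j) t"
proof -
  have "(zpow i t ** zpow j t) *v x = zpow (i + j) t *v x" for x :: "complex^'a"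
    by (simp add: zpow_vector matrix_vector_mul_assoc[symmetric] vector_smult_assoc cis_mult algebra_simps)
  then show ?thesis by (simp add: matrix_eq)
qed

lemma zpow_commute: "zpow j t ** (A :: complex^'n^'n) = A ** zpow j t"
proof -
  have "(zpow j t ** A) *v x = (A ** zpow j t) *v x" for x
    by (simp add: zpow_vector matrix_vector_mul_assoc[symmetric] vec.scale)
  then show ?thesis by (simp add: matrix_eq)
qed

lemma unitary_mult:
  assumes "unitary_mat A" "unitary_mat B" shows "unitary_mat (A ** B)"
proof -
  have "(A ** B) ** cadj (A ** B) = A ** (B ** cadj B) ** cadj A"
    by (simp add: cadj_mult matrix_mul_assoc)
  moreover have "cadj (A ** B) ** (A ** B) = cadj B ** (cadj A ** A) ** B"
    by (simp add: cadj_mult matrix_mul_assoc)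
  ultimately show ?thesis using assms by (simp add: unitary_mat_def)
qed

lemma unitary_zpow: "unitary_mat (zpow j t)"
  by (simp add: unitary_mat_def cadj_zpow zpow_mult) (simp add: zpow_def)

theorem theorem3p1:
  fixes Phi :: "real \<Rightarrow> complex^'n^'n"
  assumes "Phi \<in> Linf"
    and "ess_norm (hankel Phi) < 1"
  shows "(\<exists>U. unitary_interpolant Phi U \<and> ess_norm (hankel (\<lambda>t. cadj (U t))) < 1)
         \<longleftrightarrow> opnorm (hankel Phi) \<le> 1"
proof
  assume "\<exists>U. unitary_interpolant Phi U \<and> ess_norm (hankel (\<lambda>t. cadj (U t))) < 1"
  then obtain U where U: "U \<in> Linf" "AE t in Tm. unitary_mat (U t)" "\<And>j. j < 0 \<Longrightarrow> mcoef U j = mcoef Phi j"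
    by (auto simp: unitary_interpolant_def)
  have "norm (hk Phi x) \<le> norm x" if x: "x \<in> H2s" for x
  proof -
    have "hk Phi x = hk U x" by (rule hk_cong[OF assms(1) U(1) _ x]) (simp add: U)
    then show ?thesis using norm_Pm_le[of "mult U x"] norm_mult_unitary[OF U(1,2), of x] by (simp add: hk_def)
  qed
  then show "opnorm (hankel Phi) \<le> 1" using opnorm_hankel_le_1_iff[OF assms(1)] by blast
next
  assume "opnorm (hankel Phi) \<le> 1"
  then have le: "norm (hk Phi x) \<le> norm x" if "x \<in> H2s" for x
    using opnorm_hankel_le_1_iff[OF assms(1)] that by blast
  obtain \<theta> where \<theta>: "0 \<le> \<theta>" "\<theta> < 1" "ess_contracts \<theta> (\<lambda>x. hk Phi (Pp x))"
    using ess_norm_less_1D[OF assms] by blast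
  show "\<exists>U. unitary_interpolant Phi U \<and> ess_norm (hankel (\<lambda>t. cadj (U t))) < 1"
  proof (rule unitary_extension[OF assms(1) le \<theta>(3,1,2)])
    fix C F \<gamma>
    assume F: "F \<in> Linf" "AE t in Tm. unitary_mat (F t)"
      and co: "\<And>j. j < 0 \<Longrightarrow> mcoef F j = mcoef (extend Phi C) j"
      and \<gamma>: "0 \<le> \<gamma>" "\<gamma> < 1" "\<And>x. x \<in> H2s \<Longrightarrow> norm (hk (\<lambda>t. cadj (F t)) x) \<le> \<gamma> * norm x"
    define U where "U t = zpow 1 t ** F t" for t
    have UL: "U \<in> Linf" unfolding U_def by (intro Linf_mult Linf_zpow F)
    have "AE t in Tm. unitary_mat (U t)"
      using F(2) by eventually_elim (simp add: U_def unitary_mult unitary_zpow)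
    moreover have "mcoef U j = mcoef Phi j" if j: "j < 0" for j
    proof -
      have "mcoef U j *v v = mcoef Phi j *v v" for v
      proof -
        have "mcoef U j *v v = coef (j - 1) (mult F (mon 0 v))"
          using mcoef_mult[OF UL, of j 0 v] by (simp add: U_def[abs_def] mult_zpow F)
        also have "\<dots> = coef (j - 1) (mult (extend Phi C) (mon 0 v))"
          using j by (simp add: mcoef_mult F Linf_extend assms co)
        \<comment> \<open>The z^-1 in \<open>extend\<close> cancels the index shift by one.
          \<open>C\<close> contributes at index 0 only, and j < 0.\<close>
        also have "\<dots> = coef j (mult Phi (mon 0 v))"
          using j by (simp add: mult_extend assms coef_add coef_mult_const coef_mon)
        also have "\<dots> = mcoef Phi j *v v" by (simp add: mcoef_mult assms)
        finally show ?thesis .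
      qed
      then show ?thesis by (simp add: matrix_eq)
    qed
    ultimately have "unitary_interpolant Phi U" using UL by (simp add: unitary_interpolant_def)
    \<comment> \<open>Taking adjoints turns the factor z of \<open>U\<close> into z^-1, so the bound
      for the strictly contractive Hankel operator of \<open>cadj (F t)\<close> survives as an
      essential one.\<close>
    moreover have "(\<lambda>t. cadj (U t)) = (\<lambda>t. zpow (-1) t ** cadj (F t))"
      by (simp add: U_def cadj_mult cadj_zpow zpow_commute)
    then have "ess_norm (hankel (\<lambda>t. cadj (U t))) < 1"
      using ess_norm_backward_shift[OF Linf_cadj[OF F(1)] \<gamma>(3,1)] \<gamma>(2) by simp
    ultimately show "\<exists>U. unitary_interpolant Phi U \<and> ess_norm (hankel (\<lambda>t. cadj (U t))) < 1" by blast
  qed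
qed

end
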